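(* Consider a 3-user CGZIC $Y_1=X_1+Z_1$, $Y_2=X_2+a_1X_1+Z_2$, $Y_3=X_3+a_2X_2+Z_3$ with gains $a_1,a_2\ge 0$ and power constraints $P_1,P_2,P_3$, and suppose $a_1<1$ and $\sqrt{\frac{1+P_3}{1+a_1^2P_1}}\le a_2<\sqrt{1+P_3}$. Then the sum capacity is \[ C_{\mathrm{sum}}=\mathcal{C}(P_1)+\mathcal{C}\!\left(\frac{P_2}{1+a_1^2P_1}\right)+\mathcal{C}(P_3). \]
   Context: The noises $Z_i\sim\mathcal N(0,1)$ are i.i.d. (independent across users and time), the channel is memoryless and real, user $i$ has average power constraint $P_i>0$, each receiver $i$ decodes only its own message from $Y_i^n$, and achievability is defined in the standard way. The sum capacity is the supremum of $R_1+R_2+R_3$ over the capacity region. $\mathcal{C}(x)=\tfrac12\log_2(1+x)$. *)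

theory Defs
  imports "HOL-Probability.Probability"
begin

text \<open>Users are indexed 0,1,2 (paper's users 1,2,3). Time indices t < n.\<close>

definition gcap :: "real \<Rightarrow> real" where
  "gcap x = 1/2 * log 2 (1 + x)"

definition noise :: "nat \<Rightarrow> (nat \<times> nat \<Rightarrow> real) measure" where
  "noise n = Pi\<^sub>M ({..<3} \<times> {..<n}) (\<lambda>_. density lborel std_normal_density)"

definition chan_out ::
  "real \<Rightarrow> real \<Rightarrow> nat \<Rightarrow> (nat \<Rightarrow> nat \<Rightarrow> nat \<Rightarrow> real) \<Rightarrow> (nat \<Rightarrow> nat)
     \<Rightarrow> (nat \<times> nat \<Rightarrow> real) \<Rightarrow> nat \<Rightarrow> (nat \<Rightarrow> real)" where
  "chan_out a1 a2 n enc m z i =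
     restrict (\<lambda>t. enc i (m i) t
        + (if i = 1 then a1 * enc 0 (m 0) t else if i = 2 then a2 * enc 1 (m 1) t else 0)
        + z (i, t)) {..<n}"

definition is_code ::
  "(nat \<Rightarrow> real) \<Rightarrow> nat \<Rightarrow> (nat \<Rightarrow> nat) \<Rightarrow> (nat \<Rightarrow> nat \<Rightarrow> nat \<Rightarrow> real)
     \<Rightarrow> (nat \<Rightarrow> (nat \<Rightarrow> real) \<Rightarrow> nat) \<Rightarrow> bool" where
  "is_code P n M enc dec \<longleftrightarrow>
     (\<forall>i<3. M i \<ge> 1) \<and>
     (\<forall>i<3. \<forall>m<M i. (\<Sum>t<n. (enc i m t)\<^sup>2) \<le> real n * P i) \<and>
     (\<forall>i<3. dec i \<in> measurable (Pi\<^sub>M {..<n} (\<lambda>_. borel)) (count_space UNIV))"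

definition error_prob ::
  "real \<Rightarrow> real \<Rightarrow> nat \<Rightarrow> (nat \<Rightarrow> nat) \<Rightarrow> (nat \<Rightarrow> nat \<Rightarrow> nat \<Rightarrow> real)
     \<Rightarrow> (nat \<Rightarrow> (nat \<Rightarrow> real) \<Rightarrow> nat) \<Rightarrow> real" where
  "error_prob a1 a2 n M enc dec =
     (1 / real (M 0 * M 1 * M 2)) *
     (\<Sum>m\<in>PiE {..<3} (\<lambda>i. {..<M i}).
        measure (noise n)
          {z \<in> space (noise n). \<exists>i<3. dec i (chan_out a1 a2 n enc m z i) \<noteq> m i})"

definition achievable :: "real \<Rightarrow> real \<Rightarrow> (nat \<Rightarrow> real) \<Rightarrow> (nat \<Rightarrow> real) \<Rightarrow> bool" where
  "achievable a1 a2 P R \<longleftrightarrow>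
     (\<forall>i<3. R i \<ge> 0) \<and>
     (\<forall>\<epsilon>>0. \<exists>N. \<forall>n\<ge>N. \<exists>M enc dec.
        is_code P n M enc dec \<and>
        (\<forall>i<3. real (M i) \<ge> 2 powr (real n * R i)) \<and>
        error_prob a1 a2 n M enc dec \<le> \<epsilon>)"

definition sum_capacity :: "real \<Rightarrow> real \<Rightarrow> (nat \<Rightarrow> real) \<Rightarrow> ereal" where
  "sum_capacity a1 a2 P = Sup {ereal (R 0 + R 1 + R 2) | R. achievable a1 a2 P R}"

end

theory Submission
  imports Defs
begin

text \<open>
  Achievability: with Gaussian codebooks of slightly reduced power, receiver 0 decodes over a clean channel
  and receiver 1 treats the interference as noise. The lower bound on \<open>a2\<close> is exactly what lets receiver 2
  decode the message of user 1 while treating its own signal as noise; it then subtracts the interference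
  and sees a clean channel. All error events are bounded by Chernoff's method.

  Converse: the rate of user 2 is at most its interference-free capacity. For users 0 and 1 the likelihood of the
  outputs given the messages is compared with the density \<open>q(y1) q(y0 | y1 - x1)\<close>, where \<open>q(y0 | s)\<close> is the
  conditional law of a Gaussian \<open>Y0\<close> of variance \<open>1 + P 0\<close> given its degraded version \<open>s\<close>. Summed over all
  message pairs, the mass of this density on the correct decoding events is at most 1, so the expected
  log-likelihood ratio bounds the sum rate (as in Fano's inequality); it is an explicit quadratic form that is
  maximal at full power because \<open>a1 < 1\<close>.
\<close>

section \<open>Converse\<close>

text \<open>The obstacle in the converse is that the codebooks are arbitrary, so output entropies
  have no closed form. Comparing with Gaussian reference laws that do not depend on the message
  being bounded avoids entropies: only second moments of the codewords enter. The second factor of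
  the reference density may use \<open>x1\<close>, since the correct event already fixes the message
  of user 1: for a fixed message of user 1 and a fixed \<open>y1\<close> it is one probability law
  of \<open>y0\<close>, so the disjoint decisions of receiver 0 share mass at most 1, and the
  decisions of receiver 1 then share the mass of \<open>y1\<close>. For achievability, codebook and
  noise form one array of independent standard normals. Every signal is then a linear form in the
  array, and a wrong codeword is independent of the received word because their coefficient vectors
  have disjoint supports. One parameter \<open>\<delta>\<close> pays for the power reduction, for
  the radii of the decoding balls and for the loss in the error exponents; it must fit into the gap
  between rate and capacity.\<close>

text \<open>Think of \<open>L k\<close> as the log-likelihood ratio of \<open>P k\<close> against a
  reference \<open>Q k\<close>, so that \<open>exp (- L k)\<close> is the density of
  \<open>Q k\<close> relative to \<open>P k\<close>. The assumption \<open>correct\<close> says that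
  under the references the average success probability is at most \<open>1 / M\<close>, as for blind
  guessing; divergence is then needed to do better. The term \<open>ln 2\<close> plays the role of
  the binary entropy in Fano's inequality.\<close>

lemma change_of_measure_fano:
  fixes P :: "'k \<Rightarrow> 'a measure" and L :: "'k \<Rightarrow> 'a \<Rightarrow> real" and M :: real
  assumes "finite K" and M: "M \<ge> 1"
    and prob: "\<And>k. k \<in> K \<Longrightarrow> prob_space (P k)"
    and int: "\<And>k. k \<in> K \<Longrightarrow> integrable (P k) (L k)"
    and C: "\<And>k. k \<in> K \<Longrightarrow> C k \<in> sets (P k)"
    and total: "\<And>k. k \<in> K \<Longrightarrow> (\<integral>\<^sup>+x. ennreal (exp (- L k x)) \<partial>P k) \<le> 1"
    and correct: "(\<Sum>k\<in>K. \<integral>\<^sup>+x. ennreal (exp (- L k x)) * indicator (C k) x \<partial>P k) \<le> ennreal (card K / M)"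
  shows "(\<Sum>k\<in>K. measure (P k) (C k)) * ln M \<le> (\<Sum>k\<in>K. \<integral>x. L k x \<partial>P k) + card K * ln 2"
proof -
  have meas: "L k \<in> borel_measurable (P k)" if "k \<in> K" for k
    using int[OF that] by auto
  have intE: "integrable (P k) (\<lambda>x. exp (- L k x))" if "k \<in> K" for k
    using total[OF that] meas[OF that] by (intro integrableI_nonneg) (auto simp: top.not_eq_extremum order_le_less_trans)
  have intEC: "integrable (P k) (\<lambda>x. exp (- L k x) * indicator (C k) x)" if "k \<in> K" for k
    using integrable_mult_indicator[OF C[OF that] intE[OF that]] by (simp add: mult.commute)
  have intC: "integrable (P k) (indicator (C k) :: _ \<Rightarrow> real)" if "k \<in> K" for k
  proof -
    interpret prob_space "P k" by (rule prob[OF that])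
    show ?thesis using C[OF that] by (auto simp: emeasure_eq_measure)
  qed
  have tot': "(\<integral>x. exp (- L k x) \<partial>P k) \<le> 1" if "k \<in> K" for k
    using total[OF that] nn_integral_eq_integral[OF intE[OF that]] by simp
  have cor': "(\<Sum>k\<in>K. \<integral>x. exp (- L k x) * indicator (C k) x \<partial>P k) \<le> card K / M"
  proof -
    have "(\<Sum>k\<in>K. \<integral>\<^sup>+x. ennreal (exp (- L k x)) * indicator (C k) x \<partial>P k)
        = (\<Sum>k\<in>K. ennreal (\<integral>x. exp (- L k x) * indicator (C k) x \<partial>P k))"
    proof (intro sum.cong refl)
      fix k assume k: "k \<in> K"
      have "(\<integral>\<^sup>+x. ennreal (exp (- L k x)) * indicator (C k) x \<partial>P k)
          = (\<integral>\<^sup>+x. ennreal (exp (- L k x) * indicator (C k) x) \<partial>P k)"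
        by (intro nn_integral_cong) (auto simp: indicator_def)
      also have "\<dots> = ennreal (\<integral>x. exp (- L k x) * indicator (C k) x \<partial>P k)"
        by (intro nn_integral_eq_integral intEC k) auto
      finally show "(\<integral>\<^sup>+x. ennreal (exp (- L k x)) * indicator (C k) x \<partial>P k) = \<dots>" .
    qed
    also have "\<dots> = ennreal (\<Sum>k\<in>K. (\<integral>x. exp (- L k x) * indicator (C k) x \<partial>P k))"
      by (intro sum_ennreal integral_nonneg_AE) auto
    finally show ?thesis using correct M by simp
  qed
  have point: "indicator (C k) x * ln M - L k x - ln 2
      \<le> (M * (exp (- L k x) * indicator (C k) x) + exp (- L k x)) / 2 - 1" for k x
  proof -
    \<comment> \<open>\<open>u\<close> is the density of an equal mixture of the reference and of
      the reference restricted to \<open>C k\<close> and scaled by \<open>M\<close>. Averaged over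
      \<open>k\<close> its mass is at most 1, so \<open>ln u \<le> u - 1\<close> costs nothing on
      average; the factor 1/2 of the mixture is the origin of \<open>ln 2\<close>.\<close>
    define u where "u = (M * indicator (C k) x + 1) * exp (- L k x) / 2"
    have p: "M * indicator (C k) x + 1 > 0" using M by (auto simp: indicator_def)
    have "ln u = ln (M * indicator (C k) x + 1) - L k x - ln 2"
      unfolding u_def using p by (simp add: ln_mult ln_div)
    moreover have "ln u \<le> u - 1" using p unfolding u_def by (intro ln_le_minus_one) simp
    moreover have "indicator (C k) x * ln M \<le> ln (M * indicator (C k) x + 1)"
      using M by (auto simp: indicator_def)
    ultimately show ?thesis unfolding u_def by (simp add: field_simps)
  qed
  have each: "measure (P k) (C k) * ln M - (\<integral>x. L k x \<partial>P k) - ln 2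
      \<le> (M * (\<integral>x. exp (- L k x) * indicator (C k) x \<partial>P k) + 1) / 2 - 1" if k: "k \<in> K" for k
  proof -
    interpret prob_space "P k" by (rule prob[OF k])
    have "measure (P k) (C k) * ln M - (\<integral>x. L k x \<partial>P k) - ln 2
        = (\<integral>x. indicator (C k) x * ln M - L k x - ln 2 \<partial>P k)"
      using int[OF k] intC[OF k] C[OF k] by (simp add: prob_space Int_absorb2 sets.sets_into_space)
    also have "\<dots> \<le> (\<integral>x. (M * (exp (- L k x) * indicator (C k) x) + exp (- L k x)) / 2 - 1 \<partial>P k)"
      using int[OF k] intC[OF k] intE[OF k] intEC[OF k]
      by (intro integral_mono point Bochner_Integration.integrable_diff integrable_mult_left
          integrable_divide Bochner_Integration.integrable_add integrable_mult_right) auto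
    also have "\<dots> = (M * (\<integral>x. exp (- L k x) * indicator (C k) x \<partial>P k) + (\<integral>x. exp (- L k x) \<partial>P k)) / 2 - 1"
      using intE[OF k] intEC[OF k] by (simp add: prob_space)
    also have "\<dots> \<le> (M * (\<integral>x. exp (- L k x) * indicator (C k) x \<partial>P k) + 1) / 2 - 1"
      by (intro diff_right_mono divide_right_mono add_left_mono tot' k) simp
    finally show ?thesis .
  qed
  have "(\<Sum>k\<in>K. measure (P k) (C k) * ln M - (\<integral>x. L k x \<partial>P k) - ln 2)
      \<le> (\<Sum>k\<in>K. (M * (\<integral>x. exp (- L k x) * indicator (C k) x \<partial>P k) + 1) / 2 - 1)"
    by (intro sum_mono each)
  also have "\<dots> = (M * (\<Sum>k\<in>K. \<integral>x. exp (- L k x) * indicator (C k) x \<partial>P k) + card K) / 2 - card K"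
    by (simp add: sum_subtractf sum.distrib sum_distrib_left flip: sum_divide_distrib)
  also have "\<dots> \<le> (M * (card K / M) + card K) / 2 - card K"
    using cor' M by (intro diff_right_mono divide_right_mono add_right_mono mult_left_mono) auto
  also have "\<dots> = 0" using M by simp
  finally show ?thesis
    by (simp add: sum_subtractf sum_distrib_right)
qed

section \<open>Gaussian vectors with common variance\<close>

definition lebesgue_vec :: "nat \<Rightarrow> (nat \<Rightarrow> real) measure" where
  "lebesgue_vec n = Pi\<^sub>M {..<n} (\<lambda>_. lborel)"

definition gauss_density :: "nat \<Rightarrow> (nat \<Rightarrow> real) \<Rightarrow> real \<Rightarrow> (nat \<Rightarrow> real) \<Rightarrow> real" where
  "gauss_density n \<mu> \<sigma> y = (\<Prod>t<n. normal_density (\<mu> t) \<sigma> (y t))"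

definition gauss :: "nat \<Rightarrow> (nat \<Rightarrow> real) \<Rightarrow> real \<Rightarrow> (nat \<Rightarrow> real) measure" where
  "gauss n \<mu> \<sigma> = density (lebesgue_vec n) (\<lambda>y. ennreal (gauss_density n \<mu> \<sigma> y))"

lemma sets_lebesgue_vec [measurable_cong]: "sets (lebesgue_vec n) = sets (Pi\<^sub>M {..<n} (\<lambda>_. borel))"
  unfolding lebesgue_vec_def by (intro sets_PiM_cong) auto

lemma sets_gauss [measurable_cong, simp]: "sets (gauss n \<mu> \<sigma>) = sets (Pi\<^sub>M {..<n} (\<lambda>_. borel))"
  unfolding gauss_def by (simp add: sets_lebesgue_vec)

lemma space_lebesgue_vec [simp]: "space (lebesgue_vec n) = ({..<n} \<rightarrow>\<^sub>E UNIV)"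
  by (simp add: lebesgue_vec_def space_PiM)

lemma space_gauss [simp]: "space (gauss n \<mu> \<sigma>) = ({..<n} \<rightarrow>\<^sub>E UNIV)"
  by (simp add: gauss_def)

lemma gauss_density_nonneg [simp]: "0 \<le> gauss_density n \<mu> \<sigma> y"
  unfolding gauss_density_def by (simp add: prod_nonneg)

lemma measurable_component_borel:
  assumes "t < n"
  shows "(\<lambda>y. y t) \<in> borel_measurable (Pi\<^sub>M {..<n} (\<lambda>_. borel))"
  using assms by (intro measurable_component_singleton) auto

lemma measurable_gauss_density:
  assumes "\<And>t. t < n \<Longrightarrow> (\<lambda>w. \<mu> w t) \<in> borel_measurable M"
    and "\<And>t. t < n \<Longrightarrow> (\<lambda>w. y w t) \<in> borel_measurable M"
  shows "(\<lambda>w. gauss_density n (\<mu> w) \<sigma> (y w)) \<in> borel_measurable M"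
  unfolding gauss_density_def
proof (intro borel_measurable_prod)
  fix t assume "t \<in> {..<n}"
  then have [measurable]: "(\<lambda>w. \<mu> w t) \<in> borel_measurable M" "(\<lambda>w. y w t) \<in> borel_measurable M"
    using assms by auto
  show "(\<lambda>w. normal_density (\<mu> w t) \<sigma> (y w t)) \<in> borel_measurable M"
    unfolding normal_density_def by measurable
qed

lemma measurable_gauss_density' [measurable]:
  "gauss_density n \<mu> \<sigma> \<in> borel_measurable (Pi\<^sub>M {..<n} (\<lambda>_. borel))"
  using measurable_gauss_density[of n "\<lambda>_. \<mu>" _ "\<lambda>y. y" \<sigma>]
  by (simp add: measurable_component_borel)

text \<open>Both descriptions are used: the density form for changes of measure, the product form
  for total mass and for the law of a single coordinate.\<close>

lemma gauss_eq_PiM: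
  assumes "\<sigma> > 0"
  shows "gauss n \<mu> \<sigma> = Pi\<^sub>M {..<n} (\<lambda>t. density lborel (normal_density (\<mu> t) \<sigma>))"
proof -
  interpret L: product_sigma_finite "\<lambda>_::nat. lborel :: real measure" ..
  have ps: "prob_space (density lborel (normal_density (\<mu> t) \<sigma>))" for t
    using assms by (rule prob_space_normal_density)
  interpret N: product_prob_space "\<lambda>t. density lborel (normal_density (\<mu> t) \<sigma>)"
    using ps by (simp add: product_prob_space_def product_prob_space_axioms_def product_sigma_finite_def
        prob_space_imp_sigma_finite)
  show ?thesis
  proof (rule N.PiM_eqI)
    show "sets (gauss n \<mu> \<sigma>) = sets (Pi\<^sub>M {..<n} (\<lambda>t. density lborel (normal_density (\<mu> t) \<sigma>)))"
      by (simp, intro sets_PiM_cong) auto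
  next
    fix A assume A: "\<And>i. i \<in> {..<n} \<Longrightarrow> A i \<in> sets (density lborel (normal_density (\<mu> i) \<sigma>))"
    then have A': "A i \<in> sets borel" if "i < n" for i using that by auto
    have "emeasure (gauss n \<mu> \<sigma>) (Pi\<^sub>E {..<n} A)
        = (\<integral>\<^sup>+y. ennreal (gauss_density n \<mu> \<sigma> y) * indicator (Pi\<^sub>E {..<n} A) y \<partial>lebesgue_vec n)"
      unfolding gauss_def
    proof (rule emeasure_density)
      show "(\<lambda>y. ennreal (gauss_density n \<mu> \<sigma> y)) \<in> borel_measurable (lebesgue_vec n)"
        by measurable
      show "Pi\<^sub>E {..<n} A \<in> sets (lebesgue_vec n)"
        unfolding lebesgue_vec_def using A' by (intro sets_PiM_I_finite) auto
    qed
    also have "\<dots> = (\<integral>\<^sup>+y. (\<Prod>t<n. ennreal (normal_density (\<mu> t) \<sigma> (y t)) * indicator (A t) (y t)) \<partial>lebesgue_vec n)"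
    proof (intro nn_integral_cong)
      fix y assume y: "y \<in> space (lebesgue_vec n)"
      have "indicator (Pi\<^sub>E {..<n} A) y = (\<Prod>t<n. indicator (A t) (y t) :: ennreal)"
      proof (cases "y \<in> Pi\<^sub>E {..<n} A")
        case False
        then obtain t where "t < n" "y t \<notin> A t" using y by (auto simp: PiE_iff)
        then show ?thesis using False by (auto intro!: prod_zero[symmetric] bexI[of _ t])
      qed (auto simp: PiE_iff)
      then show "ennreal (gauss_density n \<mu> \<sigma> y) * indicator (Pi\<^sub>E {..<n} A) y
          = (\<Prod>t<n. ennreal (normal_density (\<mu> t) \<sigma> (y t)) * indicator (A t) (y t))"
        by (simp add: gauss_density_def prod.distrib flip: prod_ennreal)
    qed
    also have "\<dots> = (\<Prod>t<n. \<integral>\<^sup>+x. ennreal (normal_density (\<mu> t) \<sigma> x) * indicator (A t) x \<partial>lborel)"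
      unfolding lebesgue_vec_def using A' by (intro L.product_nn_integral_prod) auto
    also have "\<dots> = (\<Prod>t<n. emeasure (density lborel (normal_density (\<mu> t) \<sigma>)) (A t))"
      using A' by (intro prod.cong refl emeasure_density[symmetric]) auto
    finally show "emeasure (gauss n \<mu> \<sigma>) (Pi\<^sub>E {..<n} A)
        = (\<Prod>i\<in>{..<n}. emeasure (density lborel (normal_density (\<mu> i) \<sigma>)) (A i))" .
  qed auto
qed

lemma prob_space_gauss: "\<sigma> > 0 \<Longrightarrow> prob_space (gauss n \<mu> \<sigma>)"
  by (auto simp: gauss_eq_PiM intro!: prob_space_PiM prob_space_normal_density)

lemma nn_integral_gauss_density:
  assumes "\<sigma> > 0"
  shows "(\<integral>\<^sup>+y. ennreal (gauss_density n \<mu> \<sigma> y) \<partial>lebesgue_vec n) = 1"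
proof -
  interpret prob_space "gauss n \<mu> \<sigma>" by (rule prob_space_gauss[OF assms])
  have "1 = emeasure (gauss n \<mu> \<sigma>) (space (gauss n \<mu> \<sigma>))" using emeasure_space_1 by simp
  also have "\<dots> = (\<integral>\<^sup>+y. ennreal (gauss_density n \<mu> \<sigma> y) \<partial>lebesgue_vec n)"
    unfolding gauss_def by (subst emeasure_density) (auto intro!: nn_integral_cong, measurable)
  finally show ?thesis by simp
qed

lemma sigma_finite_lebesgue_vec: "sigma_finite_measure (lebesgue_vec n)"
proof -
  interpret L: product_sigma_finite "\<lambda>_::nat. lborel :: real measure" ..
  show ?thesis unfolding lebesgue_vec_def by (rule L.sigma_finite) simp
qed

lemma gauss_component:
  assumes "\<sigma> > 0" "t < n"
  shows "distr (gauss n \<mu> \<sigma>) lborel (\<lambda>y. y t) = density lborel (normal_density (\<mu> t) \<sigma>)"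
proof -
  have "distr (gauss n \<mu> \<sigma>) lborel (\<lambda>y. y t)
      = distr (gauss n \<mu> \<sigma>) (density lborel (normal_density (\<mu> t) \<sigma>)) (\<lambda>y. y t)"
    by (intro distr_cong) auto
  also have "\<dots> = density lborel (normal_density (\<mu> t) \<sigma>)"
    unfolding gauss_eq_PiM[OF assms(1)] using assms
    by (intro distr_PiM_component prob_space_normal_density) auto
  finally show ?thesis .
qed

text \<open>The centre \<open>c\<close> is arbitrary because a log-likelihood ratio measures squared
  distances from two means, neither of which need be the mean of the law under which it is
  averaged.\<close>

lemma has_bochner_integral_normal_second_moment:
  assumes "\<sigma> > 0"
  shows "has_bochner_integral (density lborel (normal_density \<mu> \<sigma>)) (\<lambda>x. (x - c)\<^sup>2) (\<sigma>\<^sup>2 + (\<mu> - c)\<^sup>2)"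
proof -
  have "has_bochner_integral lborel (\<lambda>x. normal_density \<mu> \<sigma> x * (x - \<mu>)^2) (\<sigma>\<^sup>2)"
    using normal_moment_even[OF assms, of \<mu> 1] by (simp add: fact_numeral eval_nat_numeral)
  moreover have "has_bochner_integral lborel (\<lambda>x. normal_density \<mu> \<sigma> x * x) \<mu>"
    by (rule normal_moment_nz_1[OF assms])
  moreover have "has_bochner_integral lborel (normal_density \<mu> \<sigma>) 1"
    using assms by (auto simp: has_bochner_integral_iff)
  ultimately have "has_bochner_integral lborel
      (\<lambda>x. normal_density \<mu> \<sigma> x * (x - \<mu>)^2 + (2 * (\<mu> - c) * (normal_density \<mu> \<sigma> x * x)
         + (c\<^sup>2 - \<mu>\<^sup>2) * normal_density \<mu> \<sigma> x))
      (\<sigma>\<^sup>2 + (2 * (\<mu> - c) * \<mu> + (c\<^sup>2 - \<mu>\<^sup>2) * 1))"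
    by (intro has_bochner_integral_add has_bochner_integral_mult_right) auto
  moreover have "(\<lambda>x. normal_density \<mu> \<sigma> x * (x - \<mu>)^2 + (2 * (\<mu> - c) * (normal_density \<mu> \<sigma> x * x)
         + (c\<^sup>2 - \<mu>\<^sup>2) * normal_density \<mu> \<sigma> x)) = (\<lambda>x. normal_density \<mu> \<sigma> x *\<^sub>R (x - c)\<^sup>2)"
    by (simp add: fun_eq_iff power2_eq_square algebra_simps)
  moreover have "2 * (\<mu> - c) * \<mu> + (c\<^sup>2 - \<mu>\<^sup>2) * 1 = (\<mu> - c)\<^sup>2"
    by (simp add: power2_eq_square algebra_simps)
  ultimately show ?thesis
    by (intro has_bochner_integral_density) auto
qed

lemma gauss_second_moment:
  assumes "\<sigma> > 0" "t < n"
  shows "has_bochner_integral (gauss n \<mu> \<sigma>) (\<lambda>y. (y t - c)\<^sup>2) (\<sigma>\<^sup>2 + (\<mu> t - c)\<^sup>2)"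
proof -
  have "has_bochner_integral (distr (gauss n \<mu> \<sigma>) lborel (\<lambda>y. y t)) (\<lambda>x. (x - c)\<^sup>2) (\<sigma>\<^sup>2 + (\<mu> t - c)\<^sup>2)"
    using assms by (simp add: gauss_component has_bochner_integral_normal_second_moment)
  then show ?thesis using assms measurable_component_borel[of t n]
    by (simp add: has_bochner_integral_iff integrable_distr_eq integral_distr)
qed

text \<open>Bayes' rule for a Gaussian pair, proved by completing the square: \<open>y\<close> has
  variance \<open>A\<close>, and \<open>s\<close> is \<open>\<nu> + a * y\<close> plus noise of
  variance \<open>v\<close>. Read in the other order, \<open>s\<close> has variance
  \<open>B\<close>, and \<open>y\<close> given \<open>s\<close> has the linear estimate with gain
  \<open>a * A / B\<close> as mean and \<open>A * v / B\<close> as variance.\<close>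

lemma normal_density_swap:
  fixes A v a \<mu> \<nu> y s :: real
  assumes A: "A > 0" and v: "v > 0"
  defines "B \<equiv> a\<^sup>2 * A + v"
  shows "normal_density \<mu> (sqrt A) y * normal_density (\<nu> + a * y) (sqrt v) s
    = normal_density (\<nu> + a * \<mu>) (sqrt B) s
      * normal_density (\<mu> + a * A / B * (s - \<nu> - a * \<mu>)) (sqrt (A * v / B)) y"
proof -
  have B: "B > 0" unfolding B_def using A v by (intro add_nonneg_pos) auto
  define p q where "p = y - \<mu>" and "q = s - \<nu> - a * \<mu>"
  have e: "p\<^sup>2 / (2 * A) + (q - a * p)\<^sup>2 / (2 * v) = q\<^sup>2 / (2 * B) + (p - a * A / B * q)\<^sup>2 / (2 * (A * v / B))"
  proof -
    have "q\<^sup>2 / (2 * B) + (p - a * A / B * q)\<^sup>2 / (2 * (A * v / B))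
        = q\<^sup>2 / (2 * B) + B * (p - a * A / B * q)\<^sup>2 / (2 * A * v)" using A v B by (simp add: field_simps)
    also have "B * (p - a * A / B * q)\<^sup>2 = B * p\<^sup>2 - 2 * a * A * p * q + a\<^sup>2 * A\<^sup>2 * q\<^sup>2 / B"
      using B by (simp add: power2_eq_square field_simps)
    also have "q\<^sup>2 / (2 * B) + (B * p\<^sup>2 - 2 * a * A * p * q + a\<^sup>2 * A\<^sup>2 * q\<^sup>2 / B) / (2 * A * v)
        = (B * p\<^sup>2 - 2 * a * A * p * q + (A * v + a\<^sup>2 * A\<^sup>2) * q\<^sup>2 / B) / (2 * A * v)"
      using A v B by (simp add: field_simps)
    also have "A * v + a\<^sup>2 * A\<^sup>2 = A * B" unfolding B_def by (simp add: power2_eq_square algebra_simps)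
    also have "(B * p\<^sup>2 - 2 * a * A * p * q + (A * B) * q\<^sup>2 / B) / (2 * A * v)
        = (B * p\<^sup>2 - 2 * a * A * p * q + A * q\<^sup>2) / (2 * A * v)" using B by simp
    also have "\<dots> = p\<^sup>2 / (2 * A) + (q - a * p)\<^sup>2 / (2 * v)"
      unfolding B_def using A v by (simp add: power2_eq_square field_simps)
    finally show ?thesis by simp
  qed
  have s1: "s - (\<nu> + a * y) = q - a * p" "s - (\<nu> + a * \<mu>) = q" "y - \<mu> = p"
    "y - (\<mu> + a * A / B * (s - \<nu> - a * \<mu>)) = p - a * A / B * q"
    by (simp_all add: p_def q_def algebra_simps)
  have c: "(2 * pi * A) * (2 * pi * v) = (2 * pi * B) * (2 * pi * (A * v / B))" using B by simp
  have "normal_density \<mu> (sqrt A) y * normal_density (\<nu> + a * y) (sqrt v) s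
      = 1 / sqrt ((2 * pi * A) * (2 * pi * v)) * exp (- (p\<^sup>2 / (2 * A) + (q - a * p)\<^sup>2 / (2 * v)))"
  proof -
    have "1 / sqrt ((2 * pi * A) * (2 * pi * v)) * exp (- (p\<^sup>2 / (2 * A) + (q - a * p)\<^sup>2 / (2 * v)))
      = (1 / sqrt (2 * pi * A) * (1 / sqrt (2 * pi * v)))
      * (exp (- p\<^sup>2 / (2 * A)) * exp (- (q - a * p)\<^sup>2 / (2 * v)))"
      by (simp only: real_sqrt_mult exp_add[symmetric]) simp
    then show ?thesis using A v by (simp add: normal_density_def s1)
  qed
  also have "\<dots> = 1 / sqrt ((2 * pi * B) * (2 * pi * (A * v / B)))
      * exp (- (q\<^sup>2 / (2 * B) + (p - a * A / B * q)\<^sup>2 / (2 * (A * v / B))))" unfolding c e ..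
  also have "\<dots> = (1 / sqrt (2 * pi * B) * (1 / sqrt (2 * pi * (A * v / B))))
      * (exp (- q\<^sup>2 / (2 * B)) * exp (- (p - a * A / B * q)\<^sup>2 / (2 * (A * v / B))))"
    by (simp only: real_sqrt_mult exp_add[symmetric]) simp
  also have "\<dots> = normal_density (\<nu> + a * \<mu>) (sqrt B) s
      * normal_density (\<mu> + a * A / B * (s - \<nu> - a * \<mu>)) (sqrt (A * v / B)) y"
    using A v B by (simp only: normal_density_def s1 real_sqrt_pow2[OF less_imp_le[OF B]] real_sqrt_pow2[OF less_imp_le[OF divide_pos_pos[OF mult_pos_pos[OF A v] B]]]) simp
  finally show ?thesis .
qed

text \<open>A receiver sees one row of the noise array translated by a deterministic vector; the
  proof projects to the row and then translates each coordinate.\<close>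

lemma distr_noise_shift:
  assumes i: "i < 3"
  shows "distr (noise n) (Pi\<^sub>M {..<n} (\<lambda>_. borel)) (\<lambda>z. \<lambda>t\<in>{..<n}. \<mu> t + z (i, t)) = gauss n \<mu> 1"
proof -
  define N :: "real measure" where "N = density lborel std_normal_density"
  have pN: "prob_space N" unfolding N_def by (rule prob_space_normal_density) simp
  have sN [measurable_cong, simp]: "sets N = sets borel" unfolding N_def by simp
  have spN [simp]: "space N = UNIV" unfolding N_def by simp
  interpret NP: product_prob_space "\<lambda>_::nat. N" by (intro product_prob_spaceI pN)
  have ps: "prob_space (density lborel (normal_density (\<mu> t) 1))" for t
    by (rule prob_space_normal_density) simp
  interpret Q: product_prob_space "\<lambda>t. density lborel (normal_density (\<mu> t) 1)"
    by (intro product_prob_spaceI ps)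
  have shift: "distr N lborel (\<lambda>x. \<mu> t + x) = density lborel (normal_density (\<mu> t) 1)" for t
  proof -
    have "distributed N lborel (\<lambda>x. x) std_normal_density"
      unfolding distributed_def
      by (auto simp: N_def intro!: measure_eqI) (subst emeasure_distr, auto)
    from prob_space.normal_density_affine[OF pN this, of 1 "\<mu> t"] show ?thesis
      by (simp add: distributed_def)
  qed
  have re: "distr (noise n) (Pi\<^sub>M {..<n} (\<lambda>_. N)) (\<lambda>z. \<lambda>t\<in>{..<n}. z (i, t)) = Pi\<^sub>M {..<n} (\<lambda>_. N)"
    unfolding noise_def N_def[symmetric]
    using distr_PiM_reindex[of "{..<3} \<times> {..<n}" "\<lambda>_. N" "Pair i" "{..<n}"] pN i
    by (auto simp: inj_on_def)
  have m1: "(\<lambda>z. \<lambda>t\<in>{..<n}. z (i, t)) \<in> measurable (noise n) (Pi\<^sub>M {..<n} (\<lambda>_. N))"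
    unfolding noise_def N_def[symmetric] using i
    by (intro measurable_restrict measurable_component_singleton) auto
  have m2: "(\<lambda>w. \<lambda>t\<in>{..<n}. \<mu> t + w t) \<in> measurable (Pi\<^sub>M {..<n} (\<lambda>_. N)) (Pi\<^sub>M {..<n} (\<lambda>_. borel))"
    by (intro measurable_restrict borel_measurable_add borel_measurable_const)
       (auto simp: measurable_cong_sets[OF refl sN] intro: measurable_component_singleton)
  have "distr (noise n) (Pi\<^sub>M {..<n} (\<lambda>_. borel)) (\<lambda>z. \<lambda>t\<in>{..<n}. \<mu> t + z (i, t))
     = distr (distr (noise n) (Pi\<^sub>M {..<n} (\<lambda>_. N)) (\<lambda>z. \<lambda>t\<in>{..<n}. z (i, t)))
        (Pi\<^sub>M {..<n} (\<lambda>_. borel)) (\<lambda>w. \<lambda>t\<in>{..<n}. \<mu> t + w t)"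
    using m1 m2 by (subst distr_distr) (auto simp: comp_def intro!: distr_cong)
  also have "\<dots> = distr (Pi\<^sub>M {..<n} (\<lambda>_. N)) (Pi\<^sub>M {..<n} (\<lambda>_. borel)) (\<lambda>w. \<lambda>t\<in>{..<n}. \<mu> t + w t)"
    by (simp only: re)
  also have "\<dots> = gauss n \<mu> 1"
    unfolding gauss_eq_PiM[OF zero_less_one]
  proof (rule Q.PiM_eqI)
    show "sets (distr (Pi\<^sub>M {..<n} (\<lambda>_. N)) (Pi\<^sub>M {..<n} (\<lambda>_. borel)) (\<lambda>w. \<lambda>t\<in>{..<n}. \<mu> t + w t))
        = sets (Pi\<^sub>M {..<n} (\<lambda>t. density lborel (normal_density (\<mu> t) 1)))"
      by (simp, intro sets_PiM_cong) auto
  next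
    fix A assume "\<And>t. t \<in> {..<n} \<Longrightarrow> A t \<in> sets (density lborel (normal_density (\<mu> t) 1))"
    then have A: "A t \<in> sets borel" if "t < n" for t using that by auto
    have pre: "(\<lambda>x. \<mu> t + x) -` A t \<in> sets N" if "t < n" for t
      using measurable_sets[of "\<lambda>x. \<mu> t + x" borel borel "A t"] A[OF that] by simp
    have "emeasure (distr (Pi\<^sub>M {..<n} (\<lambda>_. N)) (Pi\<^sub>M {..<n} (\<lambda>_. borel)) (\<lambda>w. \<lambda>t\<in>{..<n}. \<mu> t + w t)) (Pi\<^sub>E {..<n} A)
       = emeasure (Pi\<^sub>M {..<n} (\<lambda>_. N)) ((\<lambda>w. \<lambda>t\<in>{..<n}. \<mu> t + w t) -` Pi\<^sub>E {..<n} A \<inter> space (Pi\<^sub>M {..<n} (\<lambda>_. N)))"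
      using m2 A by (intro emeasure_distr sets_PiM_I_finite) auto
    also have "(\<lambda>w. \<lambda>t\<in>{..<n}. \<mu> t + w t) -` Pi\<^sub>E {..<n} A \<inter> space (Pi\<^sub>M {..<n} (\<lambda>_. N))
       = Pi\<^sub>E {..<n} (\<lambda>t. (\<lambda>x. \<mu> t + x) -` A t)"
      by (auto simp: space_PiM PiE_iff)
    also have "emeasure (Pi\<^sub>M {..<n} (\<lambda>_. N)) \<dots> = (\<Prod>t<n. emeasure N ((\<lambda>x. \<mu> t + x) -` A t))"
      using pre by (intro NP.emeasure_PiM) auto
    also have "\<dots> = (\<Prod>t<n. emeasure (density lborel (normal_density (\<mu> t) 1)) (A t))"
    proof (intro prod.cong refl)
      fix t assume "t \<in> {..<n}"
      then show "emeasure N ((\<lambda>x. \<mu> t + x) -` A t) = emeasure (density lborel (normal_density (\<mu> t) 1)) (A t)"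
        using A[of t] by (subst shift[symmetric], subst emeasure_distr) auto
    qed
    finally show "emeasure (distr (Pi\<^sub>M {..<n} (\<lambda>_. N)) (Pi\<^sub>M {..<n} (\<lambda>_. borel)) (\<lambda>w. \<lambda>t\<in>{..<n}. \<mu> t + w t)) (Pi\<^sub>E {..<n} A)
       = (\<Prod>t\<in>{..<n}. emeasure (density lborel (normal_density (\<mu> t) 1)) (A t))" .
  qed auto
  finally show ?thesis .
qed

section \<open>Coupling of the outputs of receivers 0 and 1\<close>

text \<open>Only the marginals of the two outputs matter to the receivers. The noise of receiver 1 may thus be
  correlated with that of receiver 0 so that the interference plus noise at receiver 1 is a degraded
  version of the output of receiver 0.\<close>

definition coupled_outputs :: "nat \<Rightarrow> real \<Rightarrow> (nat \<Rightarrow> real) \<Rightarrow> (nat \<Rightarrow> real) \<Rightarrow> ((nat \<Rightarrow> real) \<times> (nat \<Rightarrow> real)) measure" where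
  "coupled_outputs n a x0 x1 = density (lebesgue_vec n \<Otimes>\<^sub>M lebesgue_vec n)
     (\<lambda>(y0, y1). ennreal (gauss_density n x0 1 y0 * gauss_density n (\<lambda>t. x1 t + a * y0 t) (sqrt (1 - a\<^sup>2)) y1))"

lemma sets_coupled_outputs [measurable_cong, simp]:
  "sets (coupled_outputs n a x0 x1) = sets (Pi\<^sub>M {..<n} (\<lambda>_. borel) \<Otimes>\<^sub>M Pi\<^sub>M {..<n} (\<lambda>_. borel))"
  unfolding coupled_outputs_def by (simp add: sets_lebesgue_vec cong: sets_pair_measure_cong)

lemma space_coupled_outputs [simp]:
  "space (coupled_outputs n a x0 x1) = space (Pi\<^sub>M {..<n} (\<lambda>_. borel) \<Otimes>\<^sub>M Pi\<^sub>M {..<n} (\<lambda>_. borel))"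
  by (intro sets_eq_imp_space_eq) simp

lemma measurable_pair_components:
  assumes "t < n"
  shows "(\<lambda>w. fst w t) \<in> borel_measurable (Pi\<^sub>M {..<n} (\<lambda>_. borel) \<Otimes>\<^sub>M N)"
    and "(\<lambda>w. snd w t) \<in> borel_measurable (N' \<Otimes>\<^sub>M Pi\<^sub>M {..<n} (\<lambda>_. borel))"
  using measurable_compose[OF measurable_fst measurable_component_borel[OF assms]]
    measurable_compose[OF measurable_snd measurable_component_borel[OF assms]] by auto

lemma gauss_density_swap:
  assumes "A > 0" "v > 0" "B = a\<^sup>2 * A + v"
  shows "gauss_density n x (sqrt A) y * gauss_density n (\<lambda>t. u t + a * y t) (sqrt v) s
    = gauss_density n (\<lambda>t. u t + a * x t) (sqrt B) s
      * gauss_density n (\<lambda>t. x t + a * A / B * (s t - u t - a * x t)) (sqrt (A * v / B)) y"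
  unfolding gauss_density_def prod.distrib[symmetric] assms(3)
  by (intro prod.cong refl normal_density_swap assms)

lemma nn_integral_coupled_outputs:
  assumes [measurable]: "F \<in> borel_measurable (Pi\<^sub>M {..<n} (\<lambda>_. borel) \<Otimes>\<^sub>M Pi\<^sub>M {..<n} (\<lambda>_. borel))"
  shows "(\<integral>\<^sup>+w. F w \<partial>coupled_outputs n a x0 x1)
    = (\<integral>\<^sup>+w. ennreal (gauss_density n x0 1 (fst w) * gauss_density n (\<lambda>t. x1 t + a * fst w t) (sqrt (1 - a\<^sup>2)) (snd w)) * F w
        \<partial>(lebesgue_vec n \<Otimes>\<^sub>M lebesgue_vec n))"
proof -
  have s: "sets (lebesgue_vec n \<Otimes>\<^sub>M lebesgue_vec n) = sets (Pi\<^sub>M {..<n} (\<lambda>_. borel) \<Otimes>\<^sub>M Pi\<^sub>M {..<n} (\<lambda>_. borel))"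
    by (simp add: sets_lebesgue_vec cong: sets_pair_measure_cong)
  have [measurable]: "(\<lambda>w. gauss_density n (\<lambda>t. x1 t + a * fst w t) (sqrt (1 - a\<^sup>2)) (snd w))
      \<in> borel_measurable (Pi\<^sub>M {..<n} (\<lambda>_. borel) \<Otimes>\<^sub>M Pi\<^sub>M {..<n} (\<lambda>_. borel))"
    by (intro measurable_gauss_density borel_measurable_add borel_measurable_times borel_measurable_const measurable_pair_components)
  show ?thesis
    unfolding coupled_outputs_def case_prod_beta
    by (rule nn_integral_density) (auto simp: measurable_cong_sets[OF s refl])
qed

text \<open>In the coupling \<open>y1\<close> is \<open>x1 + a * y0\<close> plus fresh noise of
  variance \<open>1 - a\<^sup>2\<close>. The first marginal appears by integrating out
  \<open>y1\<close>, the second by first rewriting the joint density with Bayes' rule and then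
  integrating out \<open>y0\<close>.\<close>

lemma distr_coupled_outputs:
  assumes a: "\<bar>a\<bar> < 1"
  shows "distr (coupled_outputs n a x0 x1) (Pi\<^sub>M {..<n} (\<lambda>_. borel)) fst = gauss n x0 1"
    and "distr (coupled_outputs n a x0 x1) (Pi\<^sub>M {..<n} (\<lambda>_. borel)) snd = gauss n (\<lambda>t. x1 t + a * x0 t) 1"
proof -
  interpret L: sigma_finite_measure "lebesgue_vec n" by (rule sigma_finite_lebesgue_vec)
  interpret LL: pair_sigma_finite "lebesgue_vec n" "lebesgue_vec n" ..
  have v: "1 - a\<^sup>2 > 0" using a by (simp add: abs_square_less_1)
  have s: "sets (lebesgue_vec n \<Otimes>\<^sub>M lebesgue_vec n) = sets (Pi\<^sub>M {..<n} (\<lambda>_. borel) \<Otimes>\<^sub>M Pi\<^sub>M {..<n} (\<lambda>_. borel))"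
    by (simp add: sets_lebesgue_vec cong: sets_pair_measure_cong)
  have m1 [measurable]: "(\<lambda>w. gauss_density n (\<lambda>t. x1 t + a * fst w t) (sqrt (1 - a\<^sup>2)) (snd w))
      \<in> borel_measurable (Pi\<^sub>M {..<n} (\<lambda>_. borel) \<Otimes>\<^sub>M Pi\<^sub>M {..<n} (\<lambda>_. borel))"
    by (intro measurable_gauss_density borel_measurable_add borel_measurable_times borel_measurable_const measurable_pair_components)
  have m2 [measurable]: "(\<lambda>w. gauss_density n (\<lambda>t. x0 t + a * (snd w t - x1 t - a * x0 t)) (sqrt (1 - a\<^sup>2)) (fst w))
      \<in> borel_measurable (Pi\<^sub>M {..<n} (\<lambda>_. borel) \<Otimes>\<^sub>M Pi\<^sub>M {..<n} (\<lambda>_. borel))"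
    by (intro measurable_gauss_density borel_measurable_add borel_measurable_diff borel_measurable_times borel_measurable_const measurable_pair_components)
  \<comment> \<open>With \<open>A = 1\<close> and \<open>v = 1 - a\<^sup>2\<close> the total
    variance \<open>B\<close> is 1: the scaled noise of receiver 0 and the fresh noise add up to the
    unit noise of receiver 1.\<close>
  have swap: "gauss_density n x0 1 y0 * gauss_density n (\<lambda>t. x1 t + a * y0 t) (sqrt (1 - a\<^sup>2)) y1
     = gauss_density n (\<lambda>t. x1 t + a * x0 t) 1 y1 * gauss_density n (\<lambda>t. x0 t + a * (y1 t - x1 t - a * x0 t)) (sqrt (1 - a\<^sup>2)) y0"
    for y0 y1
    using gauss_density_swap[of 1 "1 - a\<^sup>2" 1 a n x0 y0 x1 y1] v by simp
  show "distr (coupled_outputs n a x0 x1) (Pi\<^sub>M {..<n} (\<lambda>_. borel)) fst = gauss n x0 1"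
  proof (rule measure_eqI)
    fix S assume "S \<in> sets (distr (coupled_outputs n a x0 x1) (Pi\<^sub>M {..<n} (\<lambda>_. borel)) fst)"
    then have S [measurable]: "S \<in> sets (Pi\<^sub>M {..<n} (\<lambda>_. borel))" by simp
    have "emeasure (distr (coupled_outputs n a x0 x1) (Pi\<^sub>M {..<n} (\<lambda>_. borel)) fst) S
        = (\<integral>\<^sup>+w. indicator S (fst w) \<partial>coupled_outputs n a x0 x1)"
      by (subst nn_integral_indicator[symmetric], simp, subst nn_integral_distr) auto
    also have "\<dots> = (\<integral>\<^sup>+y0. \<integral>\<^sup>+y1. ennreal (gauss_density n x0 1 y0 * gauss_density n (\<lambda>t. x1 t + a * y0 t) (sqrt (1 - a\<^sup>2)) y1) * indicator S y0
        \<partial>lebesgue_vec n \<partial>lebesgue_vec n)"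
      by (subst nn_integral_coupled_outputs, measurable, subst L.nn_integral_fst[symmetric])
         (auto simp: measurable_cong_sets[OF s refl])
    also have "\<dots> = (\<integral>\<^sup>+y0. ennreal (gauss_density n x0 1 y0) * indicator S y0 * (\<integral>\<^sup>+y1. ennreal (gauss_density n (\<lambda>t. x1 t + a * y0 t) (sqrt (1 - a\<^sup>2)) y1)
        \<partial>lebesgue_vec n) \<partial>lebesgue_vec n)"
      by (intro nn_integral_cong, subst nn_integral_cmult[symmetric])
         (auto simp: ennreal_mult mult_ac intro!: nn_integral_cong, measurable)
    also have "\<dots> = emeasure (gauss n x0 1) S"
      using v unfolding gauss_def
      by (subst emeasure_density) (auto simp: nn_integral_gauss_density sets_lebesgue_vec, measurable)
    finally show "emeasure (distr (coupled_outputs n a x0 x1) (Pi\<^sub>M {..<n} (\<lambda>_. borel)) fst) S = emeasure (gauss n x0 1) S" .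
  qed simp
  show "distr (coupled_outputs n a x0 x1) (Pi\<^sub>M {..<n} (\<lambda>_. borel)) snd = gauss n (\<lambda>t. x1 t + a * x0 t) 1"
  proof (rule measure_eqI)
    fix S assume "S \<in> sets (distr (coupled_outputs n a x0 x1) (Pi\<^sub>M {..<n} (\<lambda>_. borel)) snd)"
    then have S [measurable]: "S \<in> sets (Pi\<^sub>M {..<n} (\<lambda>_. borel))" by simp
    have "emeasure (distr (coupled_outputs n a x0 x1) (Pi\<^sub>M {..<n} (\<lambda>_. borel)) snd) S
        = (\<integral>\<^sup>+w. indicator S (snd w) \<partial>coupled_outputs n a x0 x1)"
      by (subst nn_integral_indicator[symmetric], simp, subst nn_integral_distr) auto
    also have "\<dots> = (\<integral>\<^sup>+y1. \<integral>\<^sup>+y0. ennreal (gauss_density n (\<lambda>t. x1 t + a * x0 t) 1 y1 * gauss_density n (\<lambda>t. x0 t + a * (y1 t - x1 t - a * x0 t)) (sqrt (1 - a\<^sup>2)) y0) * indicator S y1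
        \<partial>lebesgue_vec n \<partial>lebesgue_vec n)"
      by (subst nn_integral_coupled_outputs, measurable, subst swap, subst LL.nn_integral_snd[symmetric])
         (auto simp: measurable_cong_sets[OF s refl] case_prod_beta')
    also have "\<dots> = (\<integral>\<^sup>+y1. ennreal (gauss_density n (\<lambda>t. x1 t + a * x0 t) 1 y1) * indicator S y1 * (\<integral>\<^sup>+y0. ennreal (gauss_density n (\<lambda>t. x0 t + a * (y1 t - x1 t - a * x0 t)) (sqrt (1 - a\<^sup>2)) y0)
        \<partial>lebesgue_vec n) \<partial>lebesgue_vec n)"
      by (intro nn_integral_cong, subst nn_integral_cmult[symmetric])
         (auto simp: ennreal_mult mult_ac intro!: nn_integral_cong, measurable)
    also have "\<dots> = emeasure (gauss n (\<lambda>t. x1 t + a * x0 t) 1) S"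
      using v unfolding gauss_def
      by (subst emeasure_density) (auto simp: nn_integral_gauss_density sets_lebesgue_vec, measurable)
    finally show "emeasure (distr (coupled_outputs n a x0 x1) (Pi\<^sub>M {..<n} (\<lambda>_. borel)) snd) S
      = emeasure (gauss n (\<lambda>t. x1 t + a * x0 t) 1) S" .
  qed simp
qed

lemma prob_space_coupled_outputs:
  assumes "\<bar>a\<bar> < 1" shows "prob_space (coupled_outputs n a x0 x1)"
proof (rule prob_space_distrD)
  show "fst \<in> measurable (coupled_outputs n a x0 x1) (Pi\<^sub>M {..<n} (\<lambda>_. borel))" by measurable
  show "prob_space (distr (coupled_outputs n a x0 x1) (Pi\<^sub>M {..<n} (\<lambda>_. borel)) fst)"
    unfolding distr_coupled_outputs(1)[OF assms] by (rule prob_space_gauss) simp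
qed

section \<open>Gaussian log-likelihood ratios and sums over messages\<close>

text \<open>The logarithm of the density with mean \<open>\<mu>\<close> and variance
  \<open>B\<close> over the density with mean \<open>\<nu>\<close> and variance \<open>D\<close>;
  \<open>B\<close> and \<open>D\<close> are variances, not deviations. It is quadratic in
  \<open>y\<close>, so its expectation involves second moments only.\<close>

definition gauss_llr :: "nat \<Rightarrow> real \<Rightarrow> (nat \<Rightarrow> real) \<Rightarrow> real \<Rightarrow> (nat \<Rightarrow> real) \<Rightarrow> (nat \<Rightarrow> real) \<Rightarrow> real" where
  "gauss_llr n B \<mu> D \<nu> y = (\<Sum>t<n. ln (D / B) / 2 - (y t - \<mu> t)\<^sup>2 / (2 * B) + (y t - \<nu> t)\<^sup>2 / (2 * D))"

lemma measurable_gauss_llr [measurable]: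
  "gauss_llr n B \<mu> D \<nu> \<in> borel_measurable (Pi\<^sub>M {..<n} (\<lambda>_. borel))"
  unfolding gauss_llr_def
  by (intro borel_measurable_sum borel_measurable_add borel_measurable_diff borel_measurable_divide
      borel_measurable_power borel_measurable_const measurable_component_borel) auto

lemma gauss_density_mult_exp_llr:
  assumes B: "B > 0" and D: "D > 0"
  shows "gauss_density n \<mu> (sqrt B) y * exp (- gauss_llr n B \<mu> D \<nu> y) = gauss_density n \<nu> (sqrt D) y"
proof -
  have "normal_density m (sqrt B) x * exp (- (ln (D / B) / 2 - (x - m)\<^sup>2 / (2 * B) + (x - k)\<^sup>2 / (2 * D)))
      = normal_density k (sqrt D) x" for m k x
  proof -
    have e: "exp (ln (D / B) / 2) = sqrt D / sqrt B"
    proof -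
      have "exp (ln (D / B) / 2) = sqrt (exp (ln (D / B)))"
        by (simp add: exp_half_le2 real_sqrt_unique[symmetric] flip: exp_of_nat_mult)
      then show ?thesis using B D by (simp add: real_sqrt_divide)
    qed
    have "- (ln (D / B) / 2 - (x - m)\<^sup>2 / (2 * B) + (x - k)\<^sup>2 / (2 * D))
        = (x - m)\<^sup>2 / (2 * B) + (- (x - k)\<^sup>2 / (2 * D)) - ln (D / B) / 2" by simp
    then have "exp (- (ln (D / B) / 2 - (x - m)\<^sup>2 / (2 * B) + (x - k)\<^sup>2 / (2 * D)))
        = exp ((x - m)\<^sup>2 / (2 * B)) * exp (- (x - k)\<^sup>2 / (2 * D)) / (sqrt D / sqrt B)"
      by (simp only: exp_diff exp_add e)
    then show ?thesis using B D
      by (simp add: normal_density_def real_sqrt_mult exp_minus field_simps)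
  qed
  then show ?thesis
    by (simp only: gauss_density_def gauss_llr_def sum_negf[symmetric] exp_sum[OF finite_lessThan] prod.distrib[symmetric])
qed

lemma gauss_llr_expectation:
  assumes "\<sigma> > 0"
  shows "has_bochner_integral (gauss n m \<sigma>) (gauss_llr n B \<mu> D \<nu>)
    (\<Sum>t<n. ln (D / B) / 2 - (\<sigma>\<^sup>2 + (m t - \<mu> t)\<^sup>2) / (2 * B) + (\<sigma>\<^sup>2 + (m t - \<nu> t)\<^sup>2) / (2 * D))"
proof -
  interpret prob_space "gauss n m \<sigma>" by (rule prob_space_gauss[OF assms])
  have c: "has_bochner_integral (gauss n m \<sigma>) (\<lambda>_. k) k" for k :: real
    by (simp add: has_bochner_integral_iff prob_space del: space_gauss)
  show ?thesis
    unfolding gauss_llr_def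
    by (intro has_bochner_integral_sum has_bochner_integral_add has_bochner_integral_diff c
        has_bochner_integral_divide_zero gauss_second_moment assms) auto
qed

definition messages :: "(nat \<Rightarrow> nat) \<Rightarrow> (nat \<Rightarrow> nat) set" where
  "messages M = Pi\<^sub>E {..<3} (\<lambda>i. {..<M i})"

lemma finite_messages [simp]: "finite (messages M)"
  unfolding messages_def by (intro finite_PiE) auto

lemma card_messages: "card (messages M) = M 0 * M 1 * M 2"
  by (simp add: messages_def card_PiE lessThan_nat_numeral numeral_3_eq_3 lessThan_Suc numeral_2_eq_2 mult_ac)

text \<open>Turns the sum over message triples into an iterated sum, whose order can be changed so
  that one message is summed out while the others stay fixed.\<close>

lemma sum_messages:
  "(\<Sum>m\<in>messages M. F (m 0) (m 1) (m 2)) = (\<Sum>i<M 0. \<Sum>j<M 1. \<Sum>k<M 2. F i j k)"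
proof -
  have two: "i = 2" if "i < 3" "i \<noteq> Suc 0" "0 < i" for i :: nat using that by auto
  have "(\<Sum>m\<in>messages M. F (m 0) (m 1) (m 2))
      = (\<Sum>(i, j, k)\<in>{..<M 0} \<times> {..<M 1} \<times> {..<M 2}. F i j k)"
  proof (rule sum.reindex_bij_witness[where
        i = "\<lambda>(i, j, k). (\<lambda>l\<in>{..<3}. if l = 0 then i else if l = 1 then j else k)"
        and j = "\<lambda>m. (m 0, m 1, m 2)"])
    fix m assume m: "m \<in> messages M"
    show "(case (m 0, m 1, m 2) of (i, j, k) \<Rightarrow> \<lambda>l\<in>{..<3}. if l = 0 then i else if l = 1 then j else k) = m"
    proof
      fix l :: nat
      have "l = 0 \<or> l = 1 \<or> l = 2 \<or> \<not> l < 3" by auto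
      then show "(case (m 0, m 1, m 2) of (i, j, k) \<Rightarrow> \<lambda>l\<in>{..<3}. if l = 0 then i else if l = 1 then j else k) l = m l"
        using m by (auto simp: messages_def PiE_iff extensional_def)
    qed
  qed (auto simp: messages_def PiE_iff dest: two split: if_splits)
  then show ?thesis by (simp add: sum.cartesian_product)
qed

lemma sum_indicator_le_1:
  fixes d :: "'a \<Rightarrow> nat"
  shows "(\<Sum>i<N. indicator {y. d y = i} x :: ennreal) \<le> 1"
proof -
  have "(\<Sum>i<N. indicator {y. d y = i} x :: ennreal) = (\<Sum>i<N. if d x = i then 1 else 0)"
    by (intro sum.cong) (auto simp: indicator_def)
  also have "\<dots> \<le> 1" by simp
  finally show ?thesis .
qed

section \<open>The two converse bounds\<close>

text \<open>The reference law is centred at the interference \<open>\<nu> m\<close> and has the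
  full-power variance \<open>1 + P 2\<close>, as if receiver 2 knew the message of user 1. It does
  not depend on \<open>m 2\<close>, so for fixed \<open>m 1\<close> the disjoint decisions of
  receiver 2 have total mass at most 1.\<close>

lemma single_user_converse:
  assumes pos: "P 2 > 0" and code: "is_code P n M enc dec"
  shows "(\<Sum>m\<in>messages M. measure (gauss n (\<lambda>t. enc 2 (m 2) t + a2 * enc 1 (m 1) t) 1)
        {y \<in> space (gauss n (\<lambda>t. enc 2 (m 2) t + a2 * enc 1 (m 1) t) 1). dec 2 y = m 2}) * ln (M 2)
     \<le> card (messages M) * (real n * (ln (1 + P 2) / 2) + ln 2)"
proof -
  define D where "D = 1 + P 2"
  have D: "D > 0" using pos by (simp add: D_def)
  have M: "M i \<ge> 1" if "i < 3" for i using code that by (auto simp: is_code_def)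
  have pow: "(\<Sum>t<n. (enc i k t)\<^sup>2) \<le> real n * P i" if "i < 3" "k < M i" for i k
    using code that by (auto simp: is_code_def)
  have dec [measurable]: "dec 2 \<in> measurable (Pi\<^sub>M {..<n} (\<lambda>_. borel)) (count_space UNIV)"
    using code by (auto simp: is_code_def)
  define \<nu> where "\<nu> m t = a2 * enc 1 (m 1) t" for m :: "nat \<Rightarrow> nat" and t
  define \<mu> where "\<mu> m t = enc 2 (m 2) t + \<nu> m t" for m :: "nat \<Rightarrow> nat" and t
  define L where "L m = gauss_llr n 1 (\<mu> m) D (\<nu> m)" for m
  define C where "C m = {y \<in> {..<n} \<rightarrow>\<^sub>E UNIV. dec 2 y = m 2}" for m :: "nat \<Rightarrow> nat"
  have Cs [measurable]: "C m \<in> sets (Pi\<^sub>M {..<n} (\<lambda>_. borel))" for m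
  proof -
    have "C m = {y \<in> space (Pi\<^sub>M {..<n} (\<lambda>_. borel)). dec 2 y = m 2}" by (simp add: C_def space_PiM)
    then show ?thesis by simp
  qed
  have change: "(\<integral>\<^sup>+y. ennreal (exp (- L m y)) * indicator S y \<partial>gauss n (\<mu> m) 1) = emeasure (gauss n (\<nu> m) (sqrt D)) S"
    if [measurable]: "S \<in> sets (Pi\<^sub>M {..<n} (\<lambda>_. borel))" for m S
  proof -
    have "(\<integral>\<^sup>+y. ennreal (exp (- L m y)) * indicator S y \<partial>gauss n (\<mu> m) 1)
        = (\<integral>\<^sup>+y. ennreal (gauss_density n (\<mu> m) 1 y) * (ennreal (exp (- L m y)) * indicator S y) \<partial>lebesgue_vec n)"
      unfolding gauss_def L_def by (intro nn_integral_density) measurable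
    also have "\<dots> = (\<integral>\<^sup>+y. ennreal (gauss_density n (\<nu> m) (sqrt D) y) * indicator S y \<partial>lebesgue_vec n)"
      using gauss_density_mult_exp_llr[OF zero_less_one D, of n "\<mu> m" _ "\<nu> m"]
      by (intro nn_integral_cong) (simp add: L_def ennreal_mult[symmetric] mult.assoc[symmetric])
    also have "\<dots> = emeasure (gauss n (\<nu> m) (sqrt D)) S"
      unfolding gauss_def by (subst emeasure_density) (auto simp: sets_lebesgue_vec, measurable)
    finally show ?thesis .
  qed
  have "(\<Sum>m\<in>messages M. measure (gauss n (\<mu> m) 1) (C m)) * ln (real (M 2))
      \<le> (\<Sum>m\<in>messages M. \<integral>y. L m y \<partial>gauss n (\<mu> m) 1) + card (messages M) * ln 2"
  proof (rule change_of_measure_fano)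
    show "real (M 2) \<ge> 1" using M[of 2] by simp
    show "prob_space (gauss n (\<mu> m) 1)" for m by (rule prob_space_gauss) simp
    show "integrable (gauss n (\<mu> m) 1) (L m)" for m
      unfolding L_def using gauss_llr_expectation[OF zero_less_one] by (auto simp: has_bochner_integral_iff)
    show "C m \<in> sets (gauss n (\<mu> m) 1)" for m by simp
    show "(\<integral>\<^sup>+y. ennreal (exp (- L m y)) \<partial>gauss n (\<mu> m) 1) \<le> 1" for m
    proof -
      interpret prob_space "gauss n (\<nu> m) (sqrt D)" using D by (intro prob_space_gauss) simp
      have "(\<integral>\<^sup>+y. ennreal (exp (- L m y)) \<partial>gauss n (\<mu> m) 1)
        = (\<integral>\<^sup>+y. ennreal (exp (- L m y)) * indicator (space (Pi\<^sub>M {..<n} (\<lambda>_. borel))) y \<partial>gauss n (\<mu> m) 1)"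
        by (intro nn_integral_cong) (simp add: space_PiM)
      also have "\<dots> \<le> 1" by (subst change) (auto intro: emeasure_le_1)
      finally show ?thesis .
    qed
    show "(\<Sum>m\<in>messages M. \<integral>\<^sup>+y. ennreal (exp (- L m y)) * indicator (C m) y \<partial>gauss n (\<mu> m) 1)
      \<le> ennreal (card (messages M) / real (M 2))"
    proof -
      have "(\<Sum>m\<in>messages M. \<integral>\<^sup>+y. ennreal (exp (- L m y)) * indicator (C m) y \<partial>gauss n (\<mu> m) 1)
          = (\<Sum>m\<in>messages M. emeasure (gauss n (\<nu> m) (sqrt D)) (C m))"
        by (simp add: change)
      also have "\<dots> = (\<Sum>m\<in>messages M. emeasure (gauss n (\<lambda>t. a2 * enc 1 (m 1) t) (sqrt D)) {y \<in> {..<n} \<rightarrow>\<^sub>E UNIV. dec 2 y = m 2})"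
        by (simp add: \<nu>_def[abs_def] C_def)
      also have "\<dots> = (\<Sum>i<M 0. \<Sum>j<M 1. \<Sum>k<M 2. emeasure (gauss n (\<lambda>t. a2 * enc 1 j t) (sqrt D)) {y \<in> {..<n} \<rightarrow>\<^sub>E UNIV. dec 2 y = k})"
        by (rule sum_messages[where F = "\<lambda>i j k. emeasure (gauss n (\<lambda>t. a2 * enc 1 j t) (sqrt D)) {y \<in> {..<n} \<rightarrow>\<^sub>E UNIV. dec 2 y = k}"])
      also have "\<dots> \<le> (\<Sum>i<M 0. \<Sum>j<M 1. 1)"
      proof (intro sum_mono)
        fix j
        interpret prob_space "gauss n (\<lambda>t. a2 * enc 1 j t) (sqrt D)" using D by (intro prob_space_gauss) simp
        have s: "{y \<in> {..<n} \<rightarrow>\<^sub>E UNIV. dec 2 y = k} \<in> sets (gauss n (\<lambda>t. a2 * enc 1 j t) (sqrt D))" for k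
          using Cs[of "\<lambda>_. k"] by (simp add: C_def)
        have "(\<Sum>k<M 2. emeasure (gauss n (\<lambda>t. a2 * enc 1 j t) (sqrt D)) {y \<in> {..<n} \<rightarrow>\<^sub>E UNIV. dec 2 y = k})
            = emeasure (gauss n (\<lambda>t. a2 * enc 1 j t) (sqrt D)) (\<Union>k<M 2. {y \<in> {..<n} \<rightarrow>\<^sub>E UNIV. dec 2 y = k})"
          using s by (intro sum_emeasure) (auto simp: disjoint_family_on_def)
        also have "\<dots> \<le> 1" by (rule emeasure_le_1)
        finally show "(\<Sum>k<M 2. emeasure (gauss n (\<lambda>t. a2 * enc 1 j t) (sqrt D)) {y \<in> {..<n} \<rightarrow>\<^sub>E UNIV. dec 2 y = k}) \<le> 1" .
      qed
      also have "\<dots> = ennreal (card (messages M) / real (M 2))"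
        using M[of 2] by (simp add: card_messages ennreal_of_nat_eq_real_of_nat flip: ennreal_mult)
      finally show ?thesis .
    qed
  qed simp
  also have "(\<Sum>m\<in>messages M. \<integral>y. L m y \<partial>gauss n (\<mu> m) 1) \<le> (\<Sum>m\<in>messages M. real n * (ln D / 2))"
  proof (intro sum_mono)
    fix m assume "m \<in> messages M"
    then have m: "m 2 < M 2" by (simp add: messages_def PiE_iff)
    have "(\<integral>y. L m y \<partial>gauss n (\<mu> m) 1)
        = (\<Sum>t<n. ln (D / 1) / 2 - (1\<^sup>2 + (\<mu> m t - \<mu> m t)\<^sup>2) / (2 * 1) + (1\<^sup>2 + (\<mu> m t - \<nu> m t)\<^sup>2) / (2 * D))"
      unfolding L_def by (rule has_bochner_integral_integral_eq[OF gauss_llr_expectation]) simp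
    also have "\<dots> = (\<Sum>t<n. (ln D / 2 - 1 / 2 + 1 / (2 * D)) + (enc 2 (m 2) t)\<^sup>2 / (2 * D))"
      by (intro sum.cong refl) (simp add: \<mu>_def add_divide_distrib)
    also have "\<dots> = real n * (ln D / 2 - 1 / 2 + 1 / (2 * D)) + (\<Sum>t<n. (enc 2 (m 2) t)\<^sup>2) / (2 * D)"
      by (simp only: sum.distrib[of "\<lambda>_. _"] sum_divide_distrib sum_constant card_lessThan distrib_left)
    also have "\<dots> \<le> real n * (ln D / 2 - 1 / 2 + 1 / (2 * D)) + real n * P 2 / (2 * D)"
      using m D by (intro add_left_mono divide_right_mono pow) simp_all
    \<comment> \<open>Here \<open>1 + P 2\<close> meets \<open>D\<close>: the quadratic term
      contributes 1/2 and cancels the -1/2 that comes from the unit noise.\<close>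
    also have "\<dots> = real n * (ln D / 2 - 1 / 2 + (1 + P 2) / (2 * D))"
      by (simp only: distrib_left add_divide_distrib add.assoc times_divide_eq_right mult_1_right)
    also have "\<dots> = real n * (ln D / 2)"
      using D by (simp add: D_def[symmetric])
    finally show "(\<integral>y. L m y \<partial>gauss n (\<mu> m) 1) \<le> real n * (ln D / 2)" .
  qed
  finally have "(\<Sum>m\<in>messages M. measure (gauss n (\<mu> m) 1) (C m)) * ln (real (M 2))
      \<le> (\<Sum>m\<in>messages M. real n * (ln D / 2)) + card (messages M) * ln 2" by simp
  then show ?thesis
    by (simp add: \<mu>_def[abs_def] \<nu>_def C_def D_def algebra_simps)
qed

text \<open>Users 0 and 1 must be bounded jointly, since treating them apart would lose the
  interference term. Increasing the power of user 0 helps receiver 0 and hurts receiver 1; with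
  \<open>a < 1\<close> the gain outweighs the loss, so both reference variances may be taken at full
  power.\<close>

lemma weak_z_channel_sum_converse:
  assumes pos: "P 0 > 0" "P 1 > 0" and a: "0 \<le> a" "a < 1" and code: "is_code P n M enc dec"
  shows "(\<Sum>m\<in>messages M. measure (coupled_outputs n a (enc 0 (m 0)) (enc 1 (m 1)))
        {w \<in> space (coupled_outputs n a (enc 0 (m 0)) (enc 1 (m 1))). dec 0 (fst w) = m 0 \<and> dec 1 (snd w) = m 1}) * ln (real (M 0 * M 1))
     \<le> card (messages M) * (real n * (ln (1 + P 0) / 2 + ln (1 + P 1 / (1 + a\<^sup>2 * P 0)) / 2) + ln 2)"
proof -
  \<comment> \<open>Variances at full power: \<open>A\<close> of the output of receiver 0,
    \<open>B\<close> of interference plus noise at receiver 1, \<open>D\<close> of the output of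
    receiver 1. \<open>v\<close> is the noise added when \<open>B\<close> is obtained by degrading
    \<open>A\<close>.\<close>
  define A B D v where "A = 1 + P 0" and "B = 1 + a\<^sup>2 * P 0" and "D = 1 + a\<^sup>2 * P 0 + P 1" and "v = 1 - a\<^sup>2"
  have A: "A > 0" using pos by (simp add: A_def)
  have B: "B > 0" using pos by (auto simp: B_def intro: add_pos_nonneg)
  have D: "D > 0" using pos B by (auto simp: D_def B_def)
  have v: "v > 0" using a by (simp add: v_def power_less_one_iff abs_square_less_1)
  have abs_a: "\<bar>a\<bar> < 1" using a by simp
  have BA: "B = a\<^sup>2 * A + v" by (simp add: A_def B_def v_def algebra_simps)
  have M: "M i \<ge> 1" if "i < 3" for i using code that by (auto simp: is_code_def)
  have pow: "(\<Sum>t<n. (enc i k t)\<^sup>2) \<le> real n * P i" if "i < 3" "k < M i" for i k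
    using code that by (auto simp: is_code_def)
  have dec [measurable]: "dec 0 \<in> measurable (Pi\<^sub>M {..<n} (\<lambda>_. borel)) (count_space UNIV)"
      "dec 1 \<in> measurable (Pi\<^sub>M {..<n} (\<lambda>_. borel)) (count_space UNIV)"
    using code by (auto simp: is_code_def)
  \<comment> \<open>Centring at the mean interference removes the correlation between the two inputs, which individual
    message pairs may have.\<close>
  define c where "c t = a * ((\<Sum>i<M 0. enc 0 i t) / M 0)" for t
  \<comment> \<open>\<open>L\<close> compares \<open>N(x0, 1)\<close> with \<open>N(0, A)\<close> at
    receiver 0, and \<open>N(x1, B)\<close> with \<open>N(c, D)\<close> at receiver 1. Its
    expectation only needs the two marginals of the coupling, and hence is explicit.\<close>
  define L where "L m = (\<lambda>w. gauss_llr n 1 (enc 0 (m 0)) A (\<lambda>_. 0) (fst w) + gauss_llr n B (enc 1 (m 1)) D c (snd w))" for m :: "nat \<Rightarrow> nat"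
  define Q where "Q m = coupled_outputs n a (enc 0 (m 0)) (enc 1 (m 1))" for m :: "nat \<Rightarrow> nat"
  define C where "C m = {w \<in> space (Pi\<^sub>M {..<n} (\<lambda>_. borel) \<Otimes>\<^sub>M Pi\<^sub>M {..<n} (\<lambda>_. borel)). dec 0 (fst w) = m 0 \<and> dec 1 (snd w) = m 1}" for m :: "nat \<Rightarrow> nat"
  have sQ [simp]: "space (Q m) = space (Pi\<^sub>M {..<n} (\<lambda>_. borel) \<Otimes>\<^sub>M Pi\<^sub>M {..<n} (\<lambda>_. borel))" for m
    unfolding Q_def by simp
  have setsQ [simp, measurable_cong]: "sets (Q m) = sets (Pi\<^sub>M {..<n} (\<lambda>_. borel) \<Otimes>\<^sub>M Pi\<^sub>M {..<n} (\<lambda>_. borel))" for m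
    unfolding Q_def by simp
  have Cs [measurable]: "C m \<in> sets (Pi\<^sub>M {..<n} (\<lambda>_. borel) \<Otimes>\<^sub>M Pi\<^sub>M {..<n} (\<lambda>_. borel))" for m
    unfolding C_def by measurable
  have Lm [measurable]: "L m \<in> borel_measurable (Pi\<^sub>M {..<n} (\<lambda>_. borel) \<Otimes>\<^sub>M Pi\<^sub>M {..<n} (\<lambda>_. borel))" for m
    unfolding L_def by measurable
  \<comment> \<open>The posterior density of \<open>y0\<close>, with prior \<open>N(0, A)\<close>,
    given that its degraded version is \<open>y1 - x1\<close>; gain and variance come from Bayes'
    rule above.\<close>
  define g where "g j y1 y0 = gauss_density n (\<lambda>t. a * A / B * (y1 t - enc 1 j t)) (sqrt (A * v / B)) y0" for j y1 y0
  have gm [measurable]: "(\<lambda>w. g j (snd w) (fst w)) \<in> borel_measurable (Pi\<^sub>M {..<n} (\<lambda>_. borel) \<Otimes>\<^sub>M Pi\<^sub>M {..<n} (\<lambda>_. borel))" for j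
    unfolding g_def
    by (intro measurable_gauss_density borel_measurable_times borel_measurable_diff borel_measurable_const measurable_pair_components)
  have gm' [measurable]: "g j y1 \<in> borel_measurable (Pi\<^sub>M {..<n} (\<lambda>_. borel))" for j y1
    unfolding g_def by measurable
  have g0 [simp]: "0 \<le> g j y1 y0" for j y1 y0 by (simp add: g_def)
  have g1: "(\<integral>\<^sup>+y0. ennreal (g j y1 y0) \<partial>lebesgue_vec n) = 1" for j y1
    unfolding g_def using A B v by (intro nn_integral_gauss_density) simp
  interpret Lb: sigma_finite_measure "lebesgue_vec n" by (rule sigma_finite_lebesgue_vec)
  interpret LL: pair_sigma_finite "lebesgue_vec n" "lebesgue_vec n" ..
  have s: "sets (lebesgue_vec n \<Otimes>\<^sub>M lebesgue_vec n) = sets (Pi\<^sub>M {..<n} (\<lambda>_. borel) \<Otimes>\<^sub>M Pi\<^sub>M {..<n} (\<lambda>_. borel))"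
    by (simp add: sets_lebesgue_vec cong: sets_pair_measure_cong)
  \<comment> \<open>The first part of \<open>L\<close> replaces the law of \<open>y0\<close> by the
    message-free \<open>N(0, A)\<close>; Bayes' rule then exposes the factor \<open>N(x1, B)\<close>
    of \<open>y1\<close>, which the second part of \<open>L\<close> replaces by
    \<open>N(c, D)\<close>. The message of user 0 has disappeared from the result.\<close>
  have density: "gauss_density n (enc 0 (m 0)) 1 y0 * gauss_density n (\<lambda>t. enc 1 (m 1) t + a * y0 t) (sqrt (1 - a\<^sup>2)) y1
        * exp (- L m (y0, y1)) = gauss_density n c (sqrt D) y1 * g (m 1) y1 y0" for m y0 y1
  proof -
    have e: "exp (- L m (y0, y1)) = exp (- gauss_llr n 1 (enc 0 (m 0)) A (\<lambda>_. 0) y0) * exp (- gauss_llr n B (enc 1 (m 1)) D c y1)"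
      unfolding L_def by (simp flip: exp_add)
    have "gauss_density n (enc 0 (m 0)) 1 y0 * gauss_density n (\<lambda>t. enc 1 (m 1) t + a * y0 t) (sqrt v) y1 * exp (- L m (y0, y1))
      = (gauss_density n (enc 0 (m 0)) (sqrt 1) y0 * exp (- gauss_llr n 1 (enc 0 (m 0)) A (\<lambda>_. 0) y0))
        * gauss_density n (\<lambda>t. enc 1 (m 1) t + a * y0 t) (sqrt v) y1 * exp (- gauss_llr n B (enc 1 (m 1)) D c y1)"
      unfolding e by simp
    also have "\<dots> = (gauss_density n (\<lambda>_. 0) (sqrt A) y0 * gauss_density n (\<lambda>t. enc 1 (m 1) t + a * y0 t) (sqrt v) y1)
        * exp (- gauss_llr n B (enc 1 (m 1)) D c y1)"
      by (subst gauss_density_mult_exp_llr) (use A in auto)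
    also have "\<dots> = (gauss_density n (enc 1 (m 1)) (sqrt B) y1 * g (m 1) y1 y0) * exp (- gauss_llr n B (enc 1 (m 1)) D c y1)"
      by (subst gauss_density_swap[OF A v BA]) (simp add: g_def)
    also have "\<dots> = (gauss_density n (enc 1 (m 1)) (sqrt B) y1 * exp (- gauss_llr n B (enc 1 (m 1)) D c y1)) * g (m 1) y1 y0"
      by simp
    also have "\<dots> = gauss_density n c (sqrt D) y1 * g (m 1) y1 y0"
      by (subst gauss_density_mult_exp_llr[OF B D]) simp
    finally show ?thesis by (simp add: v_def)
  qed
  have change: "(\<integral>\<^sup>+w. ennreal (exp (- L m w)) * F w \<partial>Q m)
      = (\<integral>\<^sup>+y1. ennreal (gauss_density n c (sqrt D) y1) * (\<integral>\<^sup>+y0. ennreal (g (m 1) y1 y0) * F (y0, y1) \<partial>lebesgue_vec n) \<partial>lebesgue_vec n)"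
    if F [measurable]: "F \<in> borel_measurable (Pi\<^sub>M {..<n} (\<lambda>_. borel) \<Otimes>\<^sub>M Pi\<^sub>M {..<n} (\<lambda>_. borel))" for F m
  proof -
    have "(\<integral>\<^sup>+w. ennreal (exp (- L m w)) * F w \<partial>Q m)
        = (\<integral>\<^sup>+w. ennreal (gauss_density n (enc 0 (m 0)) 1 (fst w) * gauss_density n (\<lambda>t. enc 1 (m 1) t + a * fst w t) (sqrt (1 - a\<^sup>2)) (snd w))
            * (ennreal (exp (- L m w)) * F w) \<partial>(lebesgue_vec n \<Otimes>\<^sub>M lebesgue_vec n))"
      unfolding Q_def by (intro nn_integral_coupled_outputs) measurable
    also have "\<dots> = (\<integral>\<^sup>+w. ennreal (gauss_density n c (sqrt D) (snd w)) * (ennreal (g (m 1) (snd w) (fst w)) * F w)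
         \<partial>(lebesgue_vec n \<Otimes>\<^sub>M lebesgue_vec n))"
      using density[of m "fst w" "snd w" for w]
      by (intro nn_integral_cong) (simp add: mult.assoc[symmetric] ennreal_mult[symmetric])
    also have "\<dots> = (\<integral>\<^sup>+y1. \<integral>\<^sup>+y0. ennreal (gauss_density n c (sqrt D) y1) * (ennreal (g (m 1) y1 y0) * F (y0, y1)) \<partial>lebesgue_vec n \<partial>lebesgue_vec n)"
      by (subst LL.nn_integral_snd[symmetric]) (auto simp: measurable_cong_sets[OF s refl] case_prod_beta')
    also have "\<dots> = (\<integral>\<^sup>+y1. ennreal (gauss_density n c (sqrt D) y1) * (\<integral>\<^sup>+y0. ennreal (g (m 1) y1 y0) * F (y0, y1) \<partial>lebesgue_vec n) \<partial>lebesgue_vec n)"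
    proof (intro nn_integral_cong nn_integral_cmult)
      fix y1 assume "y1 \<in> space (lebesgue_vec n)"
      then have y1: "y1 \<in> space (Pi\<^sub>M {..<n} (\<lambda>_. borel))" by (simp add: space_PiM)
      have "(\<lambda>y0. F (y0, y1)) \<in> borel_measurable (Pi\<^sub>M {..<n} (\<lambda>_. borel))"
        using y1 by measurable
      then show "(\<lambda>y0. ennreal (g (m 1) y1 y0) * F (y0, y1)) \<in> borel_measurable (lebesgue_vec n)"
        by measurable
    qed
    finally show ?thesis .
  qed
  have expL: "has_bochner_integral (Q m) (L m)
     ((\<Sum>t<n. ln (A / 1) / 2 - (1\<^sup>2 + (enc 0 (m 0) t - enc 0 (m 0) t)\<^sup>2) / (2 * 1) + (1\<^sup>2 + (enc 0 (m 0) t - 0)\<^sup>2) / (2 * A))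
      + (\<Sum>t<n. ln (D / B) / 2 - (1\<^sup>2 + (enc 1 (m 1) t + a * enc 0 (m 0) t - enc 1 (m 1) t)\<^sup>2) / (2 * B)
          + (1\<^sup>2 + (enc 1 (m 1) t + a * enc 0 (m 0) t - c t)\<^sup>2) / (2 * D)))" for m
    unfolding L_def
  proof (rule has_bochner_integral_add)
    show "has_bochner_integral (Q m) (\<lambda>w. gauss_llr n 1 (enc 0 (m 0)) A (\<lambda>_. 0) (fst w))
      (\<Sum>t<n. ln (A / 1) / 2 - (1\<^sup>2 + (enc 0 (m 0) t - enc 0 (m 0) t)\<^sup>2) / (2 * 1) + (1\<^sup>2 + (enc 0 (m 0) t - 0)\<^sup>2) / (2 * A))"
      using gauss_llr_expectation[OF zero_less_one, of n "enc 0 (m 0)" 1 "enc 0 (m 0)" A "\<lambda>_. 0"]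
      unfolding distr_coupled_outputs(1)[OF abs_a, of n "enc 0 (m 0)" "enc 1 (m 1)", symmetric] Q_def[symmetric]
      by (simp add: has_bochner_integral_iff integrable_distr_eq integral_distr)
    show "has_bochner_integral (Q m) (\<lambda>w. gauss_llr n B (enc 1 (m 1)) D c (snd w))
      (\<Sum>t<n. ln (D / B) / 2 - (1\<^sup>2 + (enc 1 (m 1) t + a * enc 0 (m 0) t - enc 1 (m 1) t)\<^sup>2) / (2 * B)
          + (1\<^sup>2 + (enc 1 (m 1) t + a * enc 0 (m 0) t - c t)\<^sup>2) / (2 * D))"
      using gauss_llr_expectation[OF zero_less_one, of n "\<lambda>t. enc 1 (m 1) t + a * enc 0 (m 0) t" B "enc 1 (m 1)" D c]
      unfolding distr_coupled_outputs(2)[OF abs_a, of n "enc 0 (m 0)" "enc 1 (m 1)", symmetric] Q_def[symmetric]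
      by (simp add: has_bochner_integral_iff integrable_distr_eq integral_distr)
  qed
  have "(\<Sum>m\<in>messages M. measure (Q m) (C m)) * ln (real (M 0 * M 1))
      \<le> (\<Sum>m\<in>messages M. \<integral>w. L m w \<partial>Q m) + card (messages M) * ln 2"
  proof (rule change_of_measure_fano)
    show "real (M 0 * M 1) \<ge> 1" using M[of 0] M[of 1] by (simp add: Suc_leI flip: of_nat_mult)
    show "prob_space (Q m)" for m unfolding Q_def using abs_a by (rule prob_space_coupled_outputs)
    show "integrable (Q m) (L m)" for m using expL[of m] by (simp add: has_bochner_integral_iff)
    show "C m \<in> sets (Q m)" for m by simp
    show "(\<integral>\<^sup>+w. ennreal (exp (- L m w)) \<partial>Q m) \<le> 1" for m
      using change[of "\<lambda>_. 1" m] D by (simp add: g1 nn_integral_gauss_density)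
    show "(\<Sum>m\<in>messages M. \<integral>\<^sup>+w. ennreal (exp (- L m w)) * indicator (C m) w \<partial>Q m)
      \<le> ennreal (card (messages M) / real (M 0 * M 1))"
    proof -
      \<comment> \<open>\<open>I y1 i j\<close> is the posterior probability, given
        \<open>y1\<close> and message \<open>j\<close> of user 1, that receiver 0 decides for
        \<open>i\<close>.\<close>
      define I where "I y1 i j = (\<integral>\<^sup>+y0. ennreal (g j y1 y0) * indicator {y. dec 0 y = i} y0 \<partial>lebesgue_vec n)" for y1 i j
      have Im [measurable]: "(\<lambda>y1. I y1 i j) \<in> borel_measurable (lebesgue_vec n)" for i j
      proof -
        have "(\<lambda>w. ennreal (g j (snd w) (fst w)) * indicator {y. dec 0 y = i} (fst w)) \<in> borel_measurable (lebesgue_vec n \<Otimes>\<^sub>M lebesgue_vec n)"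
          by (simp add: measurable_cong_sets[OF s refl])
        then have "(\<lambda>(y1, y0). ennreal (g j y1 y0) * indicator {y. dec 0 y = i} y0) \<in> borel_measurable (lebesgue_vec n \<Otimes>\<^sub>M lebesgue_vec n)"
          by (subst measurable_pair_swap_iff) (simp add: case_prod_beta')
        then show ?thesis unfolding I_def by (rule Lb.borel_measurable_nn_integral)
      qed
      have Isum: "(\<Sum>i<M 0. I y1 i j) \<le> 1" if y1: "y1 \<in> space (lebesgue_vec n)" for y1 j
      proof -
        have "(\<Sum>i<M 0. I y1 i j) = (\<integral>\<^sup>+y0. (\<Sum>i<M 0. ennreal (g j y1 y0) * indicator {y. dec 0 y = i} y0) \<partial>lebesgue_vec n)"
          unfolding I_def by (intro nn_integral_sum[symmetric]) measurable
        also have "\<dots> = (\<integral>\<^sup>+y0. ennreal (g j y1 y0) * (\<Sum>i<M 0. indicator {y. dec 0 y = i} y0) \<partial>lebesgue_vec n)"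
          by (simp add: sum_distrib_left)
        also have "\<dots> \<le> (\<integral>\<^sup>+y0. ennreal (g j y1 y0) * 1 \<partial>lebesgue_vec n)"
          by (intro nn_integral_mono mult_left_mono sum_indicator_le_1) simp
        finally show ?thesis by (simp add: g1)
      qed
      have ch: "(\<integral>\<^sup>+w. ennreal (exp (- L m w)) * indicator (C m) w \<partial>Q m)
          = (\<integral>\<^sup>+y1. ennreal (gauss_density n c (sqrt D) y1) * (indicator {y. dec 1 y = m 1} y1 * I y1 (m 0) (m 1)) \<partial>lebesgue_vec n)" for m
      proof (subst change, measurable, intro nn_integral_cong arg_cong2[where f = "(*)"] refl)
        fix y1 assume y1: "y1 \<in> space (lebesgue_vec n)"
        have "(\<integral>\<^sup>+y0. ennreal (g (m 1) y1 y0) * indicator (C m) (y0, y1) \<partial>lebesgue_vec n)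
            = (\<integral>\<^sup>+y0. indicator {y. dec 1 y = m 1} y1 * (ennreal (g (m 1) y1 y0) * indicator {y. dec 0 y = m 0} y0) \<partial>lebesgue_vec n)"
          using y1 by (intro nn_integral_cong) (auto simp: C_def space_pair_measure space_PiM indicator_def)
        also have "\<dots> = indicator {y. dec 1 y = m 1} y1 * I y1 (m 0) (m 1)"
          unfolding I_def by (intro nn_integral_cmult) measurable
        finally show "(\<integral>\<^sup>+y0. ennreal (g (m 1) y1 y0) * indicator (C m) (y0, y1) \<partial>lebesgue_vec n)
           = indicator {y. dec 1 y = m 1} y1 * I y1 (m 0) (m 1)" .
      qed
      define H where "H i j = (\<integral>\<^sup>+y1. ennreal (gauss_density n c (sqrt D) y1) * (indicator {y. dec 1 y = j} y1 * I y1 i j) \<partial>lebesgue_vec n)" for i j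
      have "(\<Sum>m\<in>messages M. \<integral>\<^sup>+w. ennreal (exp (- L m w)) * indicator (C m) w \<partial>Q m) = (\<Sum>m\<in>messages M. H (m 0) (m 1))"
        unfolding ch H_def ..
      also have "\<dots> = (\<Sum>i<M 0. \<Sum>j<M 1. \<Sum>k<M 2. H i j)"
        by (rule sum_messages[where F = "\<lambda>i j k. H i j"])
      \<comment> \<open>The order matters: \<open>i\<close> is summed inside, with \<open>j\<close>
        fixed, because \<open>g\<close> depends on \<open>j\<close>. What remains after that is
        bounded by a sum over the disjoint decisions of receiver 1. The factor \<open>M 2\<close>
        counts the message of user 2, which takes no part here.\<close>
      also have "\<dots> = of_nat (M 2) * (\<Sum>j<M 1. \<Sum>i<M 0. H i j)"
        by (subst sum.swap) (simp add: sum_distrib_left)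
      also have "(\<Sum>j<M 1. \<Sum>i<M 0. H i j)
          = (\<integral>\<^sup>+y1. (\<Sum>j<M 1. \<Sum>i<M 0. ennreal (gauss_density n c (sqrt D) y1) * (indicator {y. dec 1 y = j} y1 * I y1 i j)) \<partial>lebesgue_vec n)"
        unfolding H_def
        by (subst nn_integral_sum, measurable, intro sum.cong refl nn_integral_sum[symmetric]) measurable
      also have "\<dots> = (\<integral>\<^sup>+y1. ennreal (gauss_density n c (sqrt D) y1) * (\<Sum>j<M 1. indicator {y. dec 1 y = j} y1 * (\<Sum>i<M 0. I y1 i j)) \<partial>lebesgue_vec n)"
        by (simp only: sum_distrib_left)
      also have "\<dots> \<le> (\<integral>\<^sup>+y1. ennreal (gauss_density n c (sqrt D) y1) * (\<Sum>j<M 1. indicator {y. dec 1 y = j} y1 * 1) \<partial>lebesgue_vec n)"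
        by (intro nn_integral_mono mult_left_mono sum_mono Isum) auto
      also have "\<dots> \<le> (\<integral>\<^sup>+y1. ennreal (gauss_density n c (sqrt D) y1) * 1 \<partial>lebesgue_vec n)"
        unfolding mult_1_right[where 'a = ennreal] by (intro nn_integral_mono mult_left_mono[of _ "1::ennreal", simplified mult_1_right] sum_indicator_le_1) simp
      also have "\<dots> = 1" using D by (simp add: nn_integral_gauss_density)
      finally have "(\<Sum>m\<in>messages M. \<integral>\<^sup>+w. ennreal (exp (- L m w)) * indicator (C m) w \<partial>Q m) \<le> of_nat (M 2) * 1"
        by (simp add: mult_left_mono)
      also have "of_nat (M 2) * 1 = ennreal (card (messages M) / real (M 0 * M 1))"
        using M[of 0] M[of 1] by (simp add: card_messages ennreal_of_nat_eq_real_of_nat)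
      finally show ?thesis .
    qed
  qed simp
  also have "(\<Sum>m\<in>messages M. \<integral>w. L m w \<partial>Q m) \<le> (\<Sum>m\<in>messages M. real n * (ln A / 2 + ln (D / B) / 2))"
  proof -
    \<comment> \<open>Once the cross terms are averaged away, \<open>\<alpha>\<close> is the net
      coefficient of the energy of user 0: gain at receiver 0, loss through known variance
      \<open>B\<close>, gain through total variance \<open>D\<close>. \<open>\<beta>\<close>
      collects what is independent of the inputs.\<close>
    define \<alpha> where "\<alpha> = 1 / (2 * A) - a\<^sup>2 / (2 * B) + a\<^sup>2 / (2 * D)"
    define \<beta> where "\<beta> = ln A / 2 + ln (D / B) / 2 - 1 / 2 + 1 / (2 * A) - 1 / (2 * B) + 1 / (2 * D)"
    have eq: "(\<integral>w. L m w \<partial>Q m) = (\<Sum>t<n. \<beta> + (enc 0 (m 0) t)\<^sup>2 / (2 * A) - a\<^sup>2 * (enc 0 (m 0) t)\<^sup>2 / (2 * B)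
        + (enc 1 (m 1) t + a * enc 0 (m 0) t - c t)\<^sup>2 / (2 * D))" for m
      unfolding has_bochner_integral_integral_eq[OF expL] sum.distrib[symmetric]
      by (intro sum.cong refl) (simp add: \<beta>_def add_divide_distrib power_mult_distrib)
    \<comment> \<open>The cross term between \<open>x\<close> and the interference sums to zero
      after centring, and a variance is at most the second moment. This is where averaging over the
      messages of user 0 is used.\<close>
    have centre: "(\<Sum>i<M 0. (x + a * enc 0 i t - c t)\<^sup>2) \<le> (\<Sum>i<M 0. x\<^sup>2 + a\<^sup>2 * (enc 0 i t)\<^sup>2)" for x t
    proof -
      define S where "S = (\<Sum>i<M 0. a * enc 0 i t)"
      have ct: "c t = S / M 0" by (simp add: c_def S_def sum_distrib_left)
      have M0: "real (M 0) > 0" using M[of 0] by simp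
      have "(\<Sum>i<M 0. (x + a * enc 0 i t - c t)\<^sup>2)
         = (\<Sum>i<M 0. x\<^sup>2 + a\<^sup>2 * (enc 0 i t)\<^sup>2 + (2 * (x - c t) * (a * enc 0 i t) + (c t)\<^sup>2 - 2 * x * c t))"
        by (intro sum.cong refl) (simp add: power2_eq_square algebra_simps)
      also have "\<dots> = (\<Sum>i<M 0. x\<^sup>2 + a\<^sup>2 * (enc 0 i t)\<^sup>2) + (2 * (x - c t) * S + M 0 * (c t)\<^sup>2 - M 0 * (2 * x * c t))"
        unfolding S_def by (simp add: sum.distrib sum_subtractf sum_distrib_left)
      also have "2 * (x - c t) * S + M 0 * (c t)\<^sup>2 - M 0 * (2 * x * c t) = - M 0 * (c t)\<^sup>2"
        using M0 by (simp add: ct field_simps power2_eq_square)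
      finally show ?thesis by simp
    qed
    \<comment> \<open>\<open>a\<^sup>2 * A \<le> B\<close> amounts to
      \<open>a\<^sup>2 \<le> 1\<close>. Weak interference therefore makes the bound increasing in
      the energy of user 0, so the power constraint can be inserted.\<close>
    have \<alpha>: "\<alpha> \<ge> 0"
    proof -
      have "a\<^sup>2 \<le> 1" using v by (simp add: v_def)
      then have "a\<^sup>2 / (2 * B) \<le> 1 / (2 * A)"
        using A B by (simp add: field_simps A_def B_def)
      then show ?thesis using D by (simp add: \<alpha>_def)
    qed
    define G where "G = real n * (ln A / 2 + ln (D / B) / 2)"
    define E where "E i j = (\<Sum>t<n. \<beta> + (enc 0 i t)\<^sup>2 / (2 * A) - a\<^sup>2 * (enc 0 i t)\<^sup>2 / (2 * B) + (enc 1 j t + a * enc 0 i t - c t)\<^sup>2 / (2 * D))" for i j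
    \<comment> \<open>At full power the quadratic terms become \<open>A / (2 * A)\<close>,
      \<open>B / (2 * B)\<close> and \<open>D / (2 * D)\<close>; together with -1/2 they cancel and
      only the logarithms survive.\<close>
    have G: "real n * \<beta> + \<alpha> * (real n * P 0) + real n * P 1 / (2 * D) = G"
    proof -
      have "\<beta> + \<alpha> * P 0 + P 1 / (2 * D) = ln A / 2 + ln (D / B) / 2 - 1 / 2 + (1 + P 0) / (2 * A) - (1 + a\<^sup>2 * P 0) / (2 * B) + (1 + a\<^sup>2 * P 0 + P 1) / (2 * D)"
        by (simp add: \<alpha>_def \<beta>_def add_divide_distrib diff_divide_distrib distrib_right left_diff_distrib)
      also have "\<dots> = ln A / 2 + ln (D / B) / 2"
      proof -
        have e: "1 + P 0 = A" "1 + a\<^sup>2 * P 0 = B" "1 + a\<^sup>2 * P 0 + P 1 = D" by (simp_all add: A_def B_def D_def)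
        show ?thesis unfolding e(1) e(3) unfolding e(2) using A B D by simp
      qed
      finally have "real n * (\<beta> + \<alpha> * P 0 + P 1 / (2 * D)) = G" by (simp add: G_def)
      moreover have "real n * (\<beta> + \<alpha> * P 0 + P 1 / (2 * D)) = real n * \<beta> + \<alpha> * (real n * P 0) + real n * P 1 / (2 * D)"
        by (simp add: distrib_left)
      ultimately show ?thesis by simp
    qed
    have Ej: "(\<Sum>i<M 0. E i j) \<le> real (M 0) * G" if j: "j < M 1" for j
    proof -
      have "(\<Sum>i<M 0. E i j) = (\<Sum>t<n. \<Sum>i<M 0. \<beta> + (enc 0 i t)\<^sup>2 / (2 * A) - a\<^sup>2 * (enc 0 i t)\<^sup>2 / (2 * B) + (enc 1 j t + a * enc 0 i t - c t)\<^sup>2 / (2 * D))"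
        unfolding E_def by (rule sum.swap)
      also have "\<dots> = (\<Sum>t<n. (\<Sum>i<M 0. \<beta> + (enc 0 i t)\<^sup>2 / (2 * A) - a\<^sup>2 * (enc 0 i t)\<^sup>2 / (2 * B)) + (\<Sum>i<M 0. (enc 1 j t + a * enc 0 i t - c t)\<^sup>2) / (2 * D))"
        by (simp only: sum.distrib[of _ "\<lambda>i. (enc 1 j t + a * enc 0 i t - c t)\<^sup>2 / (2 * D)" for t] sum_divide_distrib)
      also have "\<dots> \<le> (\<Sum>t<n. (\<Sum>i<M 0. \<beta> + (enc 0 i t)\<^sup>2 / (2 * A) - a\<^sup>2 * (enc 0 i t)\<^sup>2 / (2 * B)) + (\<Sum>i<M 0. (enc 1 j t)\<^sup>2 + a\<^sup>2 * (enc 0 i t)\<^sup>2) / (2 * D))"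
        using D by (intro sum_mono add_left_mono divide_right_mono centre) auto
      also have "\<dots> = (\<Sum>t<n. \<Sum>i<M 0. \<beta> + \<alpha> * (enc 0 i t)\<^sup>2 + (enc 1 j t)\<^sup>2 / (2 * D))"
        unfolding sum_divide_distrib sum.distrib[symmetric]
        by (intro sum.cong refl) (simp add: \<alpha>_def add_divide_distrib distrib_right left_diff_distrib)
      also have "\<dots> = (\<Sum>i<M 0. \<Sum>t<n. \<beta> + \<alpha> * (enc 0 i t)\<^sup>2 + (enc 1 j t)\<^sup>2 / (2 * D))"
        by (rule sum.swap)
      also have "\<dots> = (\<Sum>i<M 0. real n * \<beta> + \<alpha> * (\<Sum>t<n. (enc 0 i t)\<^sup>2) + (\<Sum>t<n. (enc 1 j t)\<^sup>2) / (2 * D))"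
        by (simp add: sum.distrib sum_distrib_left sum_divide_distrib)
      also have "\<dots> \<le> (\<Sum>i<M 0. real n * \<beta> + \<alpha> * (real n * P 0) + real n * P 1 / (2 * D))"
        using D \<alpha> j by (intro mult_left_mono sum_mono add_mono divide_right_mono pow order.refl) auto
      finally show ?thesis unfolding G by simp
    qed
    have "(\<Sum>m\<in>messages M. \<integral>w. L m w \<partial>Q m) = (\<Sum>m\<in>messages M. E (m 0) (m 1))"
      unfolding eq E_def ..
    also have "\<dots> = (\<Sum>i<M 0. \<Sum>j<M 1. \<Sum>k<M 2. E i j)"
      by (rule sum_messages[where F = "\<lambda>i j k. E i j"])
    also have "\<dots> = (\<Sum>j<M 1. \<Sum>i<M 0. real (M 2) * E i j)"
      by (subst sum.swap) simp
    also have "\<dots> = (\<Sum>j<M 1. real (M 2) * (\<Sum>i<M 0. E i j))"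
      by (simp only: sum_distrib_left)
    also have "\<dots> \<le> (\<Sum>j<M 1. real (M 2) * (real (M 0) * G))"
      by (intro sum_mono mult_left_mono Ej) auto
    also have "\<dots> = (\<Sum>m\<in>messages M. G)"
      by (simp add: card_messages)
    finally show ?thesis unfolding G_def .
  qed
  finally have "(\<Sum>m\<in>messages M. measure (Q m) (C m)) * ln (real (M 0 * M 1))
      \<le> card (messages M) * (real n * (ln A / 2 + ln (D / B) / 2) + ln 2)" by (simp add: distrib_left)
  moreover have "D / B = 1 + P 1 / (1 + a\<^sup>2 * P 0)"
    using B by (simp add: D_def B_def field_simps)
  ultimately show ?thesis
    by (simp add: C_def Q_def A_def)
qed

section \<open>From error probability to the bound on the sum rate\<close>

lemma prob_space_noise: "prob_space (noise n)"
  unfolding noise_def by (intro prob_space_PiM prob_space_normal_density) simp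

lemma measurable_chan_out [measurable]:
  assumes "i < 3"
  shows "(\<lambda>z. chan_out a1 a2 n enc m z i) \<in> measurable (noise n) (Pi\<^sub>M {..<n} (\<lambda>_. borel))"
  unfolding chan_out_def noise_def
proof (intro measurable_restrict borel_measurable_add borel_measurable_const)
  fix t assume "t \<in> {..<n}"
  then have "(i, t) \<in> {..<3} \<times> {..<n}" using assms by simp
  then show "(\<lambda>z. z (i, t)) \<in> borel_measurable (Pi\<^sub>M ({..<3} \<times> {..<n}) (\<lambda>_. density lborel std_normal_density))"
    using measurable_component_singleton[of "(i, t)" "{..<3} \<times> {..<n}" "\<lambda>_. density lborel std_normal_density"]
    by (simp add: measurable_cong_sets[OF refl sets_density])
qed

definition chan_mean :: "real \<Rightarrow> real \<Rightarrow> (nat \<Rightarrow> nat \<Rightarrow> nat \<Rightarrow> real) \<Rightarrow> (nat \<Rightarrow> nat) \<Rightarrow> nat \<Rightarrow> nat \<Rightarrow> real" where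
  "chan_mean a1 a2 enc m i t = enc i (m i) t
     + (if i = 1 then a1 * enc 0 (m 0) t else if i = 2 then a2 * enc 1 (m 1) t else 0)"

lemma distr_chan_out:
  assumes "i < 3"
  shows "distr (noise n) (Pi\<^sub>M {..<n} (\<lambda>_. borel)) (\<lambda>z. chan_out a1 a2 n enc m z i)
    = gauss n (chan_mean a1 a2 enc m i) 1"
  unfolding distr_noise_shift[OF assms, symmetric] chan_out_def chan_mean_def ..

lemma prob_correct_ge:
  assumes code: "is_code P n M enc dec" and i: "i < 3"
  shows "measure (gauss n (chan_mean a1 a2 enc m i) 1) {y \<in> space (gauss n (chan_mean a1 a2 enc m i) 1). dec i y = m i}
    \<ge> 1 - measure (noise n) {z \<in> space (noise n). \<exists>i<3. dec i (chan_out a1 a2 n enc m z i) \<noteq> m i}"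
proof -
  interpret prob_space "noise n" by (rule prob_space_noise)
  have dec: "dec j \<in> measurable (Pi\<^sub>M {..<n} (\<lambda>_. borel)) (count_space UNIV)" if "j < 3" for j
    using code that by (auto simp: is_code_def)
  have comp [measurable]: "(\<lambda>z. dec j (chan_out a1 a2 n enc m z j)) \<in> measurable (noise n) (count_space UNIV)" if "j < 3" for j
    using measurable_compose[OF measurable_chan_out[OF that] dec[OF that]] .
  have "measure (gauss n (chan_mean a1 a2 enc m i) 1) {y \<in> space (gauss n (chan_mean a1 a2 enc m i) 1). dec i y = m i}
      = prob {z \<in> space (noise n). dec i (chan_out a1 a2 n enc m z i) = m i}"
  proof -
    have [measurable]: "dec i \<in> measurable (Pi\<^sub>M {..<n} (\<lambda>_. borel)) (count_space UNIV)" by (rule dec[OF i])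
    have sp: "chan_out a1 a2 n enc m z i \<in> space (Pi\<^sub>M {..<n} (\<lambda>_. borel))" if "z \<in> space (noise n)" for z
      using measurable_space[OF measurable_chan_out[OF i] that] .
    show ?thesis
      unfolding distr_chan_out[OF i, symmetric]
      using sp by (subst measure_distr) (auto simp: i intro!: arg_cong[where f = prob])
  qed
  also have "\<dots> \<ge> prob (space (noise n) - {z \<in> space (noise n). \<exists>i<3. dec i (chan_out a1 a2 n enc m z i) \<noteq> m i})"
    using i by (intro finite_measure_mono) (auto intro: measurable_sets_Collect comp)
  moreover have "prob (space (noise n) - {z \<in> space (noise n). \<exists>i<3. dec i (chan_out a1 a2 n enc m z i) \<noteq> m i})
     = 1 - prob {z \<in> space (noise n). \<exists>i<3. dec i (chan_out a1 a2 n enc m z i) \<noteq> m i}"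
  proof (rule prob_compl)
    have "{z \<in> space (noise n). \<exists>i<3. dec i (chan_out a1 a2 n enc m z i) \<noteq> m i}
       = (\<Union>i\<in>{..<3}. {z \<in> space (noise n). dec i (chan_out a1 a2 n enc m z i) \<noteq> m i})" by auto
    also have "\<dots> \<in> sets (noise n)"
      by (intro sets.finite_UN) auto
    finally show "{z \<in> space (noise n). \<exists>i<3. dec i (chan_out a1 a2 n enc m z i) \<noteq> m i} \<in> sets (noise n)" .
  qed
  ultimately show ?thesis by simp
qed

text \<open>The coupling changes the joint law of the outputs, so joint success cannot be carried
  over from the channel. Each marginal success probability can, and the union bound over the two
  receivers is what doubles the error term.\<close>

lemma coupled_correct_ge:
  assumes code: "is_code P n M enc dec" and a: "0 \<le> a1" "a1 < 1"
  shows "measure (coupled_outputs n a1 (enc 0 (m 0)) (enc 1 (m 1)))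
      {w \<in> space (coupled_outputs n a1 (enc 0 (m 0)) (enc 1 (m 1))). dec 0 (fst w) = m 0 \<and> dec 1 (snd w) = m 1}
    \<ge> 1 - 2 * measure (noise n) {z \<in> space (noise n). \<exists>i<3. dec i (chan_out a1 a2 n enc m z i) \<noteq> m i}"
proof -
  define Q where "Q = coupled_outputs n a1 (enc 0 (m 0)) (enc 1 (m 1))"
  have abs_a: "\<bar>a1\<bar> < 1" using a by simp
  interpret prob_space Q unfolding Q_def using abs_a by (rule prob_space_coupled_outputs)
  have setsQ [simp, measurable_cong]: "sets Q = sets (Pi\<^sub>M {..<n} (\<lambda>_. borel) \<Otimes>\<^sub>M Pi\<^sub>M {..<n} (\<lambda>_. borel))"
    unfolding Q_def by simp
  have dec [measurable]: "dec 0 \<in> measurable (Pi\<^sub>M {..<n} (\<lambda>_. borel)) (count_space UNIV)"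
      "dec 1 \<in> measurable (Pi\<^sub>M {..<n} (\<lambda>_. borel)) (count_space UNIV)"
    using code by (auto simp: is_code_def)
  note [measurable] = dec(2)[unfolded One_nat_def]
  have mean: "chan_mean a1 a2 enc m 0 = enc 0 (m 0)"
     "chan_mean a1 a2 enc m 1 = (\<lambda>t. enc 1 (m 1) t + a1 * enc 0 (m 0) t)"
    by (simp_all add: chan_mean_def fun_eq_iff)
  define E where "E = measure (noise n) {z \<in> space (noise n). \<exists>i<3. dec i (chan_out a1 a2 n enc m z i) \<noteq> m i}"
  have e0: "prob {w \<in> space Q. dec 0 (fst w) = m 0} \<ge> 1 - E"
  proof -
    have "prob {w \<in> space Q. dec 0 (fst w) = m 0} = measure (gauss n (enc 0 (m 0)) 1) {y \<in> space (gauss n (enc 0 (m 0)) 1). dec 0 y = m 0}"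
      unfolding distr_coupled_outputs(1)[OF abs_a, of n _ "enc 1 (m 1)", symmetric] Q_def[symmetric]
      by (subst measure_distr) (auto simp: measurable_space[OF measurable_fst] sets_eq_imp_space_eq[OF setsQ] space_pair_measure intro!: arg_cong[where f = prob])
    then show ?thesis using prob_correct_ge[OF code, of 0 a1 a2 m] by (simp add: mean E_def)
  qed
  have e1: "prob {w \<in> space Q. dec 1 (snd w) = m 1} \<ge> 1 - E"
  proof -
    have "prob {w \<in> space Q. dec 1 (snd w) = m 1} = measure (gauss n (chan_mean a1 a2 enc m 1) 1) {y \<in> space (gauss n (chan_mean a1 a2 enc m 1) 1). dec 1 y = m 1}"
      unfolding mean distr_coupled_outputs(2)[OF abs_a, symmetric] Q_def[symmetric]
      by (subst measure_distr) (auto simp: sets_eq_imp_space_eq[OF setsQ] space_pair_measure intro!: arg_cong[where f = prob])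
    then show ?thesis using prob_correct_ge[OF code, of 1 a1 a2 m] unfolding E_def by simp
  qed
  have s0: "{w \<in> space Q. dec 0 (fst w) = m 0} \<in> fmeasurable Q"
    and s1: "{w \<in> space Q. dec 1 (snd w) = m 1} \<in> fmeasurable Q"
    unfolding fmeasurable_eq_sets by measurable
  have "prob {w \<in> space Q. dec 0 (fst w) = m 0} + prob {w \<in> space Q. dec 1 (snd w) = m 1}
      = prob ({w \<in> space Q. dec 0 (fst w) = m 0} \<union> {w \<in> space Q. dec 1 (snd w) = m 1})
       + prob ({w \<in> space Q. dec 0 (fst w) = m 0} \<inter> {w \<in> space Q. dec 1 (snd w) = m 1})"
    using measure_Un3[OF s0 s1] by simp
  also have "{w \<in> space Q. dec 0 (fst w) = m 0} \<inter> {w \<in> space Q. dec 1 (snd w) = m 1}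
     = {w \<in> space Q. dec 0 (fst w) = m 0 \<and> dec 1 (snd w) = m 1}" by auto
  finally have "prob {w \<in> space Q. dec 0 (fst w) = m 0 \<and> dec 1 (snd w) = m 1} \<ge> 1 - 2 * E"
    using e0 e1 prob_le_1[of "{w \<in> space Q. dec 0 (fst w) = m 0} \<union> {w \<in> space Q. dec 1 (snd w) = m 1}"]
    by linarith
  then show ?thesis by (simp add: Q_def E_def)
qed

lemma code_rate_bound:
  assumes pos: "P 0 > 0" "P 1 > 0" "P 2 > 0" and a: "0 \<le> a1" "a1 < 1"
    and code: "is_code P n M enc dec" and err: "error_prob a1 a2 n M enc dec \<le> \<epsilon>"
  shows "(1 - 2 * \<epsilon>) * (ln (M 0) + ln (M 1) + ln (M 2))
    \<le> n * (ln (1 + P 0) / 2 + ln (1 + P 1 / (1 + a1\<^sup>2 * P 0)) / 2 + ln (1 + P 2) / 2) + 2 * ln 2"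
proof -
  define E where "E m = measure (noise n) {z \<in> space (noise n). \<exists>i<3. dec i (chan_out a1 a2 n enc m z i) \<noteq> m i}" for m
  define K where "K = real (card (messages M))"
  have M: "M i \<ge> 1" if "i < 3" for i using code that by (auto simp: is_code_def)
  have K: "K > 0" using M[of 0] M[of 1] M[of 2] by (simp add: K_def card_messages)
  have sE: "(\<Sum>m\<in>messages M. E m) \<le> K * \<epsilon>"
    using err K unfolding error_prob_def E_def[symmetric] messages_def[symmetric] K_def card_messages
    by (simp add: field_simps)
  have l: "ln (real (M i)) \<ge> 0" if "i < 3" for i using M[OF that] by simp
  have \<epsilon>: "\<epsilon> \<ge> 0" using K sE by (smt (verit) sum_nonneg measure_nonneg E_def zero_le_mult_iff)
  have "K * ((1 - 2 * \<epsilon>) * ln (M 0 * M 1)) \<le> (\<Sum>m\<in>messages M. 1 - 2 * E m) * ln (M 0 * M 1)"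
  proof -
    have "K * (1 - 2 * \<epsilon>) \<le> (\<Sum>m\<in>messages M. 1 - 2 * E m)"
      using sE by (simp add: sum_subtractf sum_distrib_left[symmetric] K_def right_diff_distrib)
    from mult_right_mono[OF this, of "ln (real (M 0 * M 1))"] show ?thesis
      using M[of 0] M[of 1] by (simp add: ln_mult mult.assoc)
  qed
  also have "\<dots> \<le> (\<Sum>m\<in>messages M. measure (coupled_outputs n a1 (enc 0 (m 0)) (enc 1 (m 1)))
        {w \<in> space (coupled_outputs n a1 (enc 0 (m 0)) (enc 1 (m 1))). dec 0 (fst w) = m 0 \<and> dec 1 (snd w) = m 1}) * ln (M 0 * M 1)"
    using M[of 0] M[of 1] unfolding E_def
    by (intro mult_right_mono sum_mono coupled_correct_ge[OF code a]) (simp add: ln_mult)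
  also have "\<dots> \<le> K * (real n * (ln (1 + P 0) / 2 + ln (1 + P 1 / (1 + a1\<^sup>2 * P 0)) / 2) + ln 2)"
    unfolding K_def by (rule weak_z_channel_sum_converse[OF pos(1,2) a code])
  finally have 1: "(1 - 2 * \<epsilon>) * (ln (M 0) + ln (M 1)) \<le> real n * (ln (1 + P 0) / 2 + ln (1 + P 1 / (1 + a1\<^sup>2 * P 0)) / 2) + ln 2"
    using K M[of 0] M[of 1] by (simp add: ln_mult)
  have "K * ((1 - \<epsilon>) * ln (M 2)) \<le> (\<Sum>m\<in>messages M. 1 - E m) * ln (M 2)"
  proof -
    have "K * (1 - \<epsilon>) \<le> (\<Sum>m\<in>messages M. 1 - E m)"
      using sE by (simp add: sum_subtractf K_def right_diff_distrib)
    from mult_right_mono[OF this, of "ln (M 2)"] show ?thesis using l[of 2] by (simp add: mult.assoc)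
  qed
  also have "\<dots> \<le> (\<Sum>m\<in>messages M. measure (gauss n (\<lambda>t. enc 2 (m 2) t + a2 * enc 1 (m 1) t) 1)
        {y \<in> space (gauss n (\<lambda>t. enc 2 (m 2) t + a2 * enc 1 (m 1) t) 1). dec 2 y = m 2}) * ln (M 2)"
  proof (intro mult_right_mono sum_mono l)
    fix m
    have "chan_mean a1 a2 enc m 2 = (\<lambda>t. enc 2 (m 2) t + a2 * enc 1 (m 1) t)"
      by (simp add: chan_mean_def fun_eq_iff)
    then show "1 - E m \<le> measure (gauss n (\<lambda>t. enc 2 (m 2) t + a2 * enc 1 (m 1) t) 1)
        {y \<in> space (gauss n (\<lambda>t. enc 2 (m 2) t + a2 * enc 1 (m 1) t) 1). dec 2 y = m 2}"
      using prob_correct_ge[OF code, of 2 a1 a2 m] unfolding E_def by simp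
  qed simp
  also have "\<dots> \<le> K * (real n * (ln (1 + P 2) / 2) + ln 2)"
    unfolding K_def by (rule single_user_converse[OF pos(3) code])
  finally have "(1 - \<epsilon>) * ln (M 2) \<le> real n * (ln (1 + P 2) / 2) + ln 2"
    using K by simp
  \<comment> \<open>The bound for user 2 has the better factor \<open>1 - \<epsilon>\<close>; it is
    weakened so that the three logarithms can be added with a common factor.\<close>
  moreover have "(1 - 2 * \<epsilon>) * ln (M 2) \<le> (1 - \<epsilon>) * ln (M 2)"
    using \<epsilon> l[of 2] by (intro mult_right_mono) auto
  ultimately show ?thesis using 1 by (simp add: algebra_simps)
qed

lemma gcap_eq: "gcap x = ln (1 + x) / 2 / ln 2"
  by (simp add: gcap_def log_def)

lemma sum_rate_converse:
  assumes pos: "P 0 > 0" "P 1 > 0" "P 2 > 0" and a: "0 \<le> a1" "a1 < 1"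
    and ach: "achievable a1 a2 P R"
  shows "R 0 + R 1 + R 2 \<le> gcap (P 0) + gcap (P 1 / (1 + a1\<^sup>2 * P 0)) + gcap (P 2)"
proof (rule ccontr)
  define T where "T = ln (1 + P 0) / 2 + ln (1 + P 1 / (1 + a1\<^sup>2 * P 0)) / 2 + ln (1 + P 2) / 2"
  define r where "r = (R 0 + R 1 + R 2) * ln 2"
  assume "\<not> ?thesis"
  then have Tr: "T < r"
    unfolding gcap_eq T_def r_def by (simp add: field_simps add_divide_distrib[symmetric])
  have T0: "T \<ge> 0" unfolding T_def using pos by (intro add_nonneg_nonneg) auto
  \<comment> \<open>Chosen so that \<open>(1 - 2 * \<epsilon>) * r\<close> lies exactly halfway
    between \<open>T\<close> and \<open>r\<close>, both measured in nats per channel use. The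
    remaining excess \<open>(r - T) / 2\<close>, multiplied by \<open>n\<close>, eventually beats
    the constant \<open>2 * ln 2\<close>.\<close>
  define \<epsilon> where "\<epsilon> = (r - T) / (4 * r)"
  have \<epsilon>: "\<epsilon> > 0" "\<epsilon> < 1 / 2" and gap: "(1 - 2 * \<epsilon>) * r - T = (r - T) / 2"
    using Tr T0 by (auto simp: \<epsilon>_def field_simps)
  from ach \<epsilon>(1) obtain N where N: "\<And>n. n \<ge> N \<Longrightarrow> \<exists>M enc dec. is_code P n M enc dec \<and>
      (\<forall>i<3. real (M i) \<ge> 2 powr (real n * R i)) \<and> error_prob a1 a2 n M enc dec \<le> \<epsilon>"
    unfolding achievable_def by blast
  obtain n0 :: nat where n0: "real n0 > 2 * ln 2 / ((r - T) / 2)" using reals_Archimedean2 by blast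
  define n where "n = max N n0"
  have "real n0 \<le> real n" by (simp add: n_def)
  then have n: "real n > 2 * ln 2 / ((r - T) / 2)" using n0 by linarith
  from N[of n] obtain M enc dec where code: "is_code P n M enc dec"
    and rate: "\<And>i. i < 3 \<Longrightarrow> real (M i) \<ge> 2 powr (real n * R i)"
    and err: "error_prob a1 a2 n M enc dec \<le> \<epsilon>" by (auto simp: n_def)
  have lnM: "ln (real (M i)) \<ge> real n * R i * ln 2" if "i < 3" for i
  proof -
    have "ln (2 powr (real n * R i)) \<le> ln (real (M i))"
      using rate[OF that] by (intro ln_mono) auto
    then show ?thesis by (simp add: ln_powr)
  qed
  have "(1 - 2 * \<epsilon>) * (real n * r) \<le> (1 - 2 * \<epsilon>) * (ln (M 0) + ln (M 1) + ln (M 2))"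
    using lnM[of 0] lnM[of 1] lnM[of 2] \<epsilon> by (intro mult_left_mono) (auto simp: r_def algebra_simps)
  also have "\<dots> \<le> n * T + 2 * ln 2"
    unfolding T_def by (rule code_rate_bound[OF pos a code err])
  finally have "real n * ((1 - 2 * \<epsilon>) * r - T) \<le> 2 * ln 2" by (simp add: algebra_simps)
  then have "real n * ((r - T) / 2) \<le> 2 * ln 2" unfolding gap .
  then show False using n Tr by (simp add: field_simps)
qed

section \<open>Gaussian arrays\<close>

definition near :: "nat \<Rightarrow> real \<Rightarrow> (nat \<Rightarrow> real) \<Rightarrow> (nat \<Rightarrow> real) \<Rightarrow> bool" where
  "near n T y x \<longleftrightarrow> (\<Sum>t<n. (y t - x t)\<^sup>2) \<le> T"

definition unique_near :: "nat \<Rightarrow> real \<Rightarrow> nat \<Rightarrow> (nat \<Rightarrow> real) \<Rightarrow> (nat \<Rightarrow> nat \<Rightarrow> real) \<Rightarrow> nat \<Rightarrow> bool" where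
  "unique_near n T K y x k0 \<longleftrightarrow> near n T y (x k0) \<and> (\<forall>k<K. k \<noteq> k0 \<longrightarrow> \<not> near n T y (x k))"

text \<open>A label stands for a whole sequence of length \<open>n\<close>: one codeword or one
  noise. Signals are linear combinations of labels with coefficients that do not depend on time, so
  they are described by a coefficient vector; its squared norm is the power, and disjoint supports
  mean independence.\<close>

locale gaussian_array = prob_space +
  fixes L :: "'l set" and n :: nat and G :: "'l \<times> nat \<Rightarrow> 'a \<Rightarrow> real"
  assumes finite_labels: "finite L"
    and indep: "indep_vars (\<lambda>_. borel) G (L \<times> {..<n})"
    and std_normal: "\<And>k. k \<in> L \<times> {..<n} \<Longrightarrow> distributed M lborel (G k) std_normal_density"
begin

definition lin :: "('l \<Rightarrow> real) \<Rightarrow> nat \<Rightarrow> 'a \<Rightarrow> real" where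
  "lin c t \<omega> = (\<Sum>l\<in>L. c l * G (l, t) \<omega>)"

lemma measurable_G:
  assumes "l \<in> L" "t < n"
  shows "G (l, t) \<in> borel_measurable M"
  using indep assms by (auto simp: indep_vars_def)

lemma measurable_lin [measurable]:
  assumes "t < n"
  shows "lin c t \<in> borel_measurable M"
  unfolding lin_def using assms
  by (intro borel_measurable_sum borel_measurable_times borel_measurable_const measurable_G) auto

lemma lin_add: "lin (\<lambda>l. c l + d l) t \<omega> = lin c t \<omega> + lin d t \<omega>"
  by (simp add: lin_def distrib_right sum.distrib)

lemma distributed_lin:
  assumes t: "t < n" and s: "s > 0" "(\<Sum>l\<in>L. (c l)\<^sup>2) = s\<^sup>2"
  shows "distributed M lborel (lin c t) (normal_density 0 s)"
proof -
  \<comment> \<open>Zero coefficients are dropped because sums of independent normals are formed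
    from summands of positive deviation; \<open>s > 0\<close> guarantees that something is
    left.\<close>
  define L' where "L' = {l \<in> L. c l \<noteq> 0}"
  have fin: "finite L'" using finite_labels by (simp add: L'_def)
  have sq: "(\<Sum>l\<in>L'. \<bar>c l\<bar>\<^sup>2) = s\<^sup>2"
    unfolding s(2)[symmetric] L'_def using finite_labels by (intro sum.mono_neutral_cong_left) auto
  have ne: "L' \<noteq> {}" using sq s by auto
  have ind: "indep_vars (\<lambda>_. borel) (\<lambda>l \<omega>. c l * G (l, t) \<omega>) L'"
  proof -
    have "indep_vars (\<lambda>l. Pi\<^sub>M {(l, t)} (\<lambda>_. borel)) (\<lambda>l \<omega>. restrict (\<lambda>i. G i \<omega>) {(l, t)}) L'"
      by (rule indep_vars_restrict[OF indep]) (use t in \<open>auto simp: L'_def disjoint_family_on_def\<close>)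
    then have "indep_vars (\<lambda>_. borel) (\<lambda>l \<omega>. c l * (restrict (\<lambda>i. G i \<omega>) {(l, t)}) (l, t)) L'"
      by (rule indep_vars_compose2[where Y = "\<lambda>l f. c l * f (l, t)"]) measurable
    then show ?thesis by simp
  qed
  have "distributed M lborel (\<lambda>\<omega>. \<Sum>l\<in>L'. c l * G (l, t) \<omega>)
      (normal_density (\<Sum>l\<in>L'. 0) (sqrt (\<Sum>l\<in>L'. \<bar>c l\<bar>\<^sup>2)))"
  proof (rule sum_indep_normal[OF fin ne ind])
    fix l assume l: "l \<in> L'"
    then show "0 < \<bar>c l\<bar>" by (simp add: L'_def)
    have "distributed M lborel (G (l, t)) (normal_density 0 1)"
      using l t std_normal[of "(l, t)"] by (simp add: L'_def)
    from normal_density_affine[OF this, of "c l" 0] l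
    show "distributed M lborel (\<lambda>\<omega>. c l * G (l, t) \<omega>) (normal_density 0 \<bar>c l\<bar>)"
      by (simp add: L'_def)
  qed
  moreover have "(\<lambda>\<omega>. \<Sum>l\<in>L'. c l * G (l, t) \<omega>) = lin c t"
    unfolding lin_def L'_def using finite_labels by (intro ext sum.mono_neutral_cong_left) auto
  ultimately show ?thesis using s sq by simp
qed

lemma indep_slices:
  assumes h: "\<And>t. t < n \<Longrightarrow> h t \<in> borel_measurable (Pi\<^sub>M (L \<times> {t}) (\<lambda>_. borel))"
  shows "indep_vars (\<lambda>_. borel) (\<lambda>t \<omega>. h t (restrict (\<lambda>i. G i \<omega>) (L \<times> {t})) :: real) {..<n}"
proof -
  have "indep_vars (\<lambda>t. Pi\<^sub>M (L \<times> {t}) (\<lambda>_. borel)) (\<lambda>t \<omega>. restrict (\<lambda>i. G i \<omega>) (L \<times> {t})) {..<n}"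
    by (rule indep_vars_restrict[OF indep]) (auto simp: disjoint_family_on_def)
  then show ?thesis by (rule indep_vars_compose2) (use h in auto)
qed

lemma indep_pair_function_of_lin:
  assumes h: "(\<lambda>(u, v). h u v) \<in> borel_measurable (borel \<Otimes>\<^sub>M borel)"
  shows "indep_vars (\<lambda>_. borel) (\<lambda>t \<omega>. h (lin c t \<omega>) (lin d t \<omega>) :: real) {..<n}"
proof -
  have lin_eq: "lin c t \<omega> = (\<Sum>l\<in>L. c l * (restrict (\<lambda>i. G i \<omega>) (L \<times> {t})) (l, t))" for c t \<omega>
    by (simp add: lin_def)
  have m: "(\<lambda>f. \<Sum>l\<in>L. c l * f (l, t)) \<in> borel_measurable (Pi\<^sub>M (L \<times> {t}) (\<lambda>_. borel))" for c :: "'l \<Rightarrow> real" and t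
    by (intro borel_measurable_sum borel_measurable_times borel_measurable_const measurable_component_singleton) auto
  have "(\<lambda>f. h (\<Sum>l\<in>L. c l * f (l, t)) (\<Sum>l\<in>L. d l * f (l, t))) \<in> borel_measurable (Pi\<^sub>M (L \<times> {t}) (\<lambda>_. borel))" for t
    using measurable_compose[OF measurable_Pair[OF m m] h] by simp
  then show ?thesis unfolding lin_eq by (rule indep_slices)
qed

text \<open>The indicator of a nonnegative sum is at most the exponential of the sum, whose
  expectation factorises. The tilting parameter is absorbed into \<open>X\<close>, so each use only
  has to compute one exponential moment.\<close>

lemma chernoff:
  fixes q :: real
  assumes ind: "indep_vars (\<lambda>_. borel) X {..<n}" and q: "q \<ge> 0"
    and E: "\<And>t. t < n \<Longrightarrow> (\<integral>\<^sup>+\<omega>. ennreal (exp (X t \<omega>)) \<partial>M) \<le> ennreal q"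
  shows "prob {\<omega> \<in> space M. (\<Sum>t<n. X t \<omega>) \<ge> 0} \<le> q ^ n"
proof -
  have X [measurable]: "X t \<in> borel_measurable M" if "t < n" for t
    using ind that by (auto simp: indep_vars_def)
  have "emeasure M {\<omega> \<in> space M. (\<Sum>t<n. X t \<omega>) \<ge> 0}
      = (\<integral>\<^sup>+\<omega>. indicator {\<omega> \<in> space M. (\<Sum>t<n. X t \<omega>) \<ge> 0} \<omega> \<partial>M)"
    by (intro nn_integral_indicator[symmetric] borel_measurable_le borel_measurable_const borel_measurable_sum) auto
  also have "\<dots> \<le> (\<integral>\<^sup>+\<omega>. (\<Prod>t<n. ennreal (exp (X t \<omega>))) \<partial>M)"
    by (intro nn_integral_mono) (auto simp: indicator_def prod_ennreal exp_sum[symmetric])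
  also have "\<dots> = (\<Prod>t<n. \<integral>\<^sup>+\<omega>. ennreal (exp (X t \<omega>)) \<partial>M)"
  proof (rule indep_vars_nn_integral)
    show "indep_vars (\<lambda>_. borel) (\<lambda>t \<omega>. ennreal (exp (X t \<omega>))) {..<n}"
      by (rule indep_vars_compose2[OF ind]) measurable
  qed auto
  also have "\<dots> \<le> (\<Prod>t<n. ennreal q)"
    by (intro prod_mono_ennreal) (auto intro: E)
  also have "\<dots> = ennreal (q ^ n)" using q by (simp add: ennreal_power)
  finally show ?thesis using q by (simp add: emeasure_eq_measure)
qed

text \<open>For \<open>e > 0\<close> this is the upper and for \<open>e < 0\<close> the lower tail.\<close>

lemma chi_square_tail:
  fixes s e :: real
  assumes s: "s > 0" "(\<Sum>l\<in>L. (c l)\<^sup>2) = s\<^sup>2" and e: "e > -1"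
  shows "prob {\<omega> \<in> space M. 0 \<le> e * ((\<Sum>t<n. (lin c t \<omega>)\<^sup>2) - n * s\<^sup>2 * (1 + e))} \<le> sqrt ((1 + e) * exp (- e)) ^ n"
proof -
  \<comment> \<open>The coefficient \<open>e / (2 * (1 + e) * s\<^sup>2)\<close> is the optimal
    tilt: it turns variance \<open>s\<^sup>2\<close> into \<open>s\<^sup>2 * (1 + e)\<close>, the
    value at the threshold. It is negative for the lower tail.\<close>
  define X where "X t \<omega> = e / (2 * (1 + e) * s\<^sup>2) * (lin c t \<omega>)\<^sup>2 - e / 2" for t \<omega>
  have "{\<omega> \<in> space M. 0 \<le> e * ((\<Sum>t<n. (lin c t \<omega>)\<^sup>2) - n * s\<^sup>2 * (1 + e))}
      = {\<omega> \<in> space M. (\<Sum>t<n. X t \<omega>) \<ge> 0}"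
  proof (intro Collect_cong conj_cong refl)
    fix \<omega>
    have "(\<Sum>t<n. X t \<omega>) = e / (2 * (1 + e) * s\<^sup>2) * (\<Sum>t<n. (lin c t \<omega>)\<^sup>2) - n * (e / 2)"
      unfolding X_def by (simp add: sum_subtractf sum_distrib_left)
    also have "\<dots> = (e * ((\<Sum>t<n. (lin c t \<omega>)\<^sup>2) - n * s\<^sup>2 * (1 + e))) / (2 * (1 + e) * s\<^sup>2)"
    proof -
      have k: "1 + e \<noteq> 0" "s \<noteq> 0" using e s(1) by auto
      have "n * (e / 2) = e * (n * s\<^sup>2 * k) / (2 * k * s\<^sup>2)" if "k \<noteq> 0" for k using k that by simp
      from this[OF k(1)] show ?thesis by (simp only: right_diff_distrib diff_divide_distrib times_divide_eq_left)
    qed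
    finally have eq: "(\<Sum>t<n. X t \<omega>) = (e * ((\<Sum>t<n. (lin c t \<omega>)\<^sup>2) - n * s\<^sup>2 * (1 + e))) / (2 * (1 + e) * s\<^sup>2)" .
    have "2 * (1 + e) * s\<^sup>2 > 0" using s(1) e by (intro mult_pos_pos) auto
    then show "(0 \<le> e * ((\<Sum>t<n. (lin c t \<omega>)\<^sup>2) - n * s\<^sup>2 * (1 + e))) \<longleftrightarrow> (\<Sum>t<n. X t \<omega>) \<ge> 0"
      unfolding eq by (simp only: zero_le_divide_iff) linarith
  qed
  moreover have "prob {\<omega> \<in> space M. (\<Sum>t<n. X t \<omega>) \<ge> 0} \<le> sqrt ((1 + e) * exp (- e)) ^ n"
  proof (rule chernoff)
    show "indep_vars (\<lambda>_. borel) X {..<n}"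
      unfolding X_def by (rule indep_pair_function_of_lin[where h = "\<lambda>u v. e / (2 * (1 + e) * s\<^sup>2) * u\<^sup>2 - e / 2" and d = c]) measurable
    show "0 \<le> sqrt ((1 + e) * exp (- e))" using e by simp
    fix t assume t: "t < n"
    have "(\<integral>\<^sup>+\<omega>. ennreal (exp (X t \<omega>)) \<partial>M)
        = (\<integral>\<^sup>+x. ennreal (normal_density 0 s x) * ennreal (exp (e / (2 * (1 + e) * s\<^sup>2) * x\<^sup>2 - e / 2)) \<partial>lborel)"
      unfolding X_def
      by (rule distributed_nn_integral[OF distributed_lin[OF t s], symmetric]) measurable
    \<comment> \<open>The tilted density is again Gaussian up to a constant, so the exponential
      moment is that constant.\<close>
    also have "\<dots> = (\<integral>\<^sup>+x. ennreal (sqrt ((1 + e) * exp (- e))) * ennreal (normal_density 0 (s * sqrt (1 + e)) x) \<partial>lborel)"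
    proof (intro nn_integral_cong)
      fix x :: real
      have "normal_density 0 s x * exp (e / (2 * (1 + e) * s\<^sup>2) * x\<^sup>2 - e / 2)
          = 1 / sqrt (2 * pi * s\<^sup>2) * exp (- x\<^sup>2 / (2 * s\<^sup>2) + (e / (2 * (1 + e) * s\<^sup>2) * x\<^sup>2 - e / 2))"
        unfolding normal_density_def by (subst exp_add) simp
      also have "- x\<^sup>2 / (2 * s\<^sup>2) + (e / (2 * (1 + e) * s\<^sup>2) * x\<^sup>2 - e / 2) = - x\<^sup>2 / (2 * (s * sqrt (1 + e))\<^sup>2) + - e / 2"
      proof -
        have "(k - 1) / (2 * k * s\<^sup>2) * x\<^sup>2 = x\<^sup>2 / (2 * s\<^sup>2) - x\<^sup>2 / (2 * (s\<^sup>2 * k))" if "k \<noteq> 0" for k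
          using s(1) that by (simp add: field_simps)
        from this[of "1 + e"] show ?thesis using e by (simp add: power_mult_distrib)
      qed
      also have "1 / sqrt (2 * pi * s\<^sup>2) * exp (- x\<^sup>2 / (2 * (s * sqrt (1 + e))\<^sup>2) + - e / 2)
          = (sqrt (1 + e) * exp (- e / 2)) * normal_density 0 (s * sqrt (1 + e)) x"
        using s(1) e unfolding normal_density_def by (subst exp_add) (simp add: real_sqrt_mult mult_ac)
      also have "sqrt (1 + e) * exp (- e / 2) = sqrt ((1 + e) * exp (- e))"
      proof -
        have "sqrt (exp (- e)) = exp (- e / 2)"
          by (rule real_sqrt_unique) (simp_all flip: exp_of_nat_mult)
        then show ?thesis by (simp only: real_sqrt_mult)
      qed
      finally show "ennreal (normal_density 0 s x) * ennreal (exp (e / (2 * (1 + e) * s\<^sup>2) * x\<^sup>2 - e / 2))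
         = ennreal (sqrt ((1 + e) * exp (- e))) * ennreal (normal_density 0 (s * sqrt (1 + e)) x)"
        using e by (simp add: ennreal_mult[symmetric])
    qed
    also have "\<dots> = ennreal (sqrt ((1 + e) * exp (- e)))"
      using s(1) e by (subst nn_integral_cmult) (auto simp: nn_integral_eq_integral)
    finally show "(\<integral>\<^sup>+\<omega>. ennreal (exp (X t \<omega>)) \<partial>M) \<le> ennreal (sqrt ((1 + e) * exp (- e)))" by simp
  qed
  ultimately show ?thesis by simp
qed

lemma indep_lin:
  assumes t: "t < n" and disj: "\<And>l. l \<in> L \<Longrightarrow> c l = 0 \<or> d l = 0"
  shows "indep_var borel (lin c t) borel (lin d t)"
proof -
  \<comment> \<open>\<open>B\<close> is the complement of the support of \<open>c\<close> and
    contains the support of \<open>d\<close> by \<open>disj\<close>; the two forms therefore read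
    disjoint parts of the array.\<close>
  define A B where "A = {l \<in> L. c l \<noteq> 0}" and "B = {l \<in> L. c l = 0}"
  have fin: "finite A" "finite B" using finite_labels by (simp_all add: A_def B_def)
  have "indep_var (Pi\<^sub>M (A \<times> {t}) (\<lambda>_. borel)) (\<lambda>\<omega>. restrict (\<lambda>i. G i \<omega>) (A \<times> {t}))
     (Pi\<^sub>M (B \<times> {t}) (\<lambda>_. borel)) (\<lambda>\<omega>. restrict (\<lambda>i. G i \<omega>) (B \<times> {t}))"
    by (rule indep_var_restrict[OF indep]) (use t in \<open>auto simp: A_def B_def\<close>)
  then have "indep_var borel ((\<lambda>f. \<Sum>l\<in>A. c l * f (l, t)) \<circ> (\<lambda>\<omega>. restrict (\<lambda>i. G i \<omega>) (A \<times> {t})))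
     borel ((\<lambda>f. \<Sum>l\<in>B. d l * f (l, t)) \<circ> (\<lambda>\<omega>. restrict (\<lambda>i. G i \<omega>) (B \<times> {t})))"
    by (rule indep_var_compose) (auto intro!: borel_measurable_sum borel_measurable_times measurable_component_singleton)
  moreover have "(\<lambda>f. \<Sum>l\<in>A. c l * f (l, t)) \<circ> (\<lambda>\<omega>. restrict (\<lambda>i. G i \<omega>) (A \<times> {t})) = lin c t"
  proof
    fix \<omega> show "((\<lambda>f. \<Sum>l\<in>A. c l * f (l, t)) \<circ> (\<lambda>\<omega>. restrict (\<lambda>i. G i \<omega>) (A \<times> {t}))) \<omega> = lin c t \<omega>"
      unfolding comp_def lin_def using finite_labels by (intro sum.mono_neutral_cong_left) (auto simp: A_def)
  qed
  moreover have "(\<lambda>f. \<Sum>l\<in>B. d l * f (l, t)) \<circ> (\<lambda>\<omega>. restrict (\<lambda>i. G i \<omega>) (B \<times> {t})) = lin d t"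
  proof
    fix \<omega> show "((\<lambda>f. \<Sum>l\<in>B. d l * f (l, t)) \<circ> (\<lambda>\<omega>. restrict (\<lambda>i. G i \<omega>) (B \<times> {t}))) \<omega> = lin d t \<omega>"
      unfolding comp_def lin_def using finite_labels disj by (intro sum.mono_neutral_cong_left) (auto simp: B_def)
  qed
  ultimately show ?thesis by simp
qed

text \<open>\<open>c\<close> is the received signal and \<open>d\<close> a wrong codeword,
  independent of it. The exponent is the log-likelihood ratio of channel law against output law,
  without its constant; the lower bound on the received energy makes this ratio large whenever the
  wrong word is close. The resulting base is \<open>exp \<delta>\<close> times the inverse of the
  exponential of the capacity in nats.\<close>

lemma confusion_prob:
  fixes S N \<delta> :: real
  assumes S: "S > 0" and N: "N > 0"
    and c: "(\<Sum>l\<in>L. (c l)\<^sup>2) = S + N" and d: "(\<Sum>l\<in>L. (d l)\<^sup>2) = S"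
    and disj: "\<And>l. l \<in> L \<Longrightarrow> c l = 0 \<or> d l = 0"
  shows "prob {\<omega> \<in> space M. (\<Sum>t<n. (lin c t \<omega> - lin d t \<omega>)\<^sup>2) \<le> n * N * (1 + \<delta>)
      \<and> (\<Sum>t<n. (lin c t \<omega>)\<^sup>2) \<ge> n * (S + N) * (1 - \<delta>)} \<le> (exp \<delta> * sqrt (N / (S + N))) ^ n"
proof -
  have SN: "S + N > 0" using S N by simp
  \<comment> \<open>On the event, the second summand costs at most \<open>(1 + \<delta>) / 2\<close>
    per letter and the third returns at least \<open>(1 - \<delta>) / 2\<close>; the offset
    \<open>\<delta>\<close> is exactly the deficit.\<close>
  define X where "X t \<omega> = \<delta> - (lin c t \<omega> - lin d t \<omega>)\<^sup>2 / (2 * N) + (lin c t \<omega>)\<^sup>2 / (2 * (S + N))" for t \<omega>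
  have sumX: "(\<Sum>t<n. X t \<omega>) = n * \<delta> - (\<Sum>t<n. (lin c t \<omega> - lin d t \<omega>)\<^sup>2) / (2 * N) + (\<Sum>t<n. (lin c t \<omega>)\<^sup>2) / (2 * (S + N))" for \<omega>
    unfolding X_def by (simp only: sum.distrib sum_subtractf sum_divide_distrib sum_constant card_lessThan)
  have sub: "(\<Sum>t<n. X t \<omega>) \<ge> 0" if 1: "(\<Sum>t<n. (lin c t \<omega> - lin d t \<omega>)\<^sup>2) \<le> n * N * (1 + \<delta>)"
      and 2: "(\<Sum>t<n. (lin c t \<omega>)\<^sup>2) \<ge> n * (S + N) * (1 - \<delta>)" for \<omega>
  proof -
    have "(\<Sum>t<n. (lin c t \<omega> - lin d t \<omega>)\<^sup>2) / (2 * N) \<le> n * N * (1 + \<delta>) / (2 * N)"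
      using N by (intro divide_right_mono 1) simp
    moreover have "(\<Sum>t<n. (lin c t \<omega>)\<^sup>2) / (2 * (S + N)) \<ge> n * (S + N) * (1 - \<delta>) / (2 * (S + N))"
      using SN by (intro divide_right_mono 2) simp
    moreover have "n * N * (1 + \<delta>) / (2 * N) = n / 2 + n * \<delta> / 2" using N by (simp add: field_simps)
    moreover have "n * (S + N) * (1 - \<delta>) / (2 * (S + N)) = n / 2 - n * \<delta> / 2"
    proof -
      have "n * (S + N) * (1 - \<delta>) / (2 * (S + N)) = n * (1 - \<delta>) / 2"
        using SN nonzero_mult_divide_mult_cancel_left[of "S + N" "n * (1 - \<delta>)" 2] by (simp only: mult_ac)
      then show ?thesis by (simp add: right_diff_distrib diff_divide_distrib)
    qed
    ultimately show ?thesis unfolding sumX by linarith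
  qed
  have ind: "indep_vars (\<lambda>_. borel) X {..<n}"
    unfolding X_def by (rule indep_pair_function_of_lin[where h = "\<lambda>u v. \<delta> - (u - v)\<^sup>2 / (2 * N) + u\<^sup>2 / (2 * (S + N))"]) measurable
  have Xm: "X t \<in> borel_measurable M" if "t < n" for t
    using ind that by (auto simp: indep_vars_def)
  have "prob {\<omega> \<in> space M. (\<Sum>t<n. (lin c t \<omega> - lin d t \<omega>)\<^sup>2) \<le> n * N * (1 + \<delta>)
      \<and> (\<Sum>t<n. (lin c t \<omega>)\<^sup>2) \<ge> n * (S + N) * (1 - \<delta>)} \<le> prob {\<omega> \<in> space M. (\<Sum>t<n. X t \<omega>) \<ge> 0}"
    using sub by (intro finite_measure_mono borel_measurable_le borel_measurable_const borel_measurable_sum) (auto intro: Xm)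
  also have "\<dots> \<le> (exp \<delta> * sqrt (N / (S + N))) ^ n"
  proof (rule chernoff[OF ind])
    show "0 \<le> exp \<delta> * sqrt (N / (S + N))" using SN N by simp
    fix t assume t: "t < n"
    have D: "distributed M (lborel \<Otimes>\<^sub>M lborel) (\<lambda>\<omega>. (lin d t \<omega>, lin c t \<omega>))
        (\<lambda>(x, y). ennreal (normal_density 0 (sqrt S) x) * ennreal (normal_density 0 (sqrt (S + N)) y))"
    proof (rule distributed_joint_indep)
      show "sigma_finite_measure (lborel :: real measure)" "sigma_finite_measure (lborel :: real measure)" ..
      show "distributed M lborel (lin d t) (\<lambda>x. ennreal (normal_density 0 (sqrt S) x))"
        using S d t by (intro distributed_lin) auto
      show "distributed M lborel (lin c t) (\<lambda>x. ennreal (normal_density 0 (sqrt (S + N)) x))"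
        using SN c t by (intro distributed_lin) auto
      have "indep_var borel (lin d t) borel (lin c t)" using disj by (intro indep_lin[OF t]) auto
      from indep_var_compose[OF this, of "\<lambda>x. x" lborel "\<lambda>x. x" lborel]
      show "indep_var lborel (lin d t) lborel (lin c t)" by (simp add: comp_def)
    qed
    define h where "h x y = exp (\<delta> - (y - x)\<^sup>2 / (2 * N) + y\<^sup>2 / (2 * (S + N)))" for x y :: real
    have hm [measurable]: "(\<lambda>w. h (fst w) (snd w)) \<in> borel_measurable (borel \<Otimes>\<^sub>M borel)"
      unfolding h_def by measurable
    have "(\<integral>\<^sup>+\<omega>. ennreal (exp (X t \<omega>)) \<partial>M) = (\<integral>\<^sup>+\<omega>. ennreal (h (fst (lin d t \<omega>, lin c t \<omega>)) (snd (lin d t \<omega>, lin c t \<omega>))) \<partial>M)"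
      by (simp add: X_def h_def)
    also have "\<dots> = (\<integral>\<^sup>+w. (case w of (x, y) \<Rightarrow> ennreal (normal_density 0 (sqrt S) x) * ennreal (normal_density 0 (sqrt (S + N)) y)) * ennreal (h (fst w) (snd w)) \<partial>(lborel \<Otimes>\<^sub>M lborel))"
      by (rule distributed_nn_integral[OF D, symmetric, where g = "\<lambda>w. ennreal (h (fst w) (snd w))"]) measurable
    also have "\<dots> = (\<integral>\<^sup>+x. \<integral>\<^sup>+y. ennreal (normal_density 0 (sqrt S) x) * ennreal (normal_density 0 (sqrt (S + N)) y) * ennreal (h x y) \<partial>lborel \<partial>lborel)"
      by (subst lborel.nn_integral_fst[symmetric]) (auto simp: case_prod_beta')
    \<comment> \<open>The term in \<open>y\<close> cancels the Gaussian weight of the output and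
      leaves, up to normalisation, the density of \<open>y\<close> around \<open>x\<close> with
      variance \<open>N\<close>, which integrates to 1 for every \<open>x\<close>.\<close>
    also have "\<dots> = (\<integral>\<^sup>+x. \<integral>\<^sup>+y. ennreal (exp \<delta> * sqrt (N / (S + N)) * normal_density 0 (sqrt S) x) * ennreal (normal_density x (sqrt N) y) \<partial>lborel \<partial>lborel)"
    proof (intro nn_integral_cong)
      fix x y :: real
      have "normal_density 0 (sqrt (S + N)) y * h x y
         = 1 / sqrt (2 * pi * (S + N)) * (exp (- y\<^sup>2 / (2 * (S + N))) * h x y)"
        using SN by (simp add: normal_density_def)
      also have "exp (- y\<^sup>2 / (2 * (S + N))) * h x y = exp \<delta> * exp (- (y - x)\<^sup>2 / (2 * N))"
        unfolding h_def by (simp flip: exp_add)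
      also have "1 / sqrt (2 * pi * (S + N)) * (exp \<delta> * exp (- (y - x)\<^sup>2 / (2 * N)))
         = exp \<delta> * sqrt (N / (S + N)) * normal_density x (sqrt N) y"
        using N SN by (simp add: normal_density_def real_sqrt_mult real_sqrt_divide)
      finally show "ennreal (normal_density 0 (sqrt S) x) * ennreal (normal_density 0 (sqrt (S + N)) y) * ennreal (h x y)
        = ennreal (exp \<delta> * sqrt (N / (S + N)) * normal_density 0 (sqrt S) x) * ennreal (normal_density x (sqrt N) y)"
        using N SN by (simp add: h_def ennreal_mult[symmetric] mult_ac)
    qed
    also have "\<dots> = (\<integral>\<^sup>+x. ennreal (exp \<delta> * sqrt (N / (S + N))) * ennreal (normal_density 0 (sqrt S) x) \<partial>lborel)"
      using N SN by (intro nn_integral_cong) (simp add: nn_integral_cmult nn_integral_eq_integral ennreal_mult[symmetric])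
    also have "\<dots> = ennreal (exp \<delta> * sqrt (N / (S + N)))"
      using S by (subst nn_integral_cmult) (auto simp: nn_integral_eq_integral)
    finally show "(\<integral>\<^sup>+\<omega>. ennreal (exp (X t \<omega>)) \<partial>M) \<le> ennreal (exp \<delta> * sqrt (N / (S + N)))" by simp
  qed
  finally show ?thesis .
qed

text \<open>One decoding stage with signal power \<open>S\<close> and effective noise
  \<open>w\<close> of power \<open>N\<close>, where \<open>w\<close> may contain codewords of other
  users. It fails only if the noise is too strong, the received energy is too small, or a wrong
  codeword is close although the energy is normal. The supports of the sent word and
  \<open>w\<close> are disjoint, so their powers add.\<close>

lemma link_error_prob:
  fixes S N \<delta> :: real and sig :: "nat \<Rightarrow> 'l \<Rightarrow> real" and w :: "'l \<Rightarrow> real"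
  assumes S: "S > 0" and N: "N > 0" and \<delta>: "0 < \<delta>" "\<delta> < 1"
    and w: "(\<Sum>l\<in>L. (w l)\<^sup>2) = N"
    and sig: "\<And>k. k < K \<Longrightarrow> (\<Sum>l\<in>L. (sig k l)\<^sup>2) = S"
    and k0: "k0 < K" and orth: "\<And>l. l \<in> L \<Longrightarrow> sig k0 l = 0 \<or> w l = 0"
    and disj: "\<And>k l. k < K \<Longrightarrow> k \<noteq> k0 \<Longrightarrow> l \<in> L \<Longrightarrow> sig k0 l + w l = 0 \<or> sig k l = 0"
  shows "{\<omega> \<in> space M. \<not> unique_near n (n * N * (1 + \<delta>)) K (\<lambda>t. lin (sig k0) t \<omega> + lin w t \<omega>) (\<lambda>k t. lin (sig k) t \<omega>) k0} \<in> events"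
    and "prob {\<omega> \<in> space M. \<not> unique_near n (n * N * (1 + \<delta>)) K (\<lambda>t. lin (sig k0) t \<omega> + lin w t \<omega>) (\<lambda>k t. lin (sig k) t \<omega>) k0}
      \<le> sqrt ((1 + \<delta>) * exp (- \<delta>)) ^ n + sqrt ((1 - \<delta>) * exp \<delta>) ^ n + K * (exp \<delta> * sqrt (N / (S + N))) ^ n"
proof -
  define c where "c l = sig k0 l + w l" for l
  have lin_c: "lin (sig k0) t \<omega> + lin w t \<omega> = lin c t \<omega>" for t \<omega>
    unfolding c_def lin_add ..
  have lin_w: "lin c t \<omega> - lin (sig k0) t \<omega> = lin w t \<omega>" for t \<omega>
    unfolding c_def lin_add by simp
  have SN: "S + N > 0" using S N by simp
  have c: "(\<Sum>l\<in>L. (c l)\<^sup>2) = S + N"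
  proof -
    have "(\<Sum>l\<in>L. (c l)\<^sup>2) = (\<Sum>l\<in>L. (sig k0 l)\<^sup>2 + (w l)\<^sup>2)"
      unfolding c_def using orth by (intro sum.cong refl) fastforce
    then show ?thesis using sig[OF k0] w by (simp add: sum.distrib)
  qed
  define \<rho> where "\<rho> = (exp \<delta> * sqrt (N / (S + N))) ^ n"
  have \<rho>: "\<rho> \<ge> 0" using N SN by (simp add: \<rho>_def)
  \<comment> \<open>\<open>A\<close>: the sent word falls outside the ball. \<open>B\<close>: the
    received energy is too low, an instance of the lower tail with deviation
    \<open>- \<delta>\<close>. \<open>C k\<close>: word \<open>k\<close> is confused with the sent
    one while the energy is normal.\<close>
  define A where "A = {\<omega> \<in> space M. 0 \<le> \<delta> * ((\<Sum>t<n. (lin w t \<omega>)\<^sup>2) - n * (sqrt N)\<^sup>2 * (1 + \<delta>))}"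
  define B where "B = {\<omega> \<in> space M. 0 \<le> (- \<delta>) * ((\<Sum>t<n. (lin c t \<omega>)\<^sup>2) - n * (sqrt (S + N))\<^sup>2 * (1 + - \<delta>))}"
  define C where "C k = {\<omega> \<in> space M. (\<Sum>t<n. (lin c t \<omega> - lin (sig k) t \<omega>)\<^sup>2) \<le> n * N * (1 + \<delta>)
      \<and> (\<Sum>t<n. (lin c t \<omega>)\<^sup>2) \<ge> n * (S + N) * (1 - \<delta>)}" for k
  define U where "U = (\<Union>k\<in>{..<K} - {k0}. C k)"
  have energy: "(\<lambda>\<omega>. \<Sum>t<n. (lin d t \<omega>)\<^sup>2) \<in> borel_measurable M" for d
    by (intro borel_measurable_sum borel_measurable_power measurable_lin) auto
  have energy_diff: "(\<lambda>\<omega>. \<Sum>t<n. (lin c t \<omega> - lin d t \<omega>)\<^sup>2) \<in> borel_measurable M" for d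
    by (intro borel_measurable_sum borel_measurable_power borel_measurable_diff measurable_lin) auto
  note [measurable] = energy energy_diff
  have meas: "A \<in> events" "B \<in> events" "\<And>k. C k \<in> events"
    unfolding A_def B_def C_def by measurable
  then have U: "U \<in> events" unfolding U_def by auto
  let ?bad = "{\<omega> \<in> space M. \<not> unique_near n (n * N * (1 + \<delta>)) K (\<lambda>t. lin (sig k0) t \<omega> + lin w t \<omega>) (\<lambda>k t. lin (sig k) t \<omega>) k0}"
  show bad: "?bad \<in> events"
    unfolding unique_near_def near_def lin_c by measurable
  have "?bad \<subseteq> A \<union> B \<union> U"
  proof
    fix \<omega> assume \<omega>: "\<omega> \<in> ?bad"
    show "\<omega> \<in> A \<union> B \<union> U"
    proof (rule ccontr)
      assume n: "\<omega> \<notin> A \<union> B \<union> U"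
      have sp: "\<omega> \<in> space M" using \<omega> by simp
      have "(\<Sum>t<n. (lin w t \<omega>)\<^sup>2) \<le> n * N * (1 + \<delta>)"
        using n sp \<delta> N by (auto simp: A_def not_le mult_less_0_iff)
      moreover have "(\<Sum>t<n. (lin c t \<omega>)\<^sup>2) \<ge> n * (S + N) * (1 - \<delta>)"
        using n sp \<delta> SN by (auto simp: B_def not_le zero_less_mult_iff)
      then have "\<not> (\<Sum>t<n. (lin c t \<omega> - lin (sig k) t \<omega>)\<^sup>2) \<le> n * N * (1 + \<delta>)" if "k < K" "k \<noteq> k0" for k
        using n sp that by (auto simp: U_def C_def)
      ultimately show False using \<omega> by (auto simp: unique_near_def near_def lin_c lin_w)
    qed
  qed
  then have "prob ?bad \<le> prob (A \<union> B \<union> U)" using meas U by (intro finite_measure_mono) auto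
  also have "\<dots> \<le> prob A + prob B + prob U"
    using meas U measure_Un_le[of "A \<union> B" M U] measure_Un_le[of A M B] by auto
  also have "prob U \<le> (\<Sum>k\<in>{..<K} - {k0}. prob (C k))"
    unfolding U_def using meas by (intro measure_UNION_le) auto
  also have "\<dots> \<le> (\<Sum>k\<in>{..<K} - {k0}. \<rho>)"
  proof (intro sum_mono)
    fix k assume "k \<in> {..<K} - {k0}"
    then show "prob (C k) \<le> \<rho>"
      unfolding C_def \<rho>_def using sig disj c by (intro confusion_prob S N) (auto simp: c_def)
  qed
  also have "\<dots> \<le> (\<Sum>k<K. \<rho>)"
    using \<rho> by (intro sum_mono2) auto
  also have "(\<Sum>k<K. \<rho>) = K * \<rho>" by simp
  also have "prob A \<le> sqrt ((1 + \<delta>) * exp (- \<delta>)) ^ n"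
    unfolding A_def using w N \<delta> by (intro chi_square_tail) auto
  also have "prob B \<le> sqrt ((1 + - \<delta>) * exp (- (- \<delta>))) ^ n"
    unfolding B_def using c SN \<delta> by (intro chi_square_tail) auto
  finally show "prob ?bad \<le> sqrt ((1 + \<delta>) * exp (- \<delta>)) ^ n + sqrt ((1 - \<delta>) * exp \<delta>) ^ n + K * (exp \<delta> * sqrt (N / (S + N))) ^ n"
    by (simp add: \<rho>_def)
qed

end

section \<open>Random coding\<close>

lemma gaussian_array_PiM:
  assumes "finite L" "L \<noteq> {}" "n > 0"
  shows "gaussian_array (Pi\<^sub>M (L \<times> {..<n}) (\<lambda>_. density lborel std_normal_density)) L n (\<lambda>k \<omega>. \<omega> k)"
proof -
  let ?N = "density lborel std_normal_density :: real measure"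
  let ?I = "L \<times> {..<n}"
  have pN: "prob_space ?N" by (rule prob_space_normal_density) simp
  interpret prob_space "Pi\<^sub>M ?I (\<lambda>_. ?N)" by (intro prob_space_PiM pN)
  have rv: "(\<lambda>\<omega>. \<omega> k) \<in> borel_measurable (Pi\<^sub>M ?I (\<lambda>_. ?N))" if "k \<in> ?I" for k
    using measurable_component_singleton[OF that, of "\<lambda>_. ?N"]
    by (simp add: measurable_cong_sets[OF refl sets_density])
  have comp: "distr (Pi\<^sub>M ?I (\<lambda>_. ?N)) lborel (\<lambda>\<omega>. \<omega> k) = ?N" if "k \<in> ?I" for k
  proof -
    have "distr (Pi\<^sub>M ?I (\<lambda>_. ?N)) lborel (\<lambda>\<omega>. \<omega> k) = distr (Pi\<^sub>M ?I (\<lambda>_. ?N)) ?N (\<lambda>\<omega>. \<omega> k)"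
      by (intro distr_cong) auto
    also have "\<dots> = ?N" using distr_PiM_component[of ?I "\<lambda>_. ?N" k] pN that by simp
    finally show ?thesis .
  qed
  have ne: "?I \<noteq> {}" using assms by auto
  have sets: "sets (Pi\<^sub>M ?I (\<lambda>_. borel)) = sets (Pi\<^sub>M ?I (\<lambda>_. ?N))"
    by (intro sets_PiM_cong) auto
  have "distr (Pi\<^sub>M ?I (\<lambda>_. ?N)) (Pi\<^sub>M ?I (\<lambda>_. borel)) (\<lambda>x. \<lambda>i\<in>?I. x i)
      = (\<Pi>\<^sub>M i\<in>?I. distr (Pi\<^sub>M ?I (\<lambda>_. ?N)) borel (\<lambda>\<omega>. \<omega> i))"
  proof -
    have "distr (Pi\<^sub>M ?I (\<lambda>_. ?N)) (Pi\<^sub>M ?I (\<lambda>_. borel)) (\<lambda>x. \<lambda>i\<in>?I. x i) = distr (Pi\<^sub>M ?I (\<lambda>_. ?N)) (Pi\<^sub>M ?I (\<lambda>_. ?N)) (\<lambda>x. x)"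
      by (intro distr_cong sets refl) (auto simp: space_PiM)
    also have "\<dots> = Pi\<^sub>M ?I (\<lambda>_. ?N)" by (rule distr_id2) simp
    also have "\<dots> = (\<Pi>\<^sub>M i\<in>?I. distr (Pi\<^sub>M ?I (\<lambda>_. ?N)) borel (\<lambda>\<omega>. \<omega> i))"
    proof (intro PiM_cong refl)
      fix i assume "i \<in> ?I"
      have "distr (Pi\<^sub>M ?I (\<lambda>_. ?N)) borel (\<lambda>\<omega>. \<omega> i) = distr (Pi\<^sub>M ?I (\<lambda>_. ?N)) lborel (\<lambda>\<omega>. \<omega> i)"
        by (intro distr_cong) auto
      then show "?N = distr (Pi\<^sub>M ?I (\<lambda>_. ?N)) borel (\<lambda>\<omega>. \<omega> i)"
        using comp[OF \<open>i \<in> ?I\<close>] by simp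
    qed
    finally show ?thesis .
  qed
  then have ind: "indep_vars (\<lambda>_. borel) (\<lambda>k \<omega>. \<omega> k) ?I"
    using indep_vars_iff_distr_eq_PiM'[OF ne, where M' = "\<lambda>_. borel" and X = "\<lambda>k \<omega>. \<omega> k"] rv by simp
  show ?thesis
  proof
    show "finite L" by fact
    show "indep_vars (\<lambda>_. borel) (\<lambda>k \<omega>. \<omega> k) ?I" by (rule ind)
    fix k assume k: "k \<in> ?I"
    show "distributed (Pi\<^sub>M ?I (\<lambda>_. ?N)) lborel (\<lambda>\<omega>. \<omega> k) std_normal_density"
      unfolding distributed_def using comp[OF k] rv[OF k] by auto
  qed
qed

section \<open>Codes, decoders and a sufficient condition for correct decoding\<close>

text \<open>A random codeword may exceed its power, but the constraint must hold for every message;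
  violating words are sent as zero. The decoders keep using the original words, and a violation is
  counted as an error.\<close>

definition clip :: "(nat \<Rightarrow> real) \<Rightarrow> nat \<Rightarrow> (nat \<Rightarrow> nat \<Rightarrow> nat \<Rightarrow> real) \<Rightarrow> nat \<Rightarrow> nat \<Rightarrow> nat \<Rightarrow> real" where
  "clip P n x i k t = (if (\<Sum>s<n. (x i k s)\<^sup>2) \<le> n * P i then x i k t else 0)"

text \<open>Receiver 2 first decodes and subtracts the interfering codeword of user 1.\<close>

definition decoder ::
  "real \<Rightarrow> nat \<Rightarrow> (nat \<Rightarrow> nat) \<Rightarrow> real \<Rightarrow> real \<Rightarrow> real \<Rightarrow> (nat \<Rightarrow> nat \<Rightarrow> nat \<Rightarrow> real) \<Rightarrow> nat \<Rightarrow> (nat \<Rightarrow> real) \<Rightarrow> nat" where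
  "decoder a2 n M T0 T1 T2 x i y =
    (if i = 0 then LEAST k. k < M 0 \<and> near n T0 y (x 0 k)
     else if i = 1 then LEAST k. k < M 1 \<and> near n T1 y (x 1 k)
     else LEAST k. k < M 2 \<and> (\<exists>j<M 1. near n T2 y (\<lambda>t. a2 * x 1 j t) \<and> near n T0 (\<lambda>t. y t - a2 * x 1 j t) (x 2 k)))"

text \<open>Stated for the unclipped words, with each received signal grouped as wanted word plus
  effective noise, so that each clause is the complement of one link error. The last clause has no
  interference term since it describes receiver 2 after subtraction; like receiver 0 it then has
  unit noise, hence the shared radius \<open>T0\<close>.\<close>

definition decodable ::
  "real \<Rightarrow> real \<Rightarrow> (nat \<Rightarrow> real) \<Rightarrow> nat \<Rightarrow> (nat \<Rightarrow> nat) \<Rightarrow> real \<Rightarrow> real \<Rightarrow> real \<Rightarrow> (nat \<Rightarrow> nat)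
     \<Rightarrow> (nat \<Rightarrow> nat \<Rightarrow> nat \<Rightarrow> real) \<Rightarrow> (nat \<Rightarrow> nat \<Rightarrow> real) \<Rightarrow> bool" where
  "decodable a1 a2 P n M T0 T1 T2 m x z \<longleftrightarrow>
     (\<forall>i<3. (\<Sum>t<n. (x i (m i) t)\<^sup>2) \<le> n * P i) \<and>
     unique_near n T0 (M 0) (\<lambda>t. x 0 (m 0) t + z 0 t) (x 0) (m 0) \<and>
     unique_near n T1 (M 1) (\<lambda>t. x 1 (m 1) t + (a1 * x 0 (m 0) t + z 1 t)) (x 1) (m 1) \<and>
     unique_near n T2 (M 1) (\<lambda>t. a2 * x 1 (m 1) t + (x 2 (m 2) t + z 2 t)) (\<lambda>k t. a2 * x 1 k t) (m 1) \<and>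
     unique_near n T0 (M 2) (\<lambda>t. x 2 (m 2) t + z 2 t) (x 2) (m 2)"

lemma near_cong: "(\<And>t. t < n \<Longrightarrow> y t - x t = y' t - x' t) \<Longrightarrow> near n T y x = near n T y' x'"
  unfolding near_def by (intro arg_cong[where f = "\<lambda>s. s \<le> T"] sum.cong refl) simp

lemma measurable_near [measurable]:
  assumes "\<And>t. t < n \<Longrightarrow> (\<lambda>\<omega>. y \<omega> t) \<in> borel_measurable N" "\<And>t. t < n \<Longrightarrow> (\<lambda>\<omega>. x \<omega> t) \<in> borel_measurable N"
  shows "Measurable.pred N (\<lambda>\<omega>. near n T (y \<omega>) (x \<omega>))"
proof -
  have "(\<lambda>\<omega>. \<Sum>t<n. (y \<omega> t - x \<omega> t)\<^sup>2) \<in> borel_measurable N"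
    using assms by (intro borel_measurable_sum borel_measurable_power borel_measurable_diff) auto
  then show ?thesis unfolding near_def by measurable
qed

lemma measurable_decoder:
  "decoder a2 n M T0 T1 T2 x i \<in> measurable (Pi\<^sub>M {..<n} (\<lambda>_. borel)) (count_space UNIV)"
proof -
  let ?N = "Pi\<^sub>M {..<n} (\<lambda>_. borel :: real measure)"
  have [measurable]: "Measurable.pred ?N (\<lambda>y. near n T y c)" for T c
    by (intro measurable_near measurable_component_borel borel_measurable_const)
  have [measurable]: "Measurable.pred ?N (\<lambda>y. near n T (\<lambda>t. y t - b t) c)" for T b c
    by (intro measurable_near borel_measurable_diff measurable_component_borel borel_measurable_const)
  show ?thesis
    unfolding decoder_def[abs_def] by measurable
qed

text \<open>Under \<open>decodable\<close> the sent words respect the power constraints, so clipping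
  leaves them unchanged. Each \<open>LEAST\<close> then ranges over exactly one candidate.\<close>

lemma decoder_correct:
  assumes dec: "decodable a1 a2 P n M T0 T1 T2 m x z" and m: "\<And>i. i < 3 \<Longrightarrow> m i < M i" and i: "i < 3"
    and z: "\<And>i t. i < 3 \<Longrightarrow> t < n \<Longrightarrow> z i t = z' (i, t)"
  shows "decoder a2 n M T0 T1 T2 x i (chan_out a1 a2 n (clip P n x) m z' i) = m i"
proof -
  have clip: "clip P n x i (m i) t = x i (m i) t" if "i < 3" for i t
    using dec that by (auto simp: decodable_def clip_def)
  define y where "y = chan_out a1 a2 n (clip P n x) m z' i"
  have y: "y t = x i (m i) t + (if i = 1 then a1 * x 0 (m 0) t else if i = 2 then a2 * x 1 (m 1) t else 0) + z i t" if "t < n" for t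
    using that i z[OF i that] by (simp add: y_def chan_out_def clip)
  consider "i = 0" | "i = 1" | "i = 2" using i by linarith
  then have "decoder a2 n M T0 T1 T2 x i y = m i"
  proof cases
    case 1
    have eq: "near n T0 y (x 0 k) = near n T0 (\<lambda>t. x 0 (m 0) t + z 0 t) (x 0 k)" for k
      using y 1 by (intro near_cong) simp
    have "unique_near n T0 (M 0) (\<lambda>t. x 0 (m 0) t + z 0 t) (x 0) (m 0)"
      using dec by (simp add: decodable_def)
    then show ?thesis
      using m[of 0] 1 unfolding decoder_def eq unique_near_def
      by (auto intro!: Least_equality)
  next
    case 2
    have eq: "near n T1 y (x 1 k) = near n T1 (\<lambda>t. x 1 (m 1) t + (a1 * x 0 (m 0) t + z 1 t)) (x 1 k)" for k
      using y 2 by (intro near_cong) simp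
    have "unique_near n T1 (M 1) (\<lambda>t. x 1 (m 1) t + (a1 * x 0 (m 0) t + z 1 t)) (x 1) (m 1)"
      using dec by (simp add: decodable_def)
    then have "(LEAST k. k < M 1 \<and> near n T1 y (x 1 k)) = m 1"
      using m[of 1] unfolding eq unique_near_def
      by (intro Least_equality) auto
    then show ?thesis using 2 by (simp add: decoder_def)
  next
    case 3
    have eq1: "near n T2 y (\<lambda>t. a2 * x 1 j t) = near n T2 (\<lambda>t. a2 * x 1 (m 1) t + (x 2 (m 2) t + z 2 t)) (\<lambda>t. a2 * x 1 j t)" for j
      using y 3 by (intro near_cong) simp
    have eq2: "near n T0 (\<lambda>t. y t - a2 * x 1 (m 1) t) (x 2 k) = near n T0 (\<lambda>t. x 2 (m 2) t + z 2 t) (x 2 k)" for k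
      using y 3 by (intro near_cong) simp
    have u: "unique_near n T2 (M 1) (\<lambda>t. a2 * x 1 (m 1) t + (x 2 (m 2) t + z 2 t)) (\<lambda>k t. a2 * x 1 k t) (m 1)"
      and v: "unique_near n T0 (M 2) (\<lambda>t. x 2 (m 2) t + z 2 t) (x 2) (m 2)"
      using dec by (simp_all add: decodable_def)
    have m1: "m 1 < M 1" using m[of 1] by simp
    \<comment> \<open>Uniqueness in the first stage of receiver 2 reduces the existential over
      \<open>j\<close> to the true interfering word, so the second stage subtracts the right
      one.\<close>
    have j: "near n T2 y (\<lambda>t. a2 * x 1 j t) \<longleftrightarrow> j = m 1" if "j < M 1" for j
      using u that unfolding eq1 unique_near_def by blast
    have "(\<exists>j<M 1. near n T2 y (\<lambda>t. a2 * x 1 j t) \<and> near n T0 (\<lambda>t. y t - a2 * x 1 j t) (x 2 k))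
       \<longleftrightarrow> near n T0 (\<lambda>t. x 2 (m 2) t + z 2 t) (x 2 k)" for k
      unfolding eq2[symmetric] using j m1 by blast
    then have "(LEAST k. k < M 2 \<and> (\<exists>j<M 1. near n T2 y (\<lambda>t. a2 * x 1 j t) \<and> near n T0 (\<lambda>t. y t - a2 * x 1 j t) (x 2 k))) = m 2"
      using m[of 2] v unfolding unique_near_def
      by (intro Least_equality) auto
    then show ?thesis using 3 by (simp add: decoder_def)
  qed
  then show ?thesis by (simp add: y_def)
qed

lemma is_code_clip:
  assumes "\<And>i. i < 3 \<Longrightarrow> M i \<ge> 1" "\<And>i. i < 3 \<Longrightarrow> P i > 0"
  shows "is_code P n M (clip P n x) (decoder a2 n M T0 T1 T2 x)"
proof -
  have "(\<Sum>t<n. (clip P n x i k t)\<^sup>2) \<le> real n * P i" if "i < 3" for i k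
    using assms(2)[OF that] by (cases "(\<Sum>s<n. (x i k s)\<^sup>2) \<le> n * P i") (simp_all add: clip_def)
  then show ?thesis using assms by (simp add: is_code_def measurable_decoder)
qed

lemma unique_near_cong:
  assumes "k0 < K" "\<And>t. t < n \<Longrightarrow> y t = y' t" "\<And>k t. k < K \<Longrightarrow> t < n \<Longrightarrow> x k t = x' k t"
  shows "unique_near n T K y x k0 = unique_near n T K y' x' k0"
proof -
  have "near n T y (x k) = near n T y' (x' k)" if "k < K" for k
    using assms that by (intro near_cong) simp
  then show ?thesis using assms(1) by (auto simp: unique_near_def)
qed

definition unit_at :: "'l \<Rightarrow> real \<Rightarrow> 'l \<Rightarrow> real" where
  "unit_at p r l = (if l = p then r else 0)"

lemma sum_unit_at_sq: "finite L \<Longrightarrow> p \<in> L \<Longrightarrow> (\<Sum>l\<in>L. (unit_at p r l)\<^sup>2) = r\<^sup>2"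
proof -
  assume "finite L" "p \<in> L"
  moreover have "(\<Sum>l\<in>L. (unit_at p r l)\<^sup>2) = (\<Sum>l\<in>L. if l = p then r\<^sup>2 else 0)"
    by (intro sum.cong) (auto simp: unit_at_def)
  ultimately show ?thesis by simp
qed

lemma sum_two_unit_at_sq:
  assumes "finite L" "p \<in> L" "q \<in> L" "p \<noteq> q"
  shows "(\<Sum>l\<in>L. (unit_at p r l + unit_at q s l)\<^sup>2) = r\<^sup>2 + s\<^sup>2"
proof -
  have "(\<Sum>l\<in>L. (unit_at p r l + unit_at q s l)\<^sup>2) = (\<Sum>l\<in>L. (unit_at p r l)\<^sup>2 + (unit_at q s l)\<^sup>2)"
    using assms by (intro sum.cong) (auto simp: unit_at_def)
  then show ?thesis using assms by (simp add: sum.distrib sum_unit_at_sq)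
qed

lemma (in gaussian_array) lin_unit_at:
  "p \<in> L \<Longrightarrow> lin (unit_at p r) t \<omega> = r * G (p, t) \<omega>"
proof -
  assume p: "p \<in> L"
  have "lin (unit_at p r) t \<omega> = (\<Sum>l\<in>L. if l = p then r * G (l, t) \<omega> else 0)"
    unfolding lin_def by (intro sum.cong) (auto simp: unit_at_def)
  then show ?thesis using p finite_labels by simp
qed

text \<open>In the common array, label \<open>(i, Suc k)\<close> carries word \<open>k\<close> of
  user \<open>i\<close>, scaled to power \<open>Q i\<close>, while label \<open>(i, 0)\<close> is
  reserved for the noise of receiver \<open>i\<close>.\<close>

definition codeword :: "(nat \<Rightarrow> real) \<Rightarrow> ((nat \<times> nat) \<times> nat \<Rightarrow> real) \<Rightarrow> nat \<Rightarrow> nat \<Rightarrow> nat \<Rightarrow> real" where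
  "codeword Q \<omega> i k t = sqrt (Q i) * \<omega> ((i, Suc k), t)"

definition array_noise :: "((nat \<times> nat) \<times> nat \<Rightarrow> real) \<Rightarrow> nat \<Rightarrow> nat \<Rightarrow> real" where
  "array_noise \<omega> i t = \<omega> ((i, 0), t)"

text \<open>The union bound over all error events: 7 upper tails are the three power violations and
  the noise events of four decoding stages, 4 lower tails are their energy events, and the other
  four summands are confusions. The message of user 1 occurs twice, once at receiver 1 and once at
  receiver 2.\<close>

definition code_bound :: "real \<Rightarrow> real \<Rightarrow> (nat \<Rightarrow> real) \<Rightarrow> real \<Rightarrow> (nat \<Rightarrow> nat) \<Rightarrow> nat \<Rightarrow> real" where
  "code_bound a1 a2 Q \<delta> M n = 7 * sqrt ((1 + \<delta>) * exp (- \<delta>)) ^ n + 4 * sqrt ((1 - \<delta>) * exp \<delta>) ^ n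
     + M 0 * (exp \<delta> * sqrt (1 / (Q 0 + 1))) ^ n
     + M 1 * (exp \<delta> * sqrt ((1 + a1\<^sup>2 * Q 0) / (Q 1 + (1 + a1\<^sup>2 * Q 0)))) ^ n
     + M 1 * (exp \<delta> * sqrt ((1 + Q 2) / (a2\<^sup>2 * Q 1 + (1 + Q 2)))) ^ n
     + M 2 * (exp \<delta> * sqrt (1 / (Q 2 + 1))) ^ n"

section \<open>Error probability of the random code\<close>

text \<open>For fixed messages, codebook and noise are random together. Each clause of
  \<open>decodable\<close> fails with the probability of a tail or a link error for suitable
  coefficient vectors; a union bound finishes.\<close>

lemma undecodable_prob:
  fixes a1 a2 :: real and M :: "nat \<Rightarrow> nat" and P :: "nat \<Rightarrow> real"
  assumes n: "n > 0" and P: "\<And>i. i < 3 \<Longrightarrow> P i > 0" and a2: "a2 > 0" and \<delta>: "0 < \<delta>" "\<delta> < 1"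
    and m: "\<And>i. i < 3 \<Longrightarrow> m i < M i" and S: "\<And>i. i < 3 \<Longrightarrow> M i < S"
  defines "Q \<equiv> \<lambda>i. P i / (1 + \<delta>)"
  defines "\<Omega> \<equiv> Pi\<^sub>M (({..<3} \<times> {..<S}) \<times> {..<n}) (\<lambda>_. density lborel std_normal_density)"
  defines "bad \<equiv> {\<omega> \<in> space \<Omega>. \<not> decodable a1 a2 P n M (real n * 1 * (1 + \<delta>)) (real n * (1 + a1\<^sup>2 * Q 0) * (1 + \<delta>)) (real n * (1 + Q 2) * (1 + \<delta>)) m
      (codeword Q \<omega>) (array_noise \<omega>)}"
  shows "bad \<in> sets \<Omega>" and "measure \<Omega> bad \<le> code_bound a1 a2 Q \<delta> M n"
proof -
  define L :: "(nat \<times> nat) set" where "L = {..<3} \<times> {..<S}"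
  have S0: "0 < S" using S[of 0] by simp
  have fin: "finite L" by (simp add: L_def)
  have inL0: "(i, 0) \<in> L" if "i < 3" for i using S0 that by (simp add: L_def)
  have "gaussian_array (Pi\<^sub>M (L \<times> {..<n}) (\<lambda>_. density lborel std_normal_density)) L n (\<lambda>k \<omega>. \<omega> k)"
    using inL0[of 0] n by (intro gaussian_array_PiM fin) auto
  then interpret G: gaussian_array \<Omega> L n "\<lambda>k \<omega>. \<omega> k" by (simp add: L_def \<Omega>_def)
  have Q: "Q i > 0" if "i < 3" for i using P[OF that] \<delta> by (simp add: Q_def)
  have inL: "(i, Suc k) \<in> L" if "i < 3" "k < M i" for i k
    using S[OF that(1)] that by (simp add: L_def)
  note [simp] = inL inL0 m fin
  define u where "u = sqrt ((1 + \<delta>) * exp (- \<delta>)) ^ n"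
  define v where "v = sqrt ((1 - \<delta>) * exp \<delta>) ^ n"
  define X :: "nat \<Rightarrow> nat \<Rightarrow> nat \<times> nat \<Rightarrow> real" where "X i k = unit_at (i, Suc k) (sqrt (Q i))" for i k :: nat
  have linX: "G.lin (X i k) t \<omega> = codeword Q \<omega> i k t" if "i < 3" "k < M i" for i k t \<omega>
    using that by (simp add: X_def G.lin_unit_at codeword_def)
  have linZ: "G.lin (unit_at (i, 0) 1) t \<omega> = array_noise \<omega> i t" if "i < 3" for i t \<omega>
    using that by (simp add: G.lin_unit_at array_noise_def)
  \<comment> \<open>Since \<open>Q i * (1 + \<delta>) = P i\<close>, exceeding the power constraint
    is an upper tail event with the same deviation \<open>\<delta>\<close> as the noise
    events.\<close>
  define pw where "pw i = {\<omega> \<in> space \<Omega>. 0 \<le> \<delta> * ((\<Sum>t<n. (G.lin (X i (m i)) t \<omega>)\<^sup>2) - n * (sqrt (Q i))\<^sup>2 * (1 + \<delta>))}" for i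
  have pw_prob: "G.prob (pw i) \<le> u" if "i < 3" for i
    unfolding pw_def u_def using that Q[OF that] \<delta>
    by (intro G.chi_square_tail) (auto simp: X_def sum_unit_at_sq)
  have pw_sets: "pw i \<in> G.events" for i
  proof -
    have [measurable]: "(\<lambda>\<omega>. \<Sum>t<n. (G.lin (X i (m i)) t \<omega>)\<^sup>2) \<in> borel_measurable \<Omega>"
      by (intro borel_measurable_sum borel_measurable_power G.measurable_lin) auto
    show ?thesis unfolding pw_def by measurable
  qed
  have pw_iff: "(\<Sum>t<n. (codeword Q \<omega> i (m i) t)\<^sup>2) \<le> n * P i" if "i < 3" "\<omega> \<in> space \<Omega>" "\<omega> \<notin> pw i" for i \<omega>
  proof -
    have e: "n * (sqrt (Q i))\<^sup>2 * (1 + \<delta>) = n * P i" using Q[OF that(1)] \<delta> by (simp add: Q_def)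
    show ?thesis using that \<delta> unfolding pw_def e by (auto simp: linX not_le mult_less_0_iff)
  qed
  define B0 where "B0 = {\<omega> \<in> space \<Omega>. \<not> unique_near n (real n * 1 * (1 + \<delta>)) (M 0) (\<lambda>t. G.lin (X 0 (m 0)) t \<omega> + G.lin (unit_at (0, 0) 1) t \<omega>) (\<lambda>k t. G.lin (X 0 k) t \<omega>) (m 0)}"
  have B0: "B0 \<in> G.events" "G.prob B0 \<le> u + v + M 0 * (exp \<delta> * sqrt (1 / (Q 0 + 1))) ^ n"
  proof -
    have h: "(\<Sum>l\<in>L. (X 0 k l)\<^sup>2) = Q 0" if "k < M 0" for k
      using that Q[of 0] by (simp add: X_def sum_unit_at_sq)
    have w: "(\<Sum>l\<in>L. (unit_at (0, 0) 1 l)\<^sup>2) = 1" by (simp add: sum_unit_at_sq)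
    have mi: "m 0 < M 0" by simp
    have orth: "X 0 (m 0) l = 0 \<or> unit_at (0, 0) 1 l = 0" for l
      by (auto simp: X_def unit_at_def)
    have d: "X 0 (m 0) l + unit_at (0, 0) 1 l = 0 \<or> X 0 k l = 0" if "k \<noteq> m 0" for k l
      using that by (auto simp: X_def unit_at_def)
    have Qi: "Q 0 > 0" using Q[of 0] by simp
    note link = G.link_error_prob[where sig = "X 0" and w = "unit_at (0, 0) 1" and K = "M 0" and ?k0.0 = "m 0", OF Qi zero_less_one \<delta> w h mi orth d]
    show "B0 \<in> G.events" unfolding B0_def by (rule link(1))
    show "G.prob B0 \<le> u + v + M 0 * (exp \<delta> * sqrt (1 / (Q 0 + 1))) ^ n"
      unfolding B0_def u_def v_def by (rule link(2))
  qed
  \<comment> \<open>At receiver 1 the codeword of user 0 counts as Gaussian noise of power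
    \<open>a1\<^sup>2 * Q 0\<close>; it is independent of the codebook of user 1 because its label
    belongs to user 0.\<close>
  define w1 :: "nat \<times> nat \<Rightarrow> real" where "w1 = (\<lambda>l. unit_at (0, Suc (m 0)) (a1 * sqrt (Q 0)) l + unit_at (1, 0) 1 l)"
  define B1 where "B1 = {\<omega> \<in> space \<Omega>. \<not> unique_near n (real n * (1 + a1\<^sup>2 * Q 0) * (1 + \<delta>)) (M 1) (\<lambda>t. G.lin (X 1 (m 1)) t \<omega> + G.lin w1 t \<omega>) (\<lambda>k t. G.lin (X 1 k) t \<omega>) (m 1)}"
  have w1: "(\<Sum>l\<in>L. (w1 l)\<^sup>2) = 1 + a1\<^sup>2 * Q 0"
    unfolding w1_def using Q[of 0] inL[of 0 "m 0"] inL0[of 1] by (subst sum_two_unit_at_sq) (auto simp: power_mult_distrib)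
  have N1: "1 + a1\<^sup>2 * Q 0 > 0" using Q[of 0] by (intro add_pos_nonneg) auto
  have B1: "B1 \<in> G.events" "G.prob B1 \<le> u + v + M 1 * (exp \<delta> * sqrt ((1 + a1\<^sup>2 * Q 0) / (Q 1 + (1 + a1\<^sup>2 * Q 0)))) ^ n"
  proof -
    have h: "(\<Sum>l\<in>L. (X 1 k l)\<^sup>2) = Q 1" if "k < M 1" for k
      using that Q[of 1] inL[of 1 k] by (simp add: X_def sum_unit_at_sq)
    have m1: "m 1 < M 1" using m[of 1] by simp
    have orth: "X 1 (m 1) l = 0 \<or> w1 l = 0" for l
      by (auto simp: X_def w1_def unit_at_def)
    have d: "X 1 (m 1) l + w1 l = 0 \<or> X 1 k l = 0" if "k \<noteq> m 1" for k l
      using that by (auto simp: X_def w1_def unit_at_def)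
    have Q1: "Q 1 > 0" using Q[of 1] by simp
    note link = G.link_error_prob[where sig = "X 1" and w = w1 and K = "M 1" and ?k0.0 = "m 1", OF Q1 N1 \<delta> w1 h m1 orth d]
    show "B1 \<in> G.events" unfolding B1_def by (rule link(1))
    show "G.prob B1 \<le> u + v + M 1 * (exp \<delta> * sqrt ((1 + a1\<^sup>2 * Q 0) / (Q 1 + (1 + a1\<^sup>2 * Q 0)))) ^ n"
      unfolding B1_def u_def v_def by (rule link(2))
  qed
  \<comment> \<open>In the first stage of receiver 2 the roles are exchanged: the word of user 1 is
    the signal, the receiver's own word is part of the noise.\<close>
  define w2 :: "nat \<times> nat \<Rightarrow> real" where "w2 = (\<lambda>l. unit_at (2, Suc (m 2)) (sqrt (Q 2)) l + unit_at (2, 0) 1 l)"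
  define X2 :: "nat \<Rightarrow> nat \<times> nat \<Rightarrow> real" where "X2 k = unit_at (1, Suc k) (a2 * sqrt (Q 1))" for k :: nat
  define B2 where "B2 = {\<omega> \<in> space \<Omega>. \<not> unique_near n (real n * (1 + Q 2) * (1 + \<delta>)) (M 1) (\<lambda>t. G.lin (X2 (m 1)) t \<omega> + G.lin w2 t \<omega>) (\<lambda>k t. G.lin (X2 k) t \<omega>) (m 1)}"
  have w2: "(\<Sum>l\<in>L. (w2 l)\<^sup>2) = 1 + Q 2"
    unfolding w2_def using Q[of 2] by (subst sum_two_unit_at_sq) auto
  have X2sq: "(\<Sum>l\<in>L. (X2 k l)\<^sup>2) = a2\<^sup>2 * Q 1" if "k < M 1" for k
    unfolding X2_def using Q[of 1] inL[of 1 k] that by (subst sum_unit_at_sq) (auto simp: power_mult_distrib)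
  have B2: "B2 \<in> G.events" "G.prob B2 \<le> u + v + M 1 * (exp \<delta> * sqrt ((1 + Q 2) / (a2\<^sup>2 * Q 1 + (1 + Q 2)))) ^ n"
  proof -
    have m1: "m 1 < M 1" using m[of 1] by simp
    have orth: "X2 (m 1) l = 0 \<or> w2 l = 0" for l
      by (auto simp: X2_def w2_def unit_at_def)
    have d: "X2 (m 1) l + w2 l = 0 \<or> X2 k l = 0" if "k \<noteq> m 1" for k l
      using that by (auto simp: X2_def w2_def unit_at_def)
    have Q1: "a2\<^sup>2 * Q 1 > 0" using Q[of 1] a2 by simp
    have Q2: "1 + Q 2 > 0" using Q[of 2] by simp
    note link = G.link_error_prob[where sig = X2 and w = w2 and K = "M 1" and ?k0.0 = "m 1", OF Q1 Q2 \<delta> w2 X2sq m1 orth d]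
    show "B2 \<in> G.events" unfolding B2_def by (rule link(1))
    show "G.prob B2 \<le> u + v + M 1 * (exp \<delta> * sqrt ((1 + Q 2) / (a2\<^sup>2 * Q 1 + (1 + Q 2)))) ^ n"
      unfolding B2_def u_def v_def by (rule link(2))
  qed
  define B3 where "B3 = {\<omega> \<in> space \<Omega>. \<not> unique_near n (real n * 1 * (1 + \<delta>)) (M 2) (\<lambda>t. G.lin (X 2 (m 2)) t \<omega> + G.lin (unit_at (2, 0) 1) t \<omega>) (\<lambda>k t. G.lin (X 2 k) t \<omega>) (m 2)}"
  have B3: "B3 \<in> G.events" "G.prob B3 \<le> u + v + M 2 * (exp \<delta> * sqrt (1 / (Q 2 + 1))) ^ n"
  proof -
    have h: "(\<Sum>l\<in>L. (X 2 k l)\<^sup>2) = Q 2" if "k < M 2" for k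
      using that Q[of 2] by (simp add: X_def sum_unit_at_sq)
    have w: "(\<Sum>l\<in>L. (unit_at (2, 0) 1 l)\<^sup>2) = 1" by (simp add: sum_unit_at_sq)
    have mi: "m 2 < M 2" by simp
    have orth: "X 2 (m 2) l = 0 \<or> unit_at (2, 0) 1 l = 0" for l
      by (auto simp: X_def unit_at_def)
    have d: "X 2 (m 2) l + unit_at (2, 0) 1 l = 0 \<or> X 2 k l = 0" if "k \<noteq> m 2" for k l
      using that by (auto simp: X_def unit_at_def)
    have Qi: "Q 2 > 0" using Q[of 2] by simp
    note link = G.link_error_prob[where sig = "X 2" and w = "unit_at (2, 0) 1" and K = "M 2" and ?k0.0 = "m 2", OF Qi zero_less_one \<delta> w h mi orth d]
    show "B3 \<in> G.events" unfolding B3_def by (rule link(1))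
    show "G.prob B3 \<le> u + v + M 2 * (exp \<delta> * sqrt (1 / (Q 2 + 1))) ^ n"
      unfolding B3_def u_def v_def by (rule link(2))
  qed
  have linw1: "G.lin w1 t \<omega> = a1 * codeword Q \<omega> 0 (m 0) t + array_noise \<omega> 1 t" for t \<omega>
    unfolding w1_def G.lin_add using inL[of 0 "m 0"] inL0[of 1] by (simp add: G.lin_unit_at codeword_def array_noise_def)
  have linw2: "G.lin w2 t \<omega> = codeword Q \<omega> 2 (m 2) t + array_noise \<omega> 2 t" for t \<omega>
    unfolding w2_def G.lin_add by (simp add: G.lin_unit_at codeword_def array_noise_def)
  have linX2: "G.lin (X2 k) t \<omega> = a2 * codeword Q \<omega> 1 k t" if "k < M 1" for k t \<omega>
    unfolding X2_def using that inL[of 1 k] by (simp add: G.lin_unit_at codeword_def)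
  define W where "W = (\<Union>i<3. pw i) \<union> (B0 \<union> B1 \<union> (B2 \<union> B3))"
  have eq0: "unique_near n T (M 0) (\<lambda>t. G.lin (X 0 (m 0)) t \<omega> + G.lin (unit_at (0, 0) 1) t \<omega>) (\<lambda>k t. G.lin (X 0 k) t \<omega>) (m 0)
      = unique_near n T (M 0) (\<lambda>t. codeword Q \<omega> 0 (m 0) t + array_noise \<omega> 0 t) (codeword Q \<omega> 0) (m 0)" for T \<omega>
    by (intro unique_near_cong) (auto simp: linX linZ)
  have eq1: "unique_near n T (M 1) (\<lambda>t. G.lin (X 1 (m 1)) t \<omega> + G.lin w1 t \<omega>) (\<lambda>k t. G.lin (X 1 k) t \<omega>) (m 1)
      = unique_near n T (M 1) (\<lambda>t. codeword Q \<omega> 1 (m 1) t + (a1 * codeword Q \<omega> 0 (m 0) t + array_noise \<omega> 1 t)) (codeword Q \<omega> 1) (m 1)" for T \<omega>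
    using m[of 1] linX[of 1] by (intro unique_near_cong) (auto simp: linw1)
  have eq2: "unique_near n T (M 1) (\<lambda>t. G.lin (X2 (m 1)) t \<omega> + G.lin w2 t \<omega>) (\<lambda>k t. G.lin (X2 k) t \<omega>) (m 1)
      = unique_near n T (M 1) (\<lambda>t. a2 * codeword Q \<omega> 1 (m 1) t + (codeword Q \<omega> 2 (m 2) t + array_noise \<omega> 2 t)) (\<lambda>k t. a2 * codeword Q \<omega> 1 k t) (m 1)" for T \<omega>
    using m[of 1] linX2 by (intro unique_near_cong) (auto simp: linw2)
  have eq3: "unique_near n T (M 2) (\<lambda>t. G.lin (X 2 (m 2)) t \<omega> + G.lin (unit_at (2, 0) 1) t \<omega>) (\<lambda>k t. G.lin (X 2 k) t \<omega>) (m 2)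
      = unique_near n T (M 2) (\<lambda>t. codeword Q \<omega> 2 (m 2) t + array_noise \<omega> 2 t) (codeword Q \<omega> 2) (m 2)" for T \<omega>
    by (intro unique_near_cong) (auto simp: linX linZ)
  have badW: "bad \<subseteq> W"
    unfolding bad_def W_def B0_def B1_def B2_def B3_def decodable_def eq0 eq1 eq2 eq3 using pw_iff by blast
  have energy: "Measurable.pred \<Omega> (\<lambda>\<omega>. (\<Sum>t<n. (codeword Q \<omega> i (m i) t)\<^sup>2) \<le> n * P i)" if "i < 3" for i
  proof -
    have [measurable]: "(\<lambda>\<omega>. \<Sum>t<n. (G.lin (X i (m i)) t \<omega>)\<^sup>2) \<in> borel_measurable \<Omega>"
      by (intro borel_measurable_sum borel_measurable_power G.measurable_lin) auto
    have "Measurable.pred \<Omega> (\<lambda>\<omega>. (\<Sum>t<n. (G.lin (X i (m i)) t \<omega>)\<^sup>2) \<le> n * P i)" by measurable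
    then show ?thesis using that by (simp add: linX)
  qed
  show bad: "bad \<in> sets \<Omega>"
  proof -
    have "bad = (\<Union>i<3. {\<omega> \<in> space \<Omega>. \<not> (\<Sum>t<n. (codeword Q \<omega> i (m i) t)\<^sup>2) \<le> n * P i}) \<union> (B0 \<union> B1 \<union> (B2 \<union> B3))"
      unfolding bad_def B0_def B1_def B2_def B3_def decodable_def eq0 eq1 eq2 eq3 by blast
    also have "\<dots> \<in> sets \<Omega>"
      using B0 B1 B2 B3 energy by (intro sets.Un sets.finite_UN) (auto intro!: measurable_sets_Collect pred_intros_logic)
    finally show ?thesis .
  qed
  have UNm: "(\<Union>i<3. pw i) \<in> G.events" using pw_sets by (intro sets.finite_UN) auto
  have "G.prob bad \<le> G.prob W"
    using badW UNm B0 B1 B2 B3 by (intro G.finite_measure_mono) (auto simp: W_def)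
  also have "\<dots> \<le> G.prob (\<Union>i<3. pw i) + ((G.prob B0 + G.prob B1) + (G.prob B2 + G.prob B3))"
    unfolding W_def using UNm B0(1) B1(1) B2(1) B3(1)
    by (intro order.trans[OF measure_Un_le] add_left_mono add_mono measure_Un_le) auto
  also have "G.prob (\<Union>i<3. pw i) \<le> (\<Sum>i<3. G.prob (pw i))"
    using pw_sets by (intro measure_UNION_le) auto
  also have "\<dots> \<le> (\<Sum>i<3::nat. u)" by (intro sum_mono pw_prob) auto
  finally have "G.prob bad \<le> 3 * u + ((G.prob B0 + G.prob B1) + (G.prob B2 + G.prob B3))" by simp
  then show "G.prob bad \<le> code_bound a1 a2 Q \<delta> M n"
    using B0(2) B1(2) B2(2) B3(2) unfolding code_bound_def u_def[symmetric] v_def[symmetric] by linarith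
qed

text \<open>Strict positivity turns "at least twice the mean everywhere" into a contradiction when a
  good codebook is selected.\<close>

lemma code_bound_pos:
  assumes "0 < \<delta>" "\<delta> < 1" "\<And>i. i < 3 \<Longrightarrow> Q i > 0"
  shows "code_bound a1 a2 Q \<delta> M n > 0"
proof -
  have "Q 0 > 0" "Q 1 > 0" "Q 2 > 0" using assms(3) by auto
  then show ?thesis
    unfolding code_bound_def using assms(1,2)
    by (intro add_pos_nonneg mult_pos_pos mult_nonneg_nonneg zero_less_power zero_le_power) auto
qed

text \<open>The error probability summed over all message triples is averaged over the codebook by
  Fubini; some codebook does at most twice as badly as the average.\<close>

lemma random_code_exists:
  fixes a1 a2 :: real and M :: "nat \<Rightarrow> nat" and P :: "nat \<Rightarrow> real"
  assumes n: "n > 0" and P: "\<And>i. i < 3 \<Longrightarrow> P i > 0" and a2: "a2 > 0" and \<delta>: "0 < \<delta>" "\<delta> < 1"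
    and M: "\<And>i. i < 3 \<Longrightarrow> M i \<ge> 1"
  defines "Q \<equiv> \<lambda>i. P i / (1 + \<delta>)"
  shows "\<exists>enc dec. is_code P n M enc dec \<and> error_prob a1 a2 n M enc dec \<le> 2 * code_bound a1 a2 Q \<delta> M n"
proof -
  define S where "S = Suc (M 0 + M 1 + M 2)"
  have S: "M i < S" if "i < 3" for i
  proof -
    have "i = 0 \<or> i = 1 \<or> i = 2" using that by linarith
    then show ?thesis by (auto simp: S_def)
  qed
  define N :: "real measure" where "N = density lborel std_normal_density"
  have pN: "prob_space N" unfolding N_def by (rule prob_space_normal_density) simp
  interpret NP: product_prob_space "\<lambda>_::(nat \<times> nat) \<times> nat. N" by (intro product_prob_spaceI pN)
  \<comment> \<open>\<open>I\<close> indexes the codewords and \<open>J\<close> the noises; the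
    array splits into a codebook \<open>c\<close> and a noise realisation \<open>z\<close>, rejoined
    by \<open>merge\<close>.\<close>
  define I :: "((nat \<times> nat) \<times> nat) set" where "I = ({..<3} \<times> {1..<S}) \<times> {..<n}"
  define J :: "((nat \<times> nat) \<times> nat) set" where "J = ({..<3} \<times> {0}) \<times> {..<n}"
  have IJ: "I \<inter> J = {}" "finite I" "finite J" by (auto simp: I_def J_def)
  have un: "I \<union> J = ({..<3} \<times> {..<S}) \<times> {..<n}" by (auto simp: I_def J_def S_def)
  define \<Omega> where "\<Omega> = Pi\<^sub>M (I \<union> J) (\<lambda>_. N)"
  define \<beta> where "\<beta> = code_bound a1 a2 Q \<delta> M n"
  have \<beta>: "\<beta> > 0" unfolding \<beta>_def using \<delta> P by (intro code_bound_pos) (auto simp: Q_def)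
  define T0 T1 T2 where "T0 = real n * 1 * (1 + \<delta>)" and "T1 = real n * (1 + a1\<^sup>2 * Q 0) * (1 + \<delta>)"
    and "T2 = real n * (1 + Q 2) * (1 + \<delta>)"
  define bad where "bad m = {\<omega> \<in> space \<Omega>. \<not> decodable a1 a2 P n M T0 T1 T2 m (codeword Q \<omega>) (array_noise \<omega>)}" for m
  have mM: "m i < M i" if "m \<in> messages M" "i < 3" for m i
    using that by (auto simp: messages_def PiE_iff)
  have bad_sets: "bad m \<in> sets \<Omega>" and bad_prob: "measure \<Omega> (bad m) \<le> \<beta>" if "m \<in> messages M" for m
    unfolding bad_def \<Omega>_def un N_def T0_def T1_def T2_def \<beta>_def Q_def
    by (intro undecodable_prob n P a2 \<delta> mM[OF that] S; assumption)+
  interpret O: prob_space \<Omega> unfolding \<Omega>_def by (intro prob_space_PiM pN)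
  interpret PI: prob_space "Pi\<^sub>M I (\<lambda>_. N)" by (intro prob_space_PiM pN)
  interpret PJ: prob_space "Pi\<^sub>M J (\<lambda>_. N)" by (intro prob_space_PiM pN)
  define K where "K = real (card (messages M))"
  have K: "K > 0" using M[of 0] M[of 1] M[of 2] by (simp add: K_def card_messages)
  define f where "f \<omega> = (\<Sum>m\<in>messages M. indicator (bad m) \<omega> :: ennreal)" for \<omega>
  have f_meas: "f \<in> borel_measurable \<Omega>"
    unfolding f_def using bad_sets by (intro borel_measurable_sum borel_measurable_indicator) auto
  have "(\<integral>\<^sup>+c. \<integral>\<^sup>+z. f (merge I J (c, z)) \<partial>Pi\<^sub>M J (\<lambda>_. N) \<partial>Pi\<^sub>M I (\<lambda>_. N)) = (\<integral>\<^sup>+\<omega>. f \<omega> \<partial>\<Omega>)"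
    unfolding \<Omega>_def using f_meas by (intro NP.product_nn_integral_fold[symmetric] IJ) (simp add: \<Omega>_def)
  also have "\<dots> = (\<Sum>m\<in>messages M. emeasure \<Omega> (bad m))"
    unfolding f_def using bad_sets by (subst nn_integral_sum) auto
  also have "\<dots> \<le> (\<Sum>m\<in>messages M. ennreal \<beta>)"
    using bad_prob by (intro sum_mono) (simp add: O.emeasure_eq_measure ennreal_leI)
  also have "\<dots> = ennreal (K * \<beta>)"
    using \<beta> by (simp add: K_def ennreal_of_nat_eq_real_of_nat ennreal_mult)
  finally have avg: "(\<integral>\<^sup>+c. \<integral>\<^sup>+z. f (merge I J (c, z)) \<partial>Pi\<^sub>M J (\<lambda>_. N) \<partial>Pi\<^sub>M I (\<lambda>_. N)) \<le> ennreal (K * \<beta>)" .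
  have "\<exists>c\<in>space (Pi\<^sub>M I (\<lambda>_. N)). (\<integral>\<^sup>+z. f (merge I J (c, z)) \<partial>Pi\<^sub>M J (\<lambda>_. N)) \<le> ennreal (2 * (K * \<beta>))"
  proof (rule ccontr)
    assume "\<not> ?thesis"
    then have "ennreal (2 * (K * \<beta>)) \<le> (\<integral>\<^sup>+z. f (merge I J (c, z)) \<partial>Pi\<^sub>M J (\<lambda>_. N))" if "c \<in> space (Pi\<^sub>M I (\<lambda>_. N))" for c
      using that by (auto simp: not_le less_imp_le)
    then have "(\<integral>\<^sup>+c. ennreal (2 * (K * \<beta>)) \<partial>Pi\<^sub>M I (\<lambda>_. N))
        \<le> (\<integral>\<^sup>+c. \<integral>\<^sup>+z. f (merge I J (c, z)) \<partial>Pi\<^sub>M J (\<lambda>_. N) \<partial>Pi\<^sub>M I (\<lambda>_. N))"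
      by (intro nn_integral_mono)
    also note avg
    finally have "ennreal (2 * (K * \<beta>)) \<le> ennreal (K * \<beta>)" by (simp add: PI.emeasure_space_1)
    then have "2 * (K * \<beta>) \<le> K * \<beta>" using K \<beta> by (subst (asm) ennreal_le_iff) auto
    then show False using K \<beta> by simp
  qed
  then obtain c where c: "c \<in> space (Pi\<^sub>M I (\<lambda>_. N))"
    and fc: "(\<integral>\<^sup>+z. f (merge I J (c, z)) \<partial>Pi\<^sub>M J (\<lambda>_. N)) \<le> ennreal (2 * (K * \<beta>))" by blast
  have merge_meas: "(\<lambda>z. merge I J (c, z)) \<in> measurable (Pi\<^sub>M J (\<lambda>_. N)) \<Omega>"
    unfolding \<Omega>_def using c by (intro measurable_compose[OF _ measurable_merge]) simp
  define D where "D m = {z \<in> space (Pi\<^sub>M J (\<lambda>_. N)). merge I J (c, z) \<in> bad m}" for m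
  have D_sets: "D m \<in> sets (Pi\<^sub>M J (\<lambda>_. N))" if "m \<in> messages M" for m
    using measurable_sets[OF merge_meas bad_sets[OF that]] by (simp add: D_def vimage_def Int_def conj_commute)
  have sumD: "(\<Sum>m\<in>messages M. PJ.prob (D m)) \<le> 2 * (K * \<beta>)"
  proof -
    have "(\<integral>\<^sup>+z. f (merge I J (c, z)) \<partial>Pi\<^sub>M J (\<lambda>_. N)) = (\<integral>\<^sup>+z. (\<Sum>m\<in>messages M. indicator (D m) z) \<partial>Pi\<^sub>M J (\<lambda>_. N))"
      by (intro nn_integral_cong) (auto simp: f_def D_def indicator_def intro!: sum.cong)
    also have "\<dots> = (\<Sum>m\<in>messages M. emeasure (Pi\<^sub>M J (\<lambda>_. N)) (D m))"
      using D_sets by (subst nn_integral_sum) auto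
    also have "\<dots> = ennreal (\<Sum>m\<in>messages M. PJ.prob (D m))"
      by (simp add: PJ.emeasure_eq_measure)
    finally show ?thesis using fc K \<beta> by (simp add: ennreal_le_iff)
  qed
  \<comment> \<open>Identifies the channel noise, indexed by receiver and time, with the noise
    labels of the array; the law is preserved because the index map is injective.\<close>
  define \<phi> where "\<phi> z = (\<lambda>p\<in>J. z (fst (fst p), snd p))" for z :: "nat \<times> nat \<Rightarrow> real"
  have \<phi>_meas: "\<phi> \<in> measurable (noise n) (Pi\<^sub>M J (\<lambda>_. N))"
    unfolding \<phi>_def[abs_def] noise_def N_def[symmetric]
    by (intro measurable_restrict measurable_component_singleton) (auto simp: J_def)
  have \<phi>_distr: "distr (noise n) (Pi\<^sub>M J (\<lambda>_. N)) \<phi> = Pi\<^sub>M J (\<lambda>_. N)"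
    unfolding \<phi>_def[abs_def] noise_def N_def[symmetric]
    by (rule distr_PiM_reindex[where M = "\<lambda>_. N" and f = "\<lambda>p. (fst (fst p), snd p)"])
       (auto simp: pN J_def inj_on_def)
  interpret Nz: prob_space "noise n" by (rule prob_space_noise)
  define x where "x = codeword Q c"
  define dec where "dec = decoder a2 n M T0 T1 T2 x"
  have code: "is_code P n M (clip P n x) dec"
    unfolding dec_def by (intro is_code_clip M P)
  \<comment> \<open>The equality holds for all indices, including labels beyond the codebook: there
    both sides read the default value of an extensional function.\<close>
  have merge_code: "codeword Q (merge I J (c, z)) = x" for z
  proof (intro ext)
    fix i k t
    have "merge I J (c, z) ((i, Suc k), t) = c ((i, Suc k), t)"
    proof (cases "((i, Suc k), t) \<in> I")
      case True then show ?thesis by (simp add: merge_def)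
    next
      case False
      moreover have "((i, Suc k), t) \<notin> J" by (simp add: J_def)
      ultimately show ?thesis using c by (auto simp: merge_def space_PiM PiE_iff extensional_def)
    qed
    then show "codeword Q (merge I J (c, z)) i k t = x i k t" by (simp add: codeword_def x_def)
  qed
  have err: "Nz.prob {z \<in> space (noise n). \<exists>i<3. dec i (chan_out a1 a2 n (clip P n x) m z i) \<noteq> m i} \<le> PJ.prob (D m)"
    if m: "m \<in> messages M" for m
  proof -
    have "{z \<in> space (noise n). \<exists>i<3. dec i (chan_out a1 a2 n (clip P n x) m z i) \<noteq> m i} \<subseteq> \<phi> -` D m \<inter> space (noise n)"
    proof (rule subsetI)
      fix z assume "z \<in> {z \<in> space (noise n). \<exists>i<3. dec i (chan_out a1 a2 n (clip P n x) m z i) \<noteq> m i}"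
      then obtain i where z: "z \<in> space (noise n)" and i: "i < 3"
        and ne: "dec i (chan_out a1 a2 n (clip P n x) m z i) \<noteq> m i" by blast
      have \<phi>z: "\<phi> z \<in> space (Pi\<^sub>M J (\<lambda>_. N))" using measurable_space[OF \<phi>_meas z] .
      have sp: "merge I J (c, \<phi> z) \<in> space \<Omega>" using measurable_space[OF merge_meas \<phi>z] .
      have nz: "array_noise (merge I J (c, \<phi> z)) j t = z (j, t)" if "j < 3" "t < n" for j t
      proof -
        have "((j, 0), t) \<in> J" "((j, 0), t) \<notin> I" using that by (auto simp: I_def J_def)
        then show ?thesis by (simp add: array_noise_def merge_def \<phi>_def)
      qed
      have "merge I J (c, \<phi> z) \<in> bad m"
      proof (rule ccontr)
        assume "merge I J (c, \<phi> z) \<notin> bad m"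
        then have "decodable a1 a2 P n M T0 T1 T2 m x (array_noise (merge I J (c, \<phi> z)))"
          using sp by (simp add: bad_def merge_code)
        then have "dec i (chan_out a1 a2 n (clip P n x) m z i) = m i"
          unfolding dec_def by (rule decoder_correct) (use mM[OF m] i nz in auto)
        then show False using ne by simp
      qed
      then show "z \<in> \<phi> -` D m \<inter> space (noise n)" using z \<phi>z by (simp add: D_def)
    qed
    then have "Nz.prob {z \<in> space (noise n). \<exists>i<3. dec i (chan_out a1 a2 n (clip P n x) m z i) \<noteq> m i}
       \<le> Nz.prob (\<phi> -` D m \<inter> space (noise n))"
      using \<phi>_meas D_sets[OF m] by (intro Nz.finite_measure_mono) (auto intro: measurable_sets)
    also have "\<dots> = PJ.prob (D m)"
      using measure_distr[OF \<phi>_meas D_sets[OF m]] by (simp add: \<phi>_distr)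
    finally show ?thesis .
  qed
  have "error_prob a1 a2 n M (clip P n x) dec \<le> 1 / K * (2 * (K * \<beta>))"
  proof -
    have "error_prob a1 a2 n M (clip P n x) dec
       = 1 / K * (\<Sum>m\<in>messages M. Nz.prob {z \<in> space (noise n). \<exists>i<3. dec i (chan_out a1 a2 n (clip P n x) m z i) \<noteq> m i})"
      unfolding error_prob_def K_def card_messages messages_def[symmetric] ..
    also have "\<dots> \<le> 1 / K * (\<Sum>m\<in>messages M. PJ.prob (D m))"
      using K by (intro mult_left_mono sum_mono err) auto
    also have "\<dots> \<le> 1 / K * (2 * (K * \<beta>))" using K sumD by (intro mult_left_mono) auto
    finally show ?thesis .
  qed
  also have "1 / K * (2 * (K * \<beta>)) = 2 * \<beta>" using K by simp
  finally show ?thesis using code unfolding \<beta>_def by blast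
qed

section \<open>Vanishing error and achievable rates\<close>

text \<open>Each confusion term is geometric with base the exponential of rate plus
  \<open>\<delta>\<close> minus link capacity, all in nats. User 1 has two rate conditions, one for
  each receiver that decodes its message.\<close>

lemma code_bound_tendsto_0:
  fixes R :: "nat \<Rightarrow> real"
  assumes \<delta>: "0 < \<delta>" "\<delta> < 1" and Q: "\<And>i. i < 3 \<Longrightarrow> Q i > 0" and a2: "a2 > 0"
    and R: "\<And>i. i < 3 \<Longrightarrow> R i \<ge> 0"
    and R0: "R 0 * ln 2 + \<delta> < ln (1 + Q 0) / 2"
    and R1: "R 1 * ln 2 + \<delta> < ln (1 + Q 1 / (1 + a1\<^sup>2 * Q 0)) / 2"
    and R1': "R 1 * ln 2 + \<delta> < ln (1 + a2\<^sup>2 * Q 1 / (1 + Q 2)) / 2"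
    and R2: "R 2 * ln 2 + \<delta> < ln (1 + Q 2) / 2"
  shows "(\<lambda>n. code_bound a1 a2 Q \<delta> (\<lambda>i. nat \<lceil>2 powr (real n * R i)\<rceil>) n) \<longlonglongrightarrow> 0"
proof -
  have Qs: "Q 0 > 0" "Q 1 > 0" "Q 2 > 0" using Q by auto
  have link: "(\<lambda>n. real (nat \<lceil>2 powr (real n * r)\<rceil>) * (exp \<delta> * sqrt (N / (S + N))) ^ n) \<longlonglongrightarrow> 0"
    if S: "S > 0" and N: "N > 0" and r: "r \<ge> 0" and rate: "r * ln 2 + \<delta> < ln (1 + S / N) / 2" for r S N :: real
  proof -
    define b where "b = exp (r * ln 2) * (exp \<delta> * sqrt (N / (S + N)))"
    have SN: "1 + S / N > 0" using S N by (simp add: add_pos_pos)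
    have sq: "sqrt (N / (S + N)) = exp (- (ln (1 + S / N) / 2))"
    proof (rule real_sqrt_unique)
      have "(exp (- (ln (1 + S / N) / 2)))\<^sup>2 = exp (- ln (1 + S / N))"
        by (simp flip: exp_of_nat_mult)
      also have "\<dots> = N / (S + N)" using S N SN by (simp add: exp_minus field_simps)
      finally show "(exp (- (ln (1 + S / N) / 2)))\<^sup>2 = N / (S + N)" .
    qed simp
    have "b = exp (r * ln 2 + \<delta> - ln (1 + S / N) / 2)"
      unfolding b_def sq by (simp flip: exp_add)
    then have b: "0 \<le> b" "b < 1" using rate by auto
    \<comment> \<open>Rounding up at most doubles the codebook size, since
      \<open>2 powr (real n * r)\<close> is at least 1 for a nonnegative rate.\<close>
    have bound: "real (nat \<lceil>2 powr (real n * r)\<rceil>) * (exp \<delta> * sqrt (N / (S + N))) ^ n \<le> 2 * b ^ n" for n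
    proof -
      have e: "2 powr (real n * r) = exp (r * ln 2) ^ n"
        by (simp add: powr_def mult_ac flip: exp_of_nat_mult)
      have "2 powr (real n * r) \<ge> 1" using r by (intro ge_one_powr_ge_zero) auto
      then have "real (nat \<lceil>2 powr (real n * r)\<rceil>) \<le> 2 * exp (r * ln 2) ^ n"
        unfolding e[symmetric] by linarith
      then have "real (nat \<lceil>2 powr (real n * r)\<rceil>) * (exp \<delta> * sqrt (N / (S + N))) ^ n
          \<le> 2 * exp (r * ln 2) ^ n * (exp \<delta> * sqrt (N / (S + N))) ^ n"
        using S N by (intro mult_right_mono) auto
      also have "\<dots> = 2 * b ^ n" by (simp add: b_def power_mult_distrib)
      finally show ?thesis .
    qed
    have lim: "(\<lambda>n. 2 * b ^ n) \<longlonglongrightarrow> 0"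
      using tendsto_mult_right_zero[OF LIMSEQ_realpow_zero[OF b], of 2] .
    have nonneg: "0 \<le> real (nat \<lceil>2 powr (real n * r)\<rceil>) * (exp \<delta> * sqrt (N / (S + N))) ^ n" for n
      using S N by (intro mult_nonneg_nonneg zero_le_power of_nat_0_le_iff) auto
    show ?thesis
      by (rule tendsto_sandwich[OF always_eventually[OF allI[OF nonneg]] always_eventually[OF allI[OF bound]] tendsto_const lim])
  qed
  have u: "sqrt ((1 + \<delta>) * exp (- \<delta>)) < 1"
  proof -
    have "1 + \<delta> < exp \<delta>" using exp_minus_greater[of "- \<delta>"] \<delta> by simp
    then show ?thesis by (simp add: exp_minus field_simps)
  qed
  have v: "sqrt ((1 - \<delta>) * exp \<delta>) < 1"
  proof -
    have "1 - \<delta> < exp (- \<delta>)" using exp_minus_greater[of \<delta>] \<delta> by simp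
    then show ?thesis by (simp add: exp_minus field_simps)
  qed
  have lim_u: "(\<lambda>n. 7 * sqrt ((1 + \<delta>) * exp (- \<delta>)) ^ n) \<longlonglongrightarrow> 0"
    using \<delta> u by (intro tendsto_mult_right_zero LIMSEQ_realpow_zero) auto
  have lim_v: "(\<lambda>n. 4 * sqrt ((1 - \<delta>) * exp \<delta>) ^ n) \<longlonglongrightarrow> 0"
    using \<delta> v by (intro tendsto_mult_right_zero LIMSEQ_realpow_zero) auto
  have N1: "1 + a1\<^sup>2 * Q 0 > 0" using Qs by (intro add_pos_nonneg) auto
  have R1p: "R 1 \<ge> 0" using R[of 1] by simp
  have l0: "(\<lambda>n. real (nat \<lceil>2 powr (real n * R 0)\<rceil>) * (exp \<delta> * sqrt (1 / (Q 0 + 1))) ^ n) \<longlonglongrightarrow> 0"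
    using Qs R R0 by (intro link) auto
  have l1: "(\<lambda>n. real (nat \<lceil>2 powr (real n * R 1)\<rceil>) * (exp \<delta> * sqrt ((1 + a1\<^sup>2 * Q 0) / (Q 1 + (1 + a1\<^sup>2 * Q 0)))) ^ n) \<longlonglongrightarrow> 0"
    by (intro link Qs N1 R1p R1)
  have l2: "(\<lambda>n. real (nat \<lceil>2 powr (real n * R 1)\<rceil>) * (exp \<delta> * sqrt ((1 + Q 2) / (a2\<^sup>2 * Q 1 + (1 + Q 2)))) ^ n) \<longlonglongrightarrow> 0"
    using Qs a2 by (intro link R1p R1') (auto intro: mult_pos_pos)
  have l3: "(\<lambda>n. real (nat \<lceil>2 powr (real n * R 2)\<rceil>) * (exp \<delta> * sqrt (1 / (Q 2 + 1))) ^ n) \<longlonglongrightarrow> 0"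
    using Qs R R2 by (intro link) auto
  show ?thesis
    unfolding code_bound_def
    using tendsto_add[OF tendsto_add[OF tendsto_add[OF tendsto_add[OF tendsto_add[OF lim_u lim_v] l0] l1] l2] l3] by simp
qed

text \<open>Only receiver 1's condition on user 1 is assumed; the condition at receiver 2 follows
  from \<open>strong\<close>, which says that receiver 2 hears user 1 at least as well as receiver 1
  does.\<close>

lemma achievable_below_capacity:
  fixes a1 a2 :: real and P R :: "nat \<Rightarrow> real"
  assumes P: "\<And>i. i < 3 \<Longrightarrow> P i > 0" and a2: "a2 > 0" and strong: "(1 + P 2) / (1 + a1\<^sup>2 * P 0) \<le> a2\<^sup>2"
    and R: "\<And>i. i < 3 \<Longrightarrow> R i \<ge> 0"
    and R0: "R 0 < gcap (P 0)" and R1: "R 1 < gcap (P 1 / (1 + a1\<^sup>2 * P 0))" and R2: "R 2 < gcap (P 2)"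
  shows "achievable a1 a2 P R"
proof -
  have Ps: "P 0 > 0" "P 1 > 0" "P 2 > 0" using P by auto
  have B: "1 + a1\<^sup>2 * P 0 > 0" using Ps by (intro add_pos_nonneg) auto
  \<comment> \<open>\<open>\<delta>\<close> acts twice, as reduction of the power and as loss in the
    exponent. Both vanish as \<open>\<delta>\<close> tends to 0 from above, so a strict rate gap
    survives for small \<open>\<delta>\<close>.\<close>
  have ev: "\<forall>\<^sub>F \<delta> in at_right 0. r * ln 2 + \<delta> < ln (1 + s / (1 + \<delta>)) / 2" if "s > 0" "r < gcap s" for r s
  proof -
    have "((\<lambda>\<delta>. ln (1 + s / (1 + \<delta>)) / 2 - (r * ln 2 + \<delta>)) \<longlongrightarrow> ln (1 + s / (1 + 0)) / 2 - (r * ln 2 + 0)) (at_right 0)"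
      using that by (intro tendsto_intros) auto
    moreover have "ln (1 + s / (1 + 0)) / 2 - (r * ln 2 + 0) > 0"
      using that by (simp add: gcap_eq field_simps)
    ultimately have "\<forall>\<^sub>F \<delta> in at_right 0. 0 < ln (1 + s / (1 + \<delta>)) / 2 - (r * ln 2 + \<delta>)"
      by (rule order_tendstoD)
    then show ?thesis by eventually_elim simp
  qed
  have S1: "P 1 / (1 + a1\<^sup>2 * P 0) > 0" using Ps B by simp
  have "\<forall>\<^sub>F \<delta> in at_right (0::real). 0 < \<delta> \<and> \<delta> < 1"
    unfolding eventually_at_right_field by (intro exI[of _ 1]) auto
  with ev[OF Ps(1) R0] ev[OF S1 R1] ev[OF Ps(3) R2]
  have "\<forall>\<^sub>F \<delta> in at_right (0::real). (0 < \<delta> \<and> \<delta> < 1) \<and> R 0 * ln 2 + \<delta> < ln (1 + P 0 / (1 + \<delta>)) / 2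
      \<and> R 1 * ln 2 + \<delta> < ln (1 + P 1 / (1 + a1\<^sup>2 * P 0) / (1 + \<delta>)) / 2 \<and> R 2 * ln 2 + \<delta> < ln (1 + P 2 / (1 + \<delta>)) / 2"
    by eventually_elim simp
  then obtain \<delta> where \<delta>: "0 < \<delta>" "\<delta> < 1" and r0: "R 0 * ln 2 + \<delta> < ln (1 + P 0 / (1 + \<delta>)) / 2"
      and r1: "R 1 * ln 2 + \<delta> < ln (1 + P 1 / (1 + a1\<^sup>2 * P 0) / (1 + \<delta>)) / 2"
      and r2: "R 2 * ln 2 + \<delta> < ln (1 + P 2 / (1 + \<delta>)) / 2"
    using eventually_happens[of _ "at_right (0::real)"] by auto
  define Q where "Q = (\<lambda>i. P i / (1 + \<delta>))"
  have Q: "Q i > 0" if "i < 3" for i using P[OF that] \<delta> by (simp add: Q_def)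
  have QP: "Q i \<le> P i" if "i < 3" for i using P[OF that] \<delta> by (simp add: Q_def field_simps)
  have Qs: "Q 0 > 0" "Q 1 > 0" "Q 2 > 0" "Q 0 \<le> P 0" "Q 2 \<le> P 2" using Q QP by auto
  have rq: "P 1 / (1 + a1\<^sup>2 * P 0) / (1 + \<delta>) = Q 1 / (1 + a1\<^sup>2 * P 0)" by (simp add: Q_def)
  \<comment> \<open>Reducing the power of user 0 can only lower the interference, so the bound with
    interference at full power \<open>P 0\<close> suffices.\<close>
  have weak_ineq: "Q 1 / (1 + a1\<^sup>2 * P 0) \<le> Q 1 / (1 + a1\<^sup>2 * Q 0)"
  proof (rule divide_left_mono)
    show "1 + a1\<^sup>2 * Q 0 \<le> 1 + a1\<^sup>2 * P 0" using Qs by (intro add_left_mono mult_left_mono) auto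
    show "0 < (1 + a1\<^sup>2 * P 0) * (1 + a1\<^sup>2 * Q 0)" using Qs B by (intro mult_pos_pos add_pos_nonneg) auto
  qed (use Qs in auto)
  \<comment> \<open>The reduced own power \<open>Q 2\<close> again only lowers the noise of the
    first stage, so \<open>strong\<close> at full powers carries over.\<close>
  have strong_ineq: "Q 1 / (1 + a1\<^sup>2 * P 0) \<le> a2\<^sup>2 * Q 1 / (1 + Q 2)"
  proof -
    have "1 / (1 + a1\<^sup>2 * P 0) \<le> a2\<^sup>2 / (1 + P 2)"
      using strong B Ps by (simp add: field_simps)
    also have "\<dots> \<le> a2\<^sup>2 / (1 + Q 2)"
      using Qs Ps by (intro divide_left_mono) auto
    finally have "Q 1 * (1 / (1 + a1\<^sup>2 * P 0)) \<le> Q 1 * (a2\<^sup>2 / (1 + Q 2))"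
      using Qs by (intro mult_left_mono) auto
    then show ?thesis by (simp add: mult.commute)
  qed
  have mono: "ln (1 + s) / 2 \<le> ln (1 + s') / 2" if "0 < s" "s \<le> s'" for s s' :: real
    using that by simp
  have s0: "0 < Q 1 / (1 + a1\<^sup>2 * P 0)" using Qs B by simp
  have q0: "R 0 * ln 2 + \<delta> < ln (1 + Q 0) / 2" using r0 by (simp add: Q_def)
  have q1: "R 1 * ln 2 + \<delta> < ln (1 + Q 1 / (1 + a1\<^sup>2 * Q 0)) / 2"
    using r1 mono[OF s0 weak_ineq] unfolding rq by linarith
  have q1': "R 1 * ln 2 + \<delta> < ln (1 + a2\<^sup>2 * Q 1 / (1 + Q 2)) / 2"
    using r1 mono[OF s0 strong_ineq] unfolding rq by linarith
  have q2: "R 2 * ln 2 + \<delta> < ln (1 + Q 2) / 2" using r2 by (simp add: Q_def)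
  note lim = code_bound_tendsto_0[of \<delta> Q a2 R a1, OF \<delta> Q a2 R q0 q1 q1' q2]
  show ?thesis
    unfolding achievable_def
  proof (intro conjI allI impI)
    fix i :: nat assume "i < 3" then show "R i \<ge> 0" by (rule R)
  next
    fix \<epsilon> :: real assume \<epsilon>: "\<epsilon> > 0"
    from order_tendstoD(2)[OF lim, of "\<epsilon> / 2"] \<epsilon>
    obtain N0 where N0: "\<And>n. n \<ge> N0 \<Longrightarrow> code_bound a1 a2 Q \<delta> (\<lambda>i. nat \<lceil>2 powr (real n * R i)\<rceil>) n < \<epsilon> / 2"
      unfolding eventually_sequentially by auto
    show "\<exists>N. \<forall>n\<ge>N. \<exists>M enc dec. is_code P n M enc dec \<and>
        (\<forall>i<3. real (M i) \<ge> 2 powr (real n * R i)) \<and> error_prob a1 a2 n M enc dec \<le> \<epsilon>"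
    proof (intro exI[of _ "max 1 N0"] allI impI)
      fix n assume n: "max 1 N0 \<le> n"
      define M where "M = (\<lambda>i. nat \<lceil>2 powr (real n * R i)\<rceil>)"
      have n0: "n > 0" using n by simp
      have pos: "\<lceil>2 powr (real n * R i)\<rceil> > 0" for i by simp
      have M1: "M i \<ge> 1" for i using pos[of i] unfolding M_def by linarith
      have rate: "2 powr (real n * R i) \<le> real (M i)" for i
        unfolding M_def by (rule real_nat_ceiling_ge)
      from random_code_exists[of n P a2 \<delta> M a1, OF n0 P a2 \<delta> M1]
      obtain enc dec where "is_code P n M enc dec" "error_prob a1 a2 n M enc dec \<le> 2 * code_bound a1 a2 Q \<delta> M n"
        unfolding Q_def by blast
      moreover have "2 * code_bound a1 a2 Q \<delta> M n \<le> \<epsilon>"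
        using N0[of n] n unfolding M_def by simp
      ultimately show "\<exists>M enc dec. is_code P n M enc dec \<and>
        (\<forall>i<3. real (M i) \<ge> 2 powr (real n * R i)) \<and> error_prob a1 a2 n M enc dec \<le> \<epsilon>"
        using rate by (intro exI[of _ M] exI[of _ enc] exI[of _ dec]) auto
    qed
  qed
qed

section \<open>The sum capacity\<close>

theorem theorem3:
  fixes a1 a2 :: real and P :: "nat \<Rightarrow> real"
  assumes "P 0 > 0" and "P 1 > 0" and "P 2 > 0"
    and "a1 \<ge> 0" and "a2 \<ge> 0"
    and "a1 < 1"
    and "sqrt ((1 + P 2) / (1 + a1\<^sup>2 * P 0)) \<le> a2"
    and "a2 < sqrt (1 + P 2)"
  shows "sum_capacity a1 a2 P
           = ereal (gcap (P 0) + gcap (P 1 / (1 + a1\<^sup>2 * P 0)) + gcap (P 2))"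
proof -
  define C where "C = gcap (P 0) + gcap (P 1 / (1 + a1\<^sup>2 * P 0)) + gcap (P 2)"
  have B: "1 + a1\<^sup>2 * P 0 > 0" using assms(1) by (intro add_pos_nonneg) auto
  have ratio: "(1 + P 2) / (1 + a1\<^sup>2 * P 0) > 0" using B assms(3) by simp
  have a2: "a2 > 0" using ratio assms(7) by (meson less_le_trans real_sqrt_gt_zero)
  have strong: "(1 + P 2) / (1 + a1\<^sup>2 * P 0) \<le> a2\<^sup>2"
    using assms(7) ratio by (simp add: real_sqrt_le_iff sqrt_le_D)
  have P: "P i > 0" if "i < 3" for i
  proof -
    have "i = 0 \<or> i = 1 \<or> i = 2" using that by linarith
    then show ?thesis using assms(1-3) by auto
  qed
  have gpos: "gcap s > 0" if "s > 0" for s using that by (simp add: gcap_eq)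
  have S1: "P 1 / (1 + a1\<^sup>2 * P 0) > 0" using B assms(2) by simp
  define c :: "nat \<Rightarrow> real" where "c i = (if i = 0 then gcap (P 0) else if i = 1 then gcap (P 1 / (1 + a1\<^sup>2 * P 0)) else gcap (P 2))" for i
  have cpos: "c i > 0" for i unfolding c_def using gpos assms(1,3) S1 by simp
  \<comment> \<open>Scaling the corner point by \<open>\<theta> < 1\<close> makes all three rates
    strictly smaller than their limits; the supremum is approached as \<open>\<theta>\<close> tends
    to 1.\<close>
  have ach: "achievable a1 a2 P (\<lambda>i. \<theta> * c i)" if "0 < \<theta>" "\<theta> < 1" for \<theta>
  proof (rule achievable_below_capacity[OF P a2 strong])
    have lt: "\<theta> * c i < c i" for i using that cpos[of i] by simp
    show "\<theta> * c 0 < gcap (P 0)" "\<theta> * c 1 < gcap (P 1 / (1 + a1\<^sup>2 * P 0))" "\<theta> * c 2 < gcap (P 2)"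
      using lt[of 0] lt[of 1] lt[of 2] by (simp_all add: c_def)
    show "\<theta> * c i \<ge> 0" for i using that cpos[of i] by simp
  qed
  have Cc: "C = c 0 + c 1 + c 2" by (simp add: C_def c_def)
  have C: "C > 0" unfolding Cc using cpos[of 0] cpos[of 1] cpos[of 2] by linarith
  have "sum_capacity a1 a2 P = ereal C"
    unfolding sum_capacity_def
  proof (rule Sup_eqI)
    fix y assume "y \<in> {ereal (R 0 + R 1 + R 2) | R. achievable a1 a2 P R}"
    then show "y \<le> ereal C"
      using sum_rate_converse[OF assms(1-4,6)] by (auto simp: C_def)
  next
    fix y assume y: "\<And>z. z \<in> {ereal (R 0 + R 1 + R 2) | R. achievable a1 a2 P R} \<Longrightarrow> z \<le> y"
    have up: "ereal (\<theta> * C) \<le> y" if "0 < \<theta>" "\<theta> < 1" for \<theta>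
    proof (rule y, intro CollectI exI conjI)
      show "achievable a1 a2 P (\<lambda>i. \<theta> * c i)" by (rule ach[OF that])
      show "ereal (\<theta> * C) = ereal (\<theta> * c 0 + \<theta> * c 1 + \<theta> * c 2)" by (simp add: Cc distrib_left)
    qed
    show "ereal C \<le> y"
    proof (rule ereal_le_epsilon2)
      fix e :: real assume e: "e > 0"
      \<comment> \<open>\<open>1 - e / C\<close> loses exactly \<open>e\<close> from the sum rate;
        the maximum with 1/2 keeps \<open>\<theta>\<close> positive when \<open>e\<close> is at
        least \<open>C\<close>.\<close>
      define \<theta> where "\<theta> = max (1 / 2) (1 - e / C)"
      have \<theta>: "0 < \<theta>" "\<theta> < 1" using e C by (auto simp: \<theta>_def)
      have "(1 - e / C) * C \<le> \<theta> * C" using C by (intro mult_right_mono) (auto simp: \<theta>_def)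
      then have "C \<le> \<theta> * C + e" using C by (simp add: left_diff_distrib)
      then have "ereal C \<le> ereal (\<theta> * C) + ereal e" by simp
      also have "\<dots> \<le> y + ereal e" using up[OF \<theta>] by (intro add_right_mono)
      finally show "ereal C \<le> y + ereal e" .
    qed
  qed
  then show ?thesis by (simp add: C_def)
qed

end
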